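(* Let $c_1,\ldots,c_n\in\mathbb{P}^3$ be distinct points, let $C_i$ be the pinhole camera (congruence of lines) with center $c_i$, and let $A_1,\ldots,A_n$ be $3\times 4$-matrices of rank $3$ such that the kernel of $A_i$ is spanned by $c_i$. Let $B_i$ be the $6\times 3$-matrix with $x\vee c_i=B_iA_ix$ for all $x$. Then the multi-view variety of the photographic cameras $A_1,\ldots,A_n$ is isomorphic to the multi-image variety $M(C_1,\ldots,C_n)$ under the map $$(\mathbb{P}^2)^n\to\mathrm{Gr}(1,\mathbb{P}^3)^n,\qquad (u_1,\ldots,u_n)\mapsto(B_1u_1,\ldots,B_nu_n).$$ Moreover, the equation $M(C_1,\ldots,C_n)=V_n\cap(C_1\times\cdots\times C_n)$ holds ideal-theoretically, i.e., the prime ideal of the multi-view variety is the image of the ideal $I_n$ of the concurrent lines variety $V_n$ modulo the linear equations $P_1c_1=\cdots=P_nc_n=0$ that define $C_1\times\cdots\times C_n$.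
   Context: Work over $\mathbb{C}$. A line through points $x,y\in\mathbb{P}^3$ has Plücker coordinate vector $x\vee y=(p_{01}:p_{02}:p_{03}:p_{12}:p_{13}:p_{23})\in\mathbb{P}^5$ with $p_{ij}=x_iy_j-x_jy_i$; $\mathrm{Gr}(1,\mathbb{P}^3)\subset\mathbb{P}^5$ is the set of all lines. To Plücker coordinates $p$ one associates $$P=\begin{bmatrix} 0 & p_{23} & -p_{13} & p_{12} \\ -p_{23} & 0 & p_{03} & -p_{02} \\ {p_{13}} & -p_{03} & 0 & p_{01} \\ -p_{12} & p_{02} & -p_{01} & 0 \end{bmatrix},$$ and $x$ lies on the line $p$ iff $Px=0$. $P_1,\ldots,P_n$ denote $n$ such matrices of unknowns, one for each factor of $(\mathbb{P}^5)^n$. The pinhole camera $C_i$ with center $c_i$ is the set of all lines through $c_i$, a plane in $\mathrm{Gr}(1,\mathbb{P}^3)\subset\mathbb{P}^5$ given by $P_ic_i=0$, with associated map $x\mapsto C_i(x)=x\vee c_i$. The multi-image variety $M(C_1,\ldots,C_n)$ is the Zariski closure in $(\mathbb{P}^5)^n$ of the image of $x\mapsto(C_1(x),\ldots,C_n(x))$. The multi-view variety of $A_1,\ldots,A_n$ is the Zariski closure in $(\mathbb{P}^2)^n$ of the image of $\mathbb{P}^3\dashrightarrow(\mathbb{P}^2)^n$, $x\mapsto(A_1x,\ldots,A_nx)$. The concurrent lines variety $V_n\subset(\mathbb{P}^5)^n$ is the set of $n$-tuples of lines in $\mathbb{P}^3$ passing through a common point, and $I_n$ is its prime ideal in the polynomial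 ring in the $6n$ Plücker coordinates. The quotient of that ring by the linear equations $P_ic_i=0$ is the ($\mathbb{Z}^n$-graded) coordinate ring of $C_1\times\cdots\times C_n\cong(\mathbb{P}^2)^n$. *)

theory Defs
  imports
    "HOL-Analysis.Analysis"
    "HOL-Library.Poly_Mapping"
    "HOL-Algebra.Algebraic_Closure_Type"
begin

no_notation Formal_Power_Series.fps_nth (infixl \<open>$\<close> 75)

section \<open>Products of projective spaces\<close>

typedef ('d::finite) proj = "{L :: (complex^'d) set. \<exists>v. v \<noteq> 0 \<and> L = vec.span {v}}"
proof -
  have "(\<chi> i. 1) \<noteq> (0 :: complex^'d)"
    by (simp add: vec_eq_iff)
  then show ?thesis by blast
qed

text \<open>The point with homogeneous coordinate vector \<^term>\<open>v\<close>; only meaningful for \<^prop>\<open>v \<noteq> 0\<close>.\<close>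

definition proj_pt :: "complex^'d \<Rightarrow> ('d::finite) proj" where
  "proj_pt v = Abs_proj (vec.span {v})"

text \<open>The rational map given by a matrix; only meaningful at points not contained in the kernel.\<close>

definition proj_map :: "complex^'d^'e \<Rightarrow> ('d::finite) proj \<Rightarrow> ('e::finite) proj" where
  "proj_map M U = Abs_proj ((*v) M ` Rep_proj U)"

text \<open>A point of a product of projective spaces is a family \<^term>\<open>U\<close> of points; \<^term>\<open>coords U\<close>
  is the set of all its tuples of homogeneous coordinate vectors.\<close>

definition coords :: "('n \<Rightarrow> ('d::finite) proj) \<Rightarrow> ('n \<Rightarrow> complex^'d) set" where
  "coords U = {v. \<forall>i. v i \<noteq> 0 \<and> v i \<in> Rep_proj (U i)}"


section \<open>Polynomials in the homogeneous coordinates\<close>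

text \<open>The variable \<^term>\<open>(i, j)\<close> is the \<^term>\<open>j\<close>-th homogeneous coordinate in the \<^term>\<open>i\<close>-th factor.\<close>

type_synonym ('n, 'd) mpoly = "('n \<times> 'd \<Rightarrow>\<^sub>0 nat) \<Rightarrow>\<^sub>0 complex"

abbreviation mconst :: "complex \<Rightarrow> ('n, 'd) mpoly" where
  "mconst a \<equiv> Poly_Mapping.single 0 a"

abbreviation mvar :: "'n \<Rightarrow> 'd \<Rightarrow> ('n, 'd) mpoly" where
  "mvar i j \<equiv> Poly_Mapping.single (Poly_Mapping.single (i, j) 1) 1"

definition mpoly_hom ::
  "(complex \<Rightarrow> 'r::comm_ring_1) \<Rightarrow> ('n \<Rightarrow> 'd \<Rightarrow> 'r) \<Rightarrow> ('n, 'd) mpoly \<Rightarrow> 'r" where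
  "mpoly_hom h \<sigma> f = (\<Sum>m\<in>Poly_Mapping.keys f. h (Poly_Mapping.lookup f m) *
     (\<Prod>(i, j)\<in>Poly_Mapping.keys m. \<sigma> i j ^ Poly_Mapping.lookup m (i, j)))"

definition mpoly_eval :: "('n, 'd::finite) mpoly \<Rightarrow> ('n \<Rightarrow> complex^'d) \<Rightarrow> complex" where
  "mpoly_eval f v = mpoly_hom id (\<lambda>i j. v i $ j) f"

definition multihomogeneous :: "('n \<Rightarrow> nat) \<Rightarrow> ('n, 'd::finite) mpoly \<Rightarrow> bool" where
  "multihomogeneous d f \<longleftrightarrow>
     (\<forall>m\<in>Poly_Mapping.keys f. \<forall>i. (\<Sum>j\<in>UNIV. Poly_Mapping.lookup m (i, j)) = d i)"

text \<open>For a polynomial that is not multihomogeneous, vanishing at a point means vanishing at all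
  of its homogeneous coordinates, i.e. all multihomogeneous components vanish there.\<close>

definition vanishes_at :: "('n, 'd::finite) mpoly \<Rightarrow> ('n \<Rightarrow> 'd proj) \<Rightarrow> bool" where
  "vanishes_at f U \<longleftrightarrow> (\<forall>v\<in>coords U. mpoly_eval f v = 0)"

definition vanishing_ideal :: "('n \<Rightarrow> ('d::finite) proj) set \<Rightarrow> ('n, 'd) mpoly set" where
  "vanishing_ideal S = {f. \<forall>U\<in>S. vanishes_at f U}"

definition zero_locus :: "('n, 'd::finite) mpoly set \<Rightarrow> ('n \<Rightarrow> 'd proj) set" where
  "zero_locus F = {U. \<forall>f\<in>F. vanishes_at f U}"

definition zariski_closed :: "('n \<Rightarrow> ('d::finite) proj) set \<Rightarrow> bool" where
  "zariski_closed Z \<longleftrightarrow> (\<exists>F. (\<forall>f\<in>F. \<exists>d. multihomogeneous d f) \<and> Z = zero_locus F)"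

definition zariski_closure :: "('n \<Rightarrow> ('d::finite) proj) set \<Rightarrow> ('n \<Rightarrow> 'd proj) set" where
  "zariski_closure S = zariski_closed hull S"


section \<open>Morphisms and isomorphisms\<close>

text \<open>Around every point, each component of the map is given by multihomogeneous polynomials
  of a common multidegree that have no common zero.\<close>

definition regular_on ::
  "('n \<Rightarrow> ('d::finite) proj) set \<Rightarrow> (('n \<Rightarrow> 'd proj) \<Rightarrow> ('m \<Rightarrow> ('e::finite) proj)) \<Rightarrow> bool" where
  "regular_on S \<phi> \<longleftrightarrow>
     (\<forall>U\<in>S. \<exists>Z (F :: 'm \<Rightarrow> 'e \<Rightarrow> ('n, 'd) mpoly).
        zariski_closed Z \<and> U \<notin> Z \<and>
        (\<forall>k. \<exists>d. \<forall>j. multihomogeneous d (F k j)) \<and>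
        (\<forall>W\<in>S - Z. \<forall>v\<in>coords W. \<forall>k.
           (\<chi> j. mpoly_eval (F k j) v) \<noteq> 0 \<and>
           \<phi> W k = proj_pt (\<chi> j. mpoly_eval (F k j) v)))"

definition variety_morphism ::
  "('n \<Rightarrow> ('d::finite) proj) set \<Rightarrow> ('m \<Rightarrow> ('e::finite) proj) set \<Rightarrow>
     (('n \<Rightarrow> 'd proj) \<Rightarrow> ('m \<Rightarrow> 'e proj)) \<Rightarrow> bool" where
  "variety_morphism S T \<phi> \<longleftrightarrow> \<phi> ` S \<subseteq> T \<and> regular_on S \<phi>"

definition variety_isomorphism ::
  "('n \<Rightarrow> ('d::finite) proj) set \<Rightarrow> ('m \<Rightarrow> ('e::finite) proj) set \<Rightarrow>
     (('n \<Rightarrow> 'd proj) \<Rightarrow> ('m \<Rightarrow> 'e proj)) \<Rightarrow> bool" where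
  "variety_isomorphism S T \<phi> \<longleftrightarrow> variety_morphism S T \<phi> \<and>
     (\<exists>\<psi>. variety_morphism T S \<psi> \<and> (\<forall>U\<in>S. \<psi> (\<phi> U) = U) \<and> (\<forall>W\<in>T. \<phi> (\<psi> W) = W))"


section \<open>Lines in three-space\<close>

datatype pluecker_index = P01 | P02 | P03 | P12 | P13 | P23

lemma UNIV_pluecker_index: "UNIV = {P01, P02, P03, P12, P13, P23}"
  using pluecker_index.exhaust by blast

instance pluecker_index :: finite
  by standard (simp add: UNIV_pluecker_index)

text \<open>The four coordinates are indexed by \<open>0, 1, 2, 3\<close> of the type \<^typ>\<open>4\<close> (where \<open>4 = 0\<close>),
  so the \<^const>\<open>vector\<close> function, which starts at index \<open>1\<close>, would give the wrong order.\<close>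

definition vec4 :: "'a \<Rightarrow> 'a \<Rightarrow> 'a \<Rightarrow> 'a \<Rightarrow> 'a^4" where
  "vec4 a b c d = (\<chi> i. if i = 0 then a else if i = 1 then b else if i = 2 then c else d)"

definition line_through :: "complex^4 \<Rightarrow> complex^4 \<Rightarrow> complex^pluecker_index" where
  "line_through x y = (\<chi> k. case k of
       P01 \<Rightarrow> x$0 * y$1 - x$1 * y$0
     | P02 \<Rightarrow> x$0 * y$2 - x$2 * y$0
     | P03 \<Rightarrow> x$0 * y$3 - x$3 * y$0
     | P12 \<Rightarrow> x$1 * y$2 - x$2 * y$1
     | P13 \<Rightarrow> x$1 * y$3 - x$3 * y$1
     | P23 \<Rightarrow> x$2 * y$3 - x$3 * y$2)"

definition pluecker_matrix :: "'a::comm_ring_1^pluecker_index \<Rightarrow> 'a^4^4" where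
  "pluecker_matrix p = vec4
     (vec4 0          (p$P23)    (- (p$P13)) (p$P12))
     (vec4 (- (p$P23)) 0         (p$P03)     (- (p$P02)))
     (vec4 (p$P13)    (- (p$P03)) 0          (p$P01))
     (vec4 (- (p$P12)) (p$P02)   (- (p$P01)) 0)"

text \<open>The line with Pluecker coordinates \<^term>\<open>p\<close> is the kernel of \<^term>\<open>pluecker_matrix p\<close>.\<close>

lemma pluecker_matrix_line_through:
  "pluecker_matrix (line_through x y) *v x = 0" "pluecker_matrix (line_through x y) *v y = 0"
proof -
  have "(4::4) = 0" by simp
  then have "z $ 4 = z $ 0" for z :: "complex^4" by (rule arg_cong)
  then show "pluecker_matrix (line_through x y) *v x = 0" "pluecker_matrix (line_through x y) *v y = 0"
    by (simp_all add: vec_eq_iff forall_4 matrix_vector_mult_def sum_4 pluecker_matrix_def vec4_def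
        line_through_def algebra_simps)
qed

definition Gr :: "pluecker_index proj set" where
  "Gr = {proj_pt (line_through x y) | x y. x \<noteq> 0 \<and> y \<noteq> 0 \<and> proj_pt x \<noteq> proj_pt y}"

definition on_line :: "4 proj \<Rightarrow> pluecker_index proj \<Rightarrow> bool" where
  "on_line U L \<longleftrightarrow> (\<forall>x\<in>Rep_proj U. \<forall>p\<in>Rep_proj L. pluecker_matrix p *v x = 0)"

definition concurrent_lines :: "('n \<Rightarrow> pluecker_index proj) set" where
  "concurrent_lines = {L. (\<forall>i. L i \<in> Gr) \<and> (\<exists>U. \<forall>i. on_line U (L i))}"


section \<open>Cameras\<close>

definition pinhole_camera :: "complex^4 \<Rightarrow> pluecker_index proj set" where
  "pinhole_camera c = {L \<in> Gr. on_line (proj_pt c) L}"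

definition multi_image_variety :: "('n \<Rightarrow> complex^4) \<Rightarrow> ('n \<Rightarrow> pluecker_index proj) set" where
  "multi_image_variety c = zariski_closure
     {\<lambda>i. proj_pt (line_through x (c i)) | x. x \<noteq> 0 \<and> (\<forall>i. proj_pt x \<noteq> proj_pt (c i))}"

definition multi_view_variety :: "('n \<Rightarrow> complex^4^3) \<Rightarrow> ('n \<Rightarrow> 3 proj) set" where
  "multi_view_variety A = zariski_closure
     {\<lambda>i. proj_pt (A i *v x) | x. x \<noteq> 0 \<and> (\<forall>i. A i *v x \<noteq> 0)}"

text \<open>The ideal generated by the entries of all the \<open>P\<^sub>i c\<^sub>i\<close>, where \<open>P\<^sub>i\<close> is the matrix of unknowns.\<close>

definition camera_ideal :: "('n \<Rightarrow> complex^4) \<Rightarrow> ('n, pluecker_index) mpoly set" where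
  "camera_ideal c = genideal ring_of_type_algebra
     {(pluecker_matrix (\<chi> k. mvar i k) *v (\<chi> a. mconst (c i $ a))) $ b | i b. True}"

text \<open>The substitution \<open>p\<^sub>i = B\<^sub>i u\<^sub>i\<close>. When it is onto, it identifies the quotient of the ring in
  the Pluecker coordinates by its kernel with the polynomial ring in the image coordinates.\<close>

definition line_subst ::
  "('n \<Rightarrow> complex^3^pluecker_index) \<Rightarrow> ('n, pluecker_index) mpoly \<Rightarrow> ('n, 3) mpoly" where
  "line_subst B = mpoly_hom mconst (\<lambda>i k. \<Sum>l\<in>UNIV. mconst (B i $ k $ l) * mvar i l)"

end

theory Submission
  imports Defs
begin

text \<open>Both varieties are parametrised: the multi-view ideal consists of the polynomials that vanish
  at all \<open>l\<^sub>i A\<^sub>i x\<close>, and a polynomial that vanishes at all \<open>(x \<or> y\<^sub>1, \<dots>, x \<or> y\<^sub>n)\<close> vanishes on the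
  concurrent lines. The point is to lift every element \<open>f\<close> of the multi-view ideal along
  \<open>p\<^sub>i = B\<^sub>i u\<^sub>i\<close> to a polynomial of the second kind.

  In coordinates of \<open>\<complex>\<^sup>4\<close> in general position the \<open>i\<close>-th image point is
  \<open>(X\<^sub>i, Y\<^sub>i, Z\<^sub>i) = l\<^sub>i (x\<^sub>1 - a\<^sub>i x\<^sub>0, x\<^sub>2 - b\<^sub>i x\<^sub>0, x\<^sub>3 - g\<^sub>i x\<^sub>0)\<close> with distinct \<open>a\<^sub>i\<close>.
  Two incidence relations of concurrent lines restrict to bifocal forms with leading form
  \<open>(a\<^sub>i - a\<^sub>j)(Y\<^sub>i Z\<^sub>j - Z\<^sub>i Y\<^sub>j)\<close> and to trifocal forms whose leading form is the three-term relation
  between \<open>X\<^sub>i Y\<^sub>j Y\<^sub>k\<close>, \<open>X\<^sub>j Y\<^sub>i Y\<^sub>k\<close> and \<open>X\<^sub>k Y\<^sub>i Y\<^sub>j\<close>, where \<open>X\<close> has weight \<open>0\<close> and \<open>Y\<close>, \<open>Z\<close>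
  have weight \<open>1\<close>. Modulo these every polynomial is a combination of standard monomials, which are
  linearly independent on the image: the top weight degenerates to collinear centers, where they
  become products of powers of the \<open>x\<^sub>1 - a\<^sub>i x\<^sub>0\<close>, and these are separated by the order of vanishing
  at the last relevant \<open>a\<^sub>i\<close>.\<close>

section \<open>Polynomial functions\<close>

text \<open>The multi-view ideal is never given by generators that are proved complete. The forms
  that lift make up an ideal \<open>K\<close> inside it, known only to contain the focal relations.
  Standard monomials span modulo the smaller ideal and are independent modulo the larger one, and
  this forces the two to coincide. Only distinctness of the centers is available: they may be
  collinear or coplanar. After a generic choice of coordinates the argument depends on them only
  through the pairwise different \<open>a_i\<close>, once to divide by \<open>a_i - a_j\<close> and
  once to tell orders of vanishing apart. This is why the degeneration to collinear centers loses
  nothing. Both kinds of relations are needed for the rewriting: the leading forms of the bifocal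
  ones exchange Y and Z between two factors but leave a monomial such as X_i Y_j Y_k alone; the
  trifocal ones rewrite these. The set-theoretic equation has its own obstacle. If the common point
  of the lines is one of the centers, the tuple is not the image of a point of space, and it has to
  be reached as a limit.\<close>

lemma poly_mapping_eq_sum_single:
  fixes f :: "'a \<Rightarrow>\<^sub>0 'b::comm_monoid_add"
  shows "f = (\<Sum>k\<in>Poly_Mapping.keys f. Poly_Mapping.single k (Poly_Mapping.lookup f k))"
proof (rule poly_mapping_eqI)
  fix k
  show "Poly_Mapping.lookup f k =
    Poly_Mapping.lookup (\<Sum>k\<in>Poly_Mapping.keys f. Poly_Mapping.single k (Poly_Mapping.lookup f k)) k"
    by (cases "k \<in> Poly_Mapping.keys f")
      (auto simp: lookup_sum lookup_single when_def in_keys_iff sum.delta)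
qed

lemma poly_mapping_add_induct [case_names single add]:
  fixes f :: "'a \<Rightarrow>\<^sub>0 'b::comm_monoid_add"
  assumes "\<And>k a. P (Poly_Mapping.single k a)"
    and "\<And>f g. P f \<Longrightarrow> P g \<Longrightarrow> P (f + g)"
  shows "P f"
proof -
  have "P (\<Sum>k\<in>A. Poly_Mapping.single k (h k))" if "finite A" for A h
    using that
  proof (induction A rule: finite_induct)
    case empty
    have "P (Poly_Mapping.single undefined 0)" by (rule assms(1))
    then show ?case by simp
  qed (simp add: assms)
  from this[of "Poly_Mapping.keys f" "Poly_Mapping.lookup f"] show ?thesis
    using poly_mapping_eq_sum_single[of f] by simp
qed

lemma mpoly_induct [case_names const var add mult]:
  fixes f :: "('n, 'd) mpoly"
  assumes const: "\<And>a. P (mconst a)" and var: "\<And>i j. P (mvar i j)"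
    and add: "\<And>f g. P f \<Longrightarrow> P g \<Longrightarrow> P (f + g)"
    and mult: "\<And>f g. P f \<Longrightarrow> P g \<Longrightarrow> P (f * g)"
  shows "P f"
proof (induction f rule: poly_mapping_add_induct)
  case (single m a)
  have "P (Poly_Mapping.single m 1)"
  proof (induction m rule: poly_mapping_add_induct)
    case (single x k)
    obtain i j where x: "x = (i, j)" by (cases x)
    show ?case
    proof (induction k)
      case 0
      then show ?case using const[of 1] by simp
    next
      case (Suc k)
      have "Poly_Mapping.single (Poly_Mapping.single x (Suc k)) 1 =
          mvar i j * (Poly_Mapping.single (Poly_Mapping.single x k) 1 :: ('n, 'd) mpoly)"
        by (simp add: mult_single x flip: single_add)
      then show ?case using Suc var mult by simp
    qed
  next
    case (add f g)
    have "Poly_Mapping.single (f + g) 1 =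
        Poly_Mapping.single f 1 * (Poly_Mapping.single g 1 :: ('n, 'd) mpoly)"
      by (simp add: mult_single)
    then show ?case using add mult by simp
  qed
  moreover have "Poly_Mapping.single m a = mconst a * Poly_Mapping.single m 1"
    by (simp add: mult_single)
  ultimately show ?case using const mult by simp
qed (rule add)

text \<open>The product over all variables instead of those occurring in \<open>m\<close>, which makes
  multiplicativity visible.\<close>

lemma mpoly_hom_alt:
  fixes f :: "('n::finite, 'd::finite) mpoly"
  shows "mpoly_hom h \<sigma> f = (\<Sum>m\<in>Poly_Mapping.keys f. h (Poly_Mapping.lookup f m) *
     (\<Prod>x\<in>UNIV. \<sigma> (fst x) (snd x) ^ Poly_Mapping.lookup m x))"
proof -
  have "(\<Prod>(i, j)\<in>Poly_Mapping.keys m. \<sigma> i j ^ Poly_Mapping.lookup m (i, j)) =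
      (\<Prod>x\<in>UNIV. \<sigma> (fst x) (snd x) ^ Poly_Mapping.lookup m x)" for m :: "'n \<times> 'd \<Rightarrow>\<^sub>0 nat"
    by (rule prod.mono_neutral_cong_left) (auto simp: in_keys_iff)
  then show ?thesis by (simp add: mpoly_hom_def)
qed

locale coeff_hom =
  fixes h :: "complex \<Rightarrow> 'r::comm_ring_1"
  assumes h_add: "h (a + b) = h a + h b" and h_mult: "h (a * b) = h a * h b" and h_one: "h 1 = 1"
begin

lemma h_zero: "h 0 = 0"
  using h_add[of 0 0] by simp

lemma mpoly_hom_single:
  fixes m :: "'n::finite \<times> 'd::finite \<Rightarrow>\<^sub>0 nat"
  shows "mpoly_hom h \<sigma> (Poly_Mapping.single m a) =
    h a * (\<Prod>x\<in>UNIV. \<sigma> (fst x) (snd x) ^ Poly_Mapping.lookup m x)"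
  by (simp add: mpoly_hom_alt h_zero)

lemma mpoly_hom_superset:
  fixes f :: "('n::finite, 'd::finite) mpoly"
  assumes "finite S" "Poly_Mapping.keys f \<subseteq> S"
  shows "mpoly_hom h \<sigma> f = (\<Sum>m\<in>S. h (Poly_Mapping.lookup f m) *
     (\<Prod>x\<in>UNIV. \<sigma> (fst x) (snd x) ^ Poly_Mapping.lookup m x))"
  unfolding mpoly_hom_alt
  by (rule sum.mono_neutral_left) (use assms in \<open>auto simp: in_keys_iff h_zero\<close>)

lemma mpoly_hom_add:
  fixes f g :: "('n::finite, 'd::finite) mpoly"
  shows "mpoly_hom h \<sigma> (f + g) = mpoly_hom h \<sigma> f + mpoly_hom h \<sigma> g"
proof -
  let ?S = "Poly_Mapping.keys f \<union> Poly_Mapping.keys g"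
  have "finite ?S" "Poly_Mapping.keys (f + g) \<subseteq> ?S" "Poly_Mapping.keys f \<subseteq> ?S"
      "Poly_Mapping.keys g \<subseteq> ?S"
    using Poly_Mapping.keys_add[of f g] by auto
  then show ?thesis
    by (simp add: mpoly_hom_superset[of ?S] lookup_add h_add sum.distrib algebra_simps del:
        Un_subset_iff)
qed

lemma mpoly_hom_mult:
  fixes f g :: "('n::finite, 'd::finite) mpoly"
  shows "mpoly_hom h \<sigma> (f * g) = mpoly_hom h \<sigma> f * mpoly_hom h \<sigma> g"
proof (induction f rule: poly_mapping_add_induct)
  case (single k a)
  then show ?case
  proof (induction g rule: poly_mapping_add_induct)
    case (single l b)
    then show ?case
      by (simp add: mult_single mpoly_hom_single h_mult lookup_add power_add prod.distrib)
  qed (simp add: mpoly_hom_add distrib_left)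
qed (simp add: mpoly_hom_add distrib_right)

lemma mpoly_hom_const:
  "mpoly_hom h \<sigma> (mconst a :: ('n::finite, 'd::finite) mpoly) = h a"
  by (simp add: mpoly_hom_single)

lemma mpoly_hom_var:
  "mpoly_hom h \<sigma> (mvar i j :: ('n::finite, 'd::finite) mpoly) = \<sigma> i j"
proof -
  have "(\<Prod>x\<in>UNIV. \<sigma> (fst x) (snd x) ^ Poly_Mapping.lookup (Poly_Mapping.single (i, j) (1::nat)) x) =
      (\<Prod>x\<in>UNIV. if x = (i, j) then \<sigma> i j else 1)"
    by (rule prod.cong) (auto simp: lookup_single when_def)
  then show ?thesis by (simp add: mpoly_hom_single h_one)
qed

end

interpretation eval_hom: coeff_hom id
  by standard auto

interpretation mconst_hom: coeff_hom "mconst :: complex \<Rightarrow> ('n::finite, 'd::finite) mpoly"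
  by standard (simp_all add: single_add mult_single)

lemma mpoly_eval_const [simp]: "mpoly_eval (mconst a :: ('n::finite, 'd::finite) mpoly) v = a"
  by (simp add: mpoly_eval_def eval_hom.mpoly_hom_const)

lemma mpoly_eval_var [simp]: "mpoly_eval (mvar i j :: ('n::finite, 'd::finite) mpoly) v = v i $ j"
  by (simp add: mpoly_eval_def eval_hom.mpoly_hom_var del: One_nat_def)

lemma mpoly_eval_add [simp]:
  "mpoly_eval (f + g :: ('n::finite, 'd::finite) mpoly) v = mpoly_eval f v + mpoly_eval g v"
  by (simp add: mpoly_eval_def eval_hom.mpoly_hom_add)

lemma mpoly_eval_mult [simp]:
  "mpoly_eval (f * g :: ('n::finite, 'd::finite) mpoly) v = mpoly_eval f v * mpoly_eval g v"
  by (simp add: mpoly_eval_def eval_hom.mpoly_hom_mult)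

lemma mpoly_eval_zero [simp]: "mpoly_eval (0 :: ('n::finite, 'd::finite) mpoly) v = 0"
  using mpoly_eval_const[of 0] by simp

lemma mpoly_eval_one [simp]: "mpoly_eval (1 :: ('n::finite, 'd::finite) mpoly) v = 1"
  using mpoly_eval_const[of 1] by simp

lemma mpoly_eval_uminus [simp]:
  "mpoly_eval (- f :: ('n::finite, 'd::finite) mpoly) v = - mpoly_eval f v"
  using mpoly_eval_add[of f "- f" v] by (simp add: eq_neg_iff_add_eq_0 add.commute)

lemma mpoly_eval_diff [simp]:
  "mpoly_eval (f - g :: ('n::finite, 'd::finite) mpoly) v = mpoly_eval f v - mpoly_eval g v"
  using mpoly_eval_add[of f "- g" v] by simp

lemma mpoly_eval_sum [simp]:
  "mpoly_eval (sum f S :: ('n::finite, 'd::finite) mpoly) v = (\<Sum>x\<in>S. mpoly_eval (f x) v)"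
  by (induction S rule: infinite_finite_induct) auto

lemma mpoly_eval_alt:
  "mpoly_eval (f :: ('n::finite, 'd::finite) mpoly) v = (\<Sum>m\<in>Poly_Mapping.keys f.
     Poly_Mapping.lookup f m * (\<Prod>x\<in>UNIV. (v (fst x) $ snd x) ^ Poly_Mapping.lookup m x))"
  by (simp add: mpoly_eval_def mpoly_hom_alt)

lemma line_subst_const: "line_subst B (mconst a :: ('n::finite, pluecker_index) mpoly) = mconst a"
  by (simp add: line_subst_def mconst_hom.mpoly_hom_const)

lemma line_subst_add:
  "line_subst B (f + g :: ('n::finite, pluecker_index) mpoly) = line_subst B f + line_subst B g"
  by (simp add: line_subst_def mconst_hom.mpoly_hom_add)

lemma line_subst_mult:
  "line_subst B (f * g :: ('n::finite, pluecker_index) mpoly) = line_subst B f * line_subst B g"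
  by (simp add: line_subst_def mconst_hom.mpoly_hom_mult)

lemma mpoly_eval_subst:
  "mpoly_eval (mpoly_hom mconst \<sigma> (f :: ('n::finite, 'e::finite) mpoly) :: ('m::finite,
      'd::finite) mpoly) v =
    mpoly_eval f (\<lambda>i. \<chi> j. mpoly_eval (\<sigma> i j) v)"
  by (induction f rule: mpoly_induct)
    (simp_all add: mconst_hom.mpoly_hom_const mconst_hom.mpoly_hom_var mconst_hom.mpoly_hom_add
      mconst_hom.mpoly_hom_mult del: One_nat_def)

definition linear_subst :: "('n \<Rightarrow> complex^'d^'e) \<Rightarrow> ('n, 'e) mpoly \<Rightarrow> ('n, 'd::finite) mpoly" where
  "linear_subst M = mpoly_hom mconst (\<lambda>i k. \<Sum>l\<in>UNIV. mconst (M i $ k $ l) * mvar i l)"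

lemma mpoly_eval_linear_subst [simp]:
  "mpoly_eval (linear_subst M (f :: ('n::finite, 'e::finite) mpoly)) v = mpoly_eval f (\<lambda>i. M i
      *v v i)"
  by (simp add: linear_subst_def mpoly_eval_subst matrix_vector_mult_def del: One_nat_def)

lemma mpoly_eval_line_subst [simp]:
  "mpoly_eval (line_subst B (f :: ('n::finite, pluecker_index) mpoly)) v = mpoly_eval f (\<lambda>i. B i
      *v v i)"
  by (simp add: line_subst_def mpoly_eval_subst matrix_vector_mult_def del: One_nat_def)

text \<open>Incidence relations and determinants are easier to write as functions than as
  polynomials. Closure under pointwise operations provides a polynomial with the same values
  afterwards.\<close>

definition polyfuns :: "(('n \<Rightarrow> complex^'d::finite) \<Rightarrow> complex) set" where
  "polyfuns = range (\<lambda>f :: ('n, 'd) mpoly. mpoly_eval f)"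

lemma polyfuns_iff: "F \<in> polyfuns \<longleftrightarrow> (\<exists>f :: ('n, 'd::finite) mpoly. \<forall>v. mpoly_eval f v = F v)"
  unfolding polyfuns_def image_iff fun_eq_iff by (auto simp: eq_commute)

lemma polyfuns_const [intro]: "(\<lambda>v :: 'n::finite \<Rightarrow> complex^'d::finite. a) \<in> polyfuns"
  unfolding polyfuns_iff by (intro exI[of _ "mconst a"]) simp

lemma polyfuns_var [intro]: "(\<lambda>v :: 'n::finite \<Rightarrow> complex^'d::finite. v i $ j) \<in> polyfuns"
  unfolding polyfuns_iff by (intro exI[of _ "mvar i j"]) (simp del: One_nat_def)

lemma polyfuns_add [intro]:
  fixes F G :: "('n::finite \<Rightarrow> complex^'d::finite) \<Rightarrow> complex"
  assumes "F \<in> polyfuns" "G \<in> polyfuns"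
  shows "(\<lambda>v. F v + G v) \<in> polyfuns"
proof -
  obtain f g :: "('n, 'd) mpoly" where "\<forall>v. mpoly_eval f v = F v" "\<forall>v. mpoly_eval g v = G v"
    using assms by (auto simp: polyfuns_iff)
  then show ?thesis unfolding polyfuns_iff by (intro exI[of _ "f + g"]) simp
qed

lemma polyfuns_mult [intro]:
  fixes F G :: "('n::finite \<Rightarrow> complex^'d::finite) \<Rightarrow> complex"
  assumes "F \<in> polyfuns" "G \<in> polyfuns"
  shows "(\<lambda>v. F v * G v) \<in> polyfuns"
proof -
  obtain f g :: "('n, 'd) mpoly" where "\<forall>v. mpoly_eval f v = F v" "\<forall>v. mpoly_eval g v = G v"
    using assms by (auto simp: polyfuns_iff)
  then show ?thesis unfolding polyfuns_iff by (intro exI[of _ "f * g"]) simp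
qed

lemma polyfuns_uminus [intro]:
  fixes F :: "('n::finite \<Rightarrow> complex^'d::finite) \<Rightarrow> complex"
  assumes "F \<in> polyfuns"
  shows "(\<lambda>v. - F v) \<in> polyfuns"
  using polyfuns_mult[OF polyfuns_const[of "-1"] assms] by simp

lemma polyfuns_diff [intro]:
  fixes F G :: "('n::finite \<Rightarrow> complex^'d::finite) \<Rightarrow> complex"
  assumes "F \<in> polyfuns" "G \<in> polyfuns"
  shows "(\<lambda>v. F v - G v) \<in> polyfuns"
  using polyfuns_add[OF assms(1) polyfuns_uminus[OF assms(2)]] by simp

lemma polyfuns_sum [intro]:
  fixes F :: "'x \<Rightarrow> ('n::finite \<Rightarrow> complex^'d::finite) \<Rightarrow> complex"
  assumes "\<And>x. x \<in> S \<Longrightarrow> F x \<in> polyfuns"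
  shows "(\<lambda>v. \<Sum>x\<in>S. F x v) \<in> polyfuns"
  using assms by (induction S rule: infinite_finite_induct) auto

lemma polyfuns_prod [intro]:
  fixes F :: "'x \<Rightarrow> ('n::finite \<Rightarrow> complex^'d::finite) \<Rightarrow> complex"
  assumes "\<And>x. x \<in> S \<Longrightarrow> F x \<in> polyfuns"
  shows "(\<lambda>v. \<Prod>x\<in>S. F x v) \<in> polyfuns"
  using assms by (induction S rule: infinite_finite_induct) auto

section \<open>Comparing coefficients in polynomial identities\<close>

lemma sum_power_separate:
  fixes h :: "'m \<Rightarrow> complex"
  assumes "finite M" and "\<And>s. (\<Sum>m\<in>M. h m * s ^ e m) = 0"
  shows "(\<Sum>m\<in>{m\<in>M. e m = k}. h m) = 0"
proof -
  define p where "p = (\<Sum>m\<in>M. Polynomial.monom (h m) (e m))"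
  have "poly p s = 0" for s
    using assms(2)[of s] by (simp add: p_def poly_sum poly_monom)
  then have "Polynomial.coeff p k = 0"
    using poly_all_0_iff_0[of p] by simp
  also have "Polynomial.coeff p k = (\<Sum>m\<in>M. if e m = k then h m else 0)"
    by (simp add: p_def coeff_sum)
  finally show ?thesis
    using assms(1) by (simp add: sum.inter_filter)
qed

text \<open>One variable is separated at a time, the others being frozen. Different \<open>m\<close>
  may share all exponents, so only the sum of their coefficients vanishes; this is the form in which
  scalings isolate a multidegree.\<close>

lemma sum_monomials_separate:
  fixes h :: "'m \<Rightarrow> complex" and e :: "'m \<Rightarrow> 'i \<Rightarrow> nat"
  assumes "finite I" "finite M" and "\<And>v. (\<Sum>m\<in>M. h m * (\<Prod>i\<in>I. v i ^ e m i)) = 0"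
  shows "(\<Sum>m\<in>{m\<in>M. \<forall>i\<in>I. e m i = d i}. h m) = 0"
  using assms
proof (induction I arbitrary: M h rule: finite_induct)
  case empty
  then show ?case by simp
next
  case (insert i I)
  let ?M = "{m\<in>M. e m i = d i}"
  have "(\<Sum>m\<in>?M. h m * (\<Prod>j\<in>I. v j ^ e m j)) = 0" for v :: "'i \<Rightarrow> complex"
  proof (rule sum_power_separate[OF \<open>finite M\<close>])
    fix s
    have "(\<Sum>m\<in>M. h m * (\<Prod>j\<in>insert i I. (v(i := s)) j ^ e m j)) = 0"
      by (rule insert.prems)
    moreover have "(\<Prod>j\<in>insert i I. (v(i := s)) j ^ e m j) = s ^ e m i * (\<Prod>j\<in>I. v j ^ e m j)" for m
    proof -
      have "(\<Prod>j\<in>I. (v(i := s)) j ^ e m j) = (\<Prod>j\<in>I. v j ^ e m j)"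
        using insert.hyps by (intro prod.cong) auto
      then show ?thesis using insert.hyps by simp
    qed
    ultimately show "(\<Sum>m\<in>M. h m * (\<Prod>j\<in>I. v j ^ e m j) * s ^ e m i) = 0"
      by (simp add: mult_ac)
  qed
  then have "(\<Sum>m\<in>{m\<in>?M. \<forall>j\<in>I. e m j = d j}. h m) = 0"
    using insert.prems(1) by (intro insert.IH) auto
  moreover have "{m\<in>?M. \<forall>j\<in>I. e m j = d j} = {m\<in>M. \<forall>j\<in>insert i I. e m j = d j}"
    by auto
  ultimately show ?case by simp
qed

lemma mpoly_eqI:
  fixes f g :: "('n::finite, 'd::finite) mpoly"
  assumes "\<And>v. mpoly_eval f v = mpoly_eval g v"
  shows "f = g"
proof -
  define p where "p = f - g"
  have "Poly_Mapping.lookup p d = 0" for d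
  proof -
    have "(\<Sum>m\<in>{m\<in>Poly_Mapping.keys p. \<forall>x\<in>UNIV. Poly_Mapping.lookup m x = Poly_Mapping.lookup d x}.
        Poly_Mapping.lookup p m) = 0"
    proof (rule sum_monomials_separate)
      fix v :: "'n \<times> 'd \<Rightarrow> complex"
      have "mpoly_eval p (\<lambda>i. \<chi> j. v (i, j)) = 0"
        using assms by (simp add: p_def)
      then show "(\<Sum>m\<in>Poly_Mapping.keys p. Poly_Mapping.lookup p m *
          (\<Prod>x\<in>UNIV. v x ^ Poly_Mapping.lookup m x)) = 0"
        by (simp add: mpoly_eval_alt)
    qed auto
    also have "{m\<in>Poly_Mapping.keys p. \<forall>x\<in>UNIV. Poly_Mapping.lookup m x = Poly_Mapping.lookup d x} =
        {m\<in>Poly_Mapping.keys p. m = d}"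
      by (auto intro: poly_mapping_eqI)
    also have "(\<Sum>m\<in>\<dots>. Poly_Mapping.lookup p m) = Poly_Mapping.lookup p d"
      by (cases "d \<in> Poly_Mapping.keys p") (auto simp: in_keys_iff Collect_conv_if)
    finally show ?thesis .
  qed
  then have "p = 0" by (intro poly_mapping_eqI) simp
  then show ?thesis by (simp add: p_def)
qed

section \<open>Monomials and standard monomials\<close>

text \<open>Multisets of variables make rewriting a matter of splitting off elements with
  \<open>add_mset\<close>.\<close>

definition mon_eval :: "('n \<times> 'd) multiset \<Rightarrow> ('n \<Rightarrow> complex^'d) \<Rightarrow> complex" where
  "mon_eval m w = (\<Prod>x\<in>#m. w (fst x) $ snd x)"

lemma mon_eval_empty [simp]: "mon_eval {#} w = 1"
  by (simp add: mon_eval_def)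

lemma mon_eval_add_mset [simp]: "mon_eval (add_mset x m) w = w (fst x) $ snd x * mon_eval m w"
  by (simp add: mon_eval_def)

lemma mon_eval_eq_mpoly_eval:
  "\<exists>p :: ('n::finite, 'd::finite) mpoly. \<forall>w. mon_eval m w = mpoly_eval p w"
proof (induction m)
  case empty
  show ?case by (rule exI[of _ 1]) simp
next
  case (add x m)
  then obtain p :: "('n, 'd) mpoly" where "\<forall>w. mon_eval m w = mpoly_eval p w" by blast
  then show ?case
    by (cases x) (intro exI[of _ "mvar (fst x) (snd x) * p"], simp del: One_nat_def)
qed

lemma mon_eval_eq_prod:
  fixes m :: "('n::finite \<times> 'd::finite) multiset"
  shows "mon_eval m w = (\<Prod>x\<in>UNIV. (w (fst x) $ snd x) ^ count m x)"
proof -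
  have "mon_eval m w = (\<Prod>x\<in>set_mset m. (w (fst x) $ snd x) ^ count m x)"
    by (simp add: mon_eval_def image_prod_mset_multiplicity)
  also have "\<dots> = (\<Prod>x\<in>UNIV. (w (fst x) $ snd x) ^ count m x)"
    by (rule prod.mono_neutral_left) (auto simp: not_in_iff)
  finally show ?thesis .
qed

lemma prod_power_eq_mon_eval:
  fixes e :: "'n::finite \<times> 'd::finite \<Rightarrow> nat"
  shows "\<exists>m. \<forall>w. (\<Prod>x\<in>UNIV. (w (fst x) $ snd x) ^ e x) = mon_eval m w"
proof -
  have "count (\<Sum>x\<in>UNIV. replicate_mset (e x) x) = e"
    by (rule ext) (simp add: count_sum)
  then show ?thesis
    by (intro exI[of _ "\<Sum>x\<in>UNIV. replicate_mset (e x) x"]) (simp add: mon_eval_eq_prod)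
qed

text \<open>At the first place, in the order of \<open>r\<close>, where the two differ, the smaller
  one is below its capacity \<open>d\<close> and so is zero at all later places. It is then bounded
  by the other everywhere, strictly at one place, against the equal sums. The exponents of standard
  monomials are fillings of this greedy kind.\<close>

lemma greedy_unique:
  fixes f g d :: "'n \<Rightarrow> nat" and r :: "'n \<Rightarrow> nat"
  assumes "finite S" and "inj r"
    and f: "\<And>i. i \<in> S \<Longrightarrow> f i \<le> d i" "\<And>i j. i \<in> S \<Longrightarrow> j \<in> S \<Longrightarrow> r i < r j \<Longrightarrow> 0 < f j \<Longrightarrow> f i = d i"
    and g: "\<And>i. i \<in> S \<Longrightarrow> g i \<le> d i" "\<And>i j. i \<in> S \<Longrightarrow> j \<in> S \<Longrightarrow> r i < r j \<Longrightarrow> 0 < g j \<Longrightarrow> g i = d i"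
    and sum: "sum f S = sum g S"
    and "i \<in> S"
  shows "f i = g i"
proof -
  have contra: False
    if "i \<in> S" "f i < g i" and eq: "\<And>j. j \<in> S \<Longrightarrow> r j < r i \<Longrightarrow> f j = g j"
      and f: "\<And>j. j \<in> S \<Longrightarrow> r i < r j \<Longrightarrow> 0 < f j \<Longrightarrow> f i = d i"
      and g: "g i \<le> d i" and sum: "sum f S = sum g S"
    for i and f g :: "'n \<Rightarrow> nat"
  proof -
    have "f j \<le> g j" if "j \<in> S" for j
    proof (cases "r j" "r i" rule: linorder_cases)
      case less
      then show ?thesis using eq that by simp
    next
      case equal
      then show ?thesis using \<open>inj r\<close> \<open>f i < g i\<close> by (auto dest: injD)
    next
      case greater
      then show ?thesis using f[OF that] \<open>f i < g i\<close> g by (cases "f j = 0") auto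
    qed
    then have "sum f S < sum g S"
      using \<open>finite S\<close> \<open>i \<in> S\<close> \<open>f i < g i\<close> by (intro sum_strict_mono_ex1) auto
    then show False using sum by simp
  qed
  show ?thesis
    using \<open>i \<in> S\<close>
  proof (induction "r i" arbitrary: i rule: less_induct)
    case less
    show ?case
    proof (cases "f i" "g i" rule: linorder_cases)
      case l: less
      have False
        by (rule contra[of i f g]) (use l f g sum less in auto)
      then show ?thesis ..
    next
      case equal
      then show ?thesis .
    next
      case gr: greater
      have False
        by (rule contra[of i g f]) (use gr f g sum less in auto)
      then show ?thesis ..
    qed
  qed
qed

text \<open>The determinant of \<open>w i\<close>, \<open>h j - h i\<close>, \<open>w j\<close>: the restriction of the polar form of the
  Klein quadric to lines through the centers \<open>(1, h i)\<close> and \<open>(1, h j)\<close>.\<close>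

definition bifocal :: "('n \<Rightarrow> complex^3) \<Rightarrow> 'n \<Rightarrow> 'n \<Rightarrow> ('n \<Rightarrow> complex^3) \<Rightarrow> complex" where
  "bifocal h i j w =
     w i$1 * ((h j$2 - h i$2) * w j$3 - (h j$3 - h i$3) * w j$2)
   - w i$2 * ((h j$1 - h i$1) * w j$3 - (h j$3 - h i$3) * w j$1)
   + w i$3 * ((h j$1 - h i$1) * w j$2 - (h j$2 - h i$2) * w j$1)"

text \<open>Projecting three concurrent lines from a point gives three concurrent lines in a plane, so
  their coordinates \<open>p\<^sub>0\<^sub>1\<close>, \<open>p\<^sub>0\<^sub>s\<close>, \<open>p\<^sub>1\<^sub>s\<close> have determinant \<open>0\<close>; \<open>trifocal\<close> is the polarisation in \<open>s\<close>.
  On a line through the center \<open>(1, h l)\<close> the coordinate \<open>p\<^sub>1\<^sub>t\<close> is \<open>q l\<close>.\<close>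

definition trifocal_part ::
  "('n \<Rightarrow> complex^3) \<Rightarrow> 3 \<Rightarrow> 3 \<Rightarrow> 'n \<Rightarrow> 'n \<Rightarrow> 'n \<Rightarrow> ('n \<Rightarrow> complex^3) \<Rightarrow> complex" where
  "trifocal_part h s t i j k w =
     (let q = (\<lambda>l. h l$1 * w l$t - h l$t * w l$1) in
        w i$1 * (w j$s * q k - w k$s * q j)
      - w j$1 * (w i$s * q k - w k$s * q i)
      + w k$1 * (w i$s * q j - w j$s * q i))"

definition trifocal ::
  "('n \<Rightarrow> complex^3) \<Rightarrow> 3 \<Rightarrow> 3 \<Rightarrow> 'n \<Rightarrow> 'n \<Rightarrow> 'n \<Rightarrow> ('n \<Rightarrow> complex^3) \<Rightarrow> complex" where
  "trifocal h s t i j k w = trifocal_part h s t i j k w + trifocal_part h t s i j k w"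

section \<open>Rewriting to standard monomials modulo the focal relations\<close>

lemma wf_measures_induct [consumes 0, case_names less]:
  assumes "\<And>x. (\<And>y. (y, x) \<in> measures fs \<Longrightarrow> P y) \<Longrightarrow> P x"
  shows "P x"
  using wf_measures[of fs] assms by (rule wf_induct_rule)

text \<open>The coordinates \<open>1\<close>, \<open>2\<close>, \<open>3\<close> of \<open>w i\<close> are \<open>X\<^sub>i\<close>, \<open>Y\<^sub>i\<close>, \<open>Z\<^sub>i\<close>; \<open>r\<close> is an arbitrary order of
  the factors.\<close>

locale focal_ideal =
  fixes h :: "'n::finite \<Rightarrow> complex^3" and r :: "'n \<Rightarrow> nat"
    and K :: "(('n \<Rightarrow> complex^3) \<Rightarrow> complex) set"
  assumes inj_r: "inj r"
    and inj_h: "inj (\<lambda>i. h i $ 1)"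
    and K_zero: "(\<lambda>w. 0) \<in> K"
    and K_add: "f \<in> K \<Longrightarrow> g \<in> K \<Longrightarrow> (\<lambda>w. f w + g w) \<in> K"
    and K_mult: "f \<in> K \<Longrightarrow> (\<lambda>w. mpoly_eval (p :: ('n, 3) mpoly) w * f w) \<in> K"
    and bifocal_K: "i \<noteq> j \<Longrightarrow> bifocal h i j \<in> K"
    and trifocal_K: "s \<noteq> 1 \<Longrightarrow> t \<noteq> 1 \<Longrightarrow> i \<noteq> j \<Longrightarrow> i \<noteq> k \<Longrightarrow> j \<noteq> k \<Longrightarrow> trifocal h s t i j k \<in> K"
    and K_vanish: "f \<in> K \<Longrightarrow> f (\<lambda>i. l i *s (y - x0 *s h i)) = 0"
begin

lemma h_neq: "i \<noteq> j \<Longrightarrow> h i $ 1 \<noteq> h j $ 1"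
  using inj_h by (auto dest: injD)

lemma K_mult_mon_eval: "f \<in> K \<Longrightarrow> (\<lambda>w. mon_eval m w * f w) \<in> K"
  using mon_eval_eq_mpoly_eval[of m] K_mult[of f] by (elim exE) simp

lemma K_smult: "f \<in> K \<Longrightarrow> (\<lambda>w. a * f w) \<in> K"
  using K_mult[of f "mconst a"] by simp

definition has_inversion :: "('n \<times> 3) multiset \<Rightarrow> bool" where
  "has_inversion m \<longleftrightarrow> (\<exists>i j. r i < r j \<and> (i, 3) \<in># m \<and> (j, 2) \<in># m)"

text \<open>In such a triple the three-term relation can move the X away from the earliest factor.
  Without them, the Y and Z fill the factors before the last one they reach greedily.\<close>

definition has_bad_triple :: "('n \<times> 3) multiset \<Rightarrow> bool" where
  "has_bad_triple m \<longleftrightarrow> (\<exists>i j k s t. r i < r j \<and> r j < r k \<and> s \<noteq> 1 \<and> t \<noteq> 1 \<and>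
     (i, 1) \<in># m \<and> (j, s) \<in># m \<and> (k, t) \<in># m)"

definition standard :: "('n \<times> 3) multiset set" where
  "standard = {m. \<not> has_inversion m \<and> \<not> has_bad_triple m}"

text \<open>The coefficients are required to vanish off \<open>M\<close> so that two representations
  can be added over the union of their supports.\<close>

definition reducible :: "(('n \<Rightarrow> complex^3) \<Rightarrow> complex) set" where
  "reducible = {f. \<exists>k\<in>K. \<exists>M c. finite M \<and> M \<subseteq> standard \<and> (\<forall>m. m \<notin> M \<longrightarrow> c m = 0) \<and>
     f = (\<lambda>w. k w + (\<Sum>m\<in>M. c m * mon_eval m w))}"

lemma reducible_cong: "f \<in> reducible \<Longrightarrow> (\<And>w. f w = g w) \<Longrightarrow> g \<in> reducible"
  by (metis ext)

lemma K_reducible: "f \<in> K \<Longrightarrow> f \<in> reducible"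
  unfolding reducible_def by (intro CollectI bexI[of _ f] exI[of _ "{}"] exI[of _ "\<lambda>_. 0"]) auto

lemma standard_reducible:
  assumes "m \<in> standard"
  shows "mon_eval m \<in> reducible"
  unfolding reducible_def
  by (intro CollectI bexI[of _ "\<lambda>_. 0"] exI[of _ "{m}"] exI[of _ "\<lambda>m'. if m' = m then 1 else 0"])
    (use assms K_zero in auto)

lemma reducible_add:
  assumes "f \<in> reducible" "g \<in> reducible"
  shows "(\<lambda>w. f w + g w) \<in> reducible"
proof -
  from assms(1) obtain k M c where f: "k \<in> K" "finite M" "M \<subseteq> standard" "\<And>m. m \<notin> M \<Longrightarrow> c m = 0"
    "f = (\<lambda>w. k w + (\<Sum>m\<in>M. c m * mon_eval m w))"
    unfolding reducible_def by blast
  from assms(2) obtain k' M' c' where g: "k' \<in> K" "finite M'" "M' \<subseteq> standard" "\<And>m. m \<notin> M' \<Longrightarrow> c' m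
      = 0"
    "g = (\<lambda>w. k' w + (\<Sum>m\<in>M'. c' m * mon_eval m w))"
    unfolding reducible_def by blast
  have "(\<Sum>m\<in>M. c m * mon_eval m w) = (\<Sum>m\<in>M \<union> M'. c m * mon_eval m w)"
    "(\<Sum>m\<in>M'. c' m * mon_eval m w) = (\<Sum>m\<in>M \<union> M'. c' m * mon_eval m w)" for w
    using f g by (auto intro!: sum.mono_neutral_left)
  then have "(\<lambda>w. f w + g w) = (\<lambda>w. (k w + k' w) + (\<Sum>m\<in>M \<union> M'. (c m + c' m) * mon_eval m w))"
    by (simp add: f(5) g(5) distrib_right sum.distrib add_ac)
  then show ?thesis
    unfolding reducible_def using f g K_add
    by (intro CollectI bexI[of _ "\<lambda>w. k w + k' w"] exI[of _ "M \<union> M'"] exI[of _ "\<lambda>m. c m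
        + c' m"]) auto
qed

lemma reducible_smult:
  assumes "f \<in> reducible"
  shows "(\<lambda>w. a * f w) \<in> reducible"
proof -
  from assms obtain k M c where f: "k \<in> K" "finite M" "M \<subseteq> standard" "\<And>m. m \<notin> M \<Longrightarrow> c m = 0"
    "f = (\<lambda>w. k w + (\<Sum>m\<in>M. c m * mon_eval m w))"
    unfolding reducible_def by blast
  have "(\<lambda>w. a * f w) = (\<lambda>w. a * k w + (\<Sum>m\<in>M. (a * c m) * mon_eval m w))"
    by (simp add: f(5) distrib_left sum_distrib_left mult_ac)
  then show ?thesis
    unfolding reducible_def using f K_smult
    by (intro CollectI bexI[of _ "\<lambda>w. a * k w"] exI[of _ M] exI[of _ "\<lambda>m. a * c m"]) auto
qed

lemma reducible_diff:
  assumes "f \<in> reducible" "g \<in> reducible"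
  shows "(\<lambda>w. f w - g w) \<in> reducible"
  using reducible_add[OF assms(1) reducible_smult[OF assms(2), of "-1"]] by simp

lemma reducible_sum:
  assumes "finite S" "\<And>x. x \<in> S \<Longrightarrow> f x \<in> reducible"
  shows "(\<lambda>w. \<Sum>x\<in>S. f x w) \<in> reducible"
  using assms
  by (induction S rule: finite_induct) (auto intro: K_reducible K_zero reducible_add)

lemmas reducible_intros = reducible_add reducible_smult reducible_diff

definition weight :: "('n \<times> 3) multiset \<Rightarrow> nat" where
  "weight m = (\<Sum>x\<in>#m. if snd x = 1 then 0 else 1)"

definition rank_sum :: "('n \<times> 3) multiset \<Rightarrow> nat" where
  "rank_sum m = (\<Sum>x\<in>#m. if snd x = 1 then 0 else r (fst x))"

definition rank_sum2 :: "('n \<times> 3) multiset \<Rightarrow> nat" where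
  "rank_sum2 m = (\<Sum>x\<in>#m. if snd x = 2 then r (fst x) else 0)"

text \<open>Apart from its leading form, every term of the bifocal form contains an X, so that its
  product with \<open>m\<close> has weight at most \<open>weight m + 1\<close> and is covered by
  \<open>low\<close>. The leading coefficient \<open>h j$1 - h i$1\<close> is invertible.\<close>

lemma swap_reducible:
  assumes low: "\<And>m'. weight m' < weight m + 2 \<Longrightarrow> mon_eval m' \<in> reducible"
    and "i \<noteq> j" "s \<noteq> 1" "t \<noteq> 1"
  shows "(\<lambda>w. mon_eval m w * (w i$s * w j$t - w i$t * w j$s)) \<in> reducible"
proof -
  have low': "(\<lambda>w. mon_eval m w * (w k$1 * w l$u)) \<in> reducible" for k l u
  proof -
    have "mon_eval (add_mset (k, 1) (add_mset (l, u) m)) \<in> reducible"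
      by (rule low) (simp add: weight_def)
    then show ?thesis by (rule reducible_cong) (simp add: mult_ac)
  qed
  let ?d = "h j$1 - h i$1"
  have d: "?d \<noteq> 0" using h_neq \<open>i \<noteq> j\<close> by auto
  define T where "T = (\<lambda>w. mon_eval m w * bifocal h i j w
      - (h j$2 - h i$2) * (mon_eval m w * (w i$1 * w j$3))
      + (h j$3 - h i$3) * (mon_eval m w * (w i$1 * w j$2))
      - (h j$3 - h i$3) * (mon_eval m w * (w j$1 * w i$2))
      + (h j$2 - h i$2) * (mon_eval m w * (w j$1 * w i$3)))"
  have "(\<lambda>w. mon_eval m w * bifocal h i j w) \<in> reducible"
    using bifocal_K[OF \<open>i \<noteq> j\<close>] K_mult_mon_eval K_reducible by blast
  then have "(\<lambda>w. (1/?d) * T w) \<in> reducible"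
    unfolding T_def by (intro reducible_intros low')
  also have "(\<lambda>w. (1/?d) * T w) = (\<lambda>w. mon_eval m w * (w i$3 * w j$2 - w i$2 * w j$3))"
    using d by (intro ext) (simp add: T_def bifocal_def divide_simps, simp add: algebra_simps)
  finally have *: "(\<lambda>w. mon_eval m w * (w i$3 * w j$2 - w i$2 * w j$3)) \<in> reducible" .
  have **: "(\<lambda>w. mon_eval m w * (w i$2 * w j$3 - w i$3 * w j$2)) \<in> reducible"
    using reducible_smult[OF *, of "-1"] by (simp add: algebra_simps)
  have "s = t \<or> s = 3 \<and> t = 2 \<or> s = 2 \<and> t = 3"
    using assms(3,4) exhaust_3[of s] exhaust_3[of t] by auto
  then show ?thesis
    using * ** K_reducible[OF K_zero] by auto
qed

text \<open>The descent is lexicographic. Remainders of either relation have smaller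
  \<open>weight\<close>; the two other terms of a three-term relation have their X in a later
  factor, which lowers \<open>rank_sum\<close>; removing an inversion preserves both and moves a Y
  to the earlier factor, which lowers \<open>rank_sum2\<close>.\<close>

lemma mon_eval_reducible: "mon_eval m \<in> reducible"
proof (induction m rule: wf_measures_induct[of "[weight, rank_sum, rank_sum2]"])
  case (less m)
  consider "m \<in> standard" | "has_inversion m" | "has_bad_triple m"
    by (auto simp: standard_def)
  then show ?case
  proof cases
    case 1
    then show ?thesis by (rule standard_reducible)
  next
    case 2
    then obtain i j where 2: "r i < r j" "(i, 3) \<in># m" "(j, 2) \<in># m"
      by (auto simp: has_inversion_def)
    obtain m1 where m1: "m = add_mset (i, 3) m1"
      using 2 multi_member_split by metis
    then have "(j, 2) \<in># m1" using 2 by simp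
    then obtain m0 where m: "m = add_mset (i, 3) (add_mset (j, 2) m0)"
      using m1 multi_member_split by metis
    have "mon_eval (add_mset (i, 2) (add_mset (j, 3) m0)) \<in> reducible"
      by (rule less) (use 2 in \<open>simp add: m weight_def rank_sum_def rank_sum2_def\<close>)
    moreover have "(\<lambda>w. mon_eval m0 w * (w i$3 * w j$2 - w i$2 * w j$3)) \<in> reducible"
      by (rule swap_reducible) (use 2 in \<open>auto intro!: less simp: m weight_def\<close>)
    ultimately have "(\<lambda>w. mon_eval (add_mset (i, 2) (add_mset (j, 3) m0)) w
        + mon_eval m0 w * (w i$3 * w j$2 - w i$2 * w j$3)) \<in> reducible"
      by (rule reducible_add)
    also have "(\<lambda>w. mon_eval (add_mset (i, 2) (add_mset (j, 3) m0)) w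
        + mon_eval m0 w * (w i$3 * w j$2 - w i$2 * w j$3)) = mon_eval m"
      by (simp add: m fun_eq_iff algebra_simps)
    finally show ?thesis .
  next
    case 3
    then obtain i j k s t where 3: "r i < r j" "r j < r k" "s \<noteq> 1" "t \<noteq> 1"
      "(i, 1) \<in># m" "(j, s) \<in># m" "(k, t) \<in># m"
      unfolding has_bad_triple_def by (elim exE conjE)
    then have neq: "i \<noteq> j" "i \<noteq> k" "j \<noteq> k" by auto
    obtain m1 where m1: "m = add_mset (i, 1) m1"
      using 3 multi_member_split by metis
    then have "(j, s) \<in># m1" using 3 neq by simp
    then obtain m2 where m2: "m1 = add_mset (j, s) m2"
      using multi_member_split by metis
    then have "(k, t) \<in># m2" using 3 neq m1 by simp
    then obtain m0 where m: "m = add_mset (i, 1) (add_mset (j, s) (add_mset (k, t) m0))"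
      using m1 m2 multi_member_split by metis
    let ?m = "mon_eval m0"
    have low: "(\<lambda>w. ?m w * (w i'$1 * w j'$1 * w k'$u)) \<in> reducible" for i' j' k' u
    proof -
      have "mon_eval (add_mset (i', 1) (add_mset (j', 1) (add_mset (k', u) m0))) \<in> reducible"
        by (rule less) (use 3 in \<open>simp add: m weight_def\<close>)
      then show ?thesis by (rule reducible_cong) (simp add: mult_ac)
    qed
    have J: "(\<lambda>w. ?m w * (w j$1 * w i$u * w k$v)) \<in> reducible" if "u \<noteq> 1" "v \<noteq> 1" for u v
    proof -
      have "mon_eval (add_mset (j, 1) (add_mset (i, u) (add_mset (k, v) m0))) \<in> reducible"
        by (rule less) (use 3 that in \<open>simp add: m weight_def rank_sum_def\<close>)
      then show ?thesis by (rule reducible_cong) (simp add: mult_ac)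
    qed
    have K: "(\<lambda>w. ?m w * (w k$1 * w i$u * w j$v)) \<in> reducible" if "u \<noteq> 1" "v \<noteq> 1" for u v
    proof -
      have "mon_eval (add_mset (k, 1) (add_mset (i, u) (add_mset (j, v) m0))) \<in> reducible"
        by (rule less) (use 3 that in \<open>simp add: m weight_def rank_sum_def\<close>)
      then show ?thesis by (rule reducible_cong) (simp add: mult_ac)
    qed
    have "(\<lambda>w. mon_eval (add_mset (i, 1) m0) w * (w j$s * w k$t - w j$t * w k$s)) \<in> reducible"
      by (rule swap_reducible) (use 3 neq in \<open>auto intro!: less simp: m weight_def\<close>)
    then have swap: "(\<lambda>w. ?m w * w i$1 * (w j$s * w k$t - w j$t * w k$s)) \<in> reducible"
      by (rule reducible_cong) (simp add: mult_ac)
    have tri: "(\<lambda>w. ?m w * trifocal h s t i j k w) \<in> reducible"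
      using trifocal_K neq 3 K_mult_mon_eval K_reducible by blast
    \<comment> \<open>In the trifocal form \<open>w i$1\<close> comes with \<open>?e\<close> times
      the symmetric expression \<open>w j$s * w k$t + w j$t * w k$s\<close>. Adding
      \<open>?e\<close> times the antisymmetric one, reducible by \<open>swap\<close>, leaves twice
      the wanted monomial. \<open>A\<close> cancels the other two terms of the three-term relation
      and \<open>L\<close> the terms with two X.\<close>
    let ?e = "h k$1 - h j$1"
    have "?e \<noteq> 0" using h_neq neq by auto
    define A where "A = (\<lambda>u v w. (h k$1 - h i$1) * (?m w * (w j$1 * w i$u * w k$v))
      - (h j$1 - h i$1) * (?m w * (w k$1 * w i$u * w j$v)))"
    define L where "L = (\<lambda>u v w.
        h k$v * (?m w * (w i$1 * w k$1 * w j$u)) - h j$v * (?m w * (w i$1 * w j$1 * w k$u))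
      - h k$v * (?m w * (w j$1 * w k$1 * w i$u)) + h i$v * (?m w * (w j$1 * w i$1 * w k$u))
      + h j$v * (?m w * (w k$1 * w j$1 * w i$u)) - h i$v * (?m w * (w k$1 * w i$1 * w j$u)))"
    define T where "T = (\<lambda>w. ?m w * trifocal h s t i j k w
      + ?e * (?m w * w i$1 * (w j$s * w k$t - w j$t * w k$s))
      + A s t w + A t s w + L s t w + L t s w)"
    have "(\<lambda>w. (1/(2 * ?e)) * T w) \<in> reducible"
      unfolding T_def A_def L_def by (intro reducible_intros low J K swap tri 3)
    also have "(\<lambda>w. (1/(2 * ?e)) * T w) = mon_eval m"
    proof
      fix w
      have "T w = 2 * ?e * mon_eval m w"
        unfolding T_def A_def L_def trifocal_def trifocal_part_def Let_def m
        by (simp add: algebra_simps)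
      then show "(1/(2 * ?e)) * T w = mon_eval m w"
        using \<open>?e \<noteq> 0\<close> by simp
    qed
    finally show ?thesis .
  qed
qed

lemma mpoly_eval_reducible: "mpoly_eval (p :: ('n, 3) mpoly) \<in> reducible"
proof -
  have "(\<lambda>w. \<Sum>m\<in>Poly_Mapping.keys p. Poly_Mapping.lookup p m *
      (\<Prod>x\<in>UNIV. (w (fst x) $ snd x) ^ Poly_Mapping.lookup m x)) \<in> reducible"
  proof (rule reducible_sum)
    fix m :: "'n \<times> 3 \<Rightarrow>\<^sub>0 nat"
    obtain m' :: "('n \<times> 3) multiset" where
      "\<And>w. (\<Prod>x\<in>UNIV. (w (fst x) $ snd x) ^ Poly_Mapping.lookup m x) = mon_eval m' w"
      using prod_power_eq_mon_eval[of "Poly_Mapping.lookup m"] by blast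
    then show "(\<lambda>w. Poly_Mapping.lookup p m *
      (\<Prod>x\<in>UNIV. (w (fst x) $ snd x) ^ Poly_Mapping.lookup m x)) \<in> reducible"
      using reducible_smult[OF mon_eval_reducible[of m'], of "Poly_Mapping.lookup p m"] by simp
  qed simp
  also have "(\<lambda>w. \<Sum>m\<in>Poly_Mapping.keys p. Poly_Mapping.lookup p m *
      (\<Prod>x\<in>UNIV. (w (fst x) $ snd x) ^ Poly_Mapping.lookup m x)) = mpoly_eval p"
    by (simp add: fun_eq_iff mpoly_eval_alt)
  finally show ?thesis .
qed

end

section \<open>Independence of the standard monomials on the image\<close>

lemma continuous_zero_cofinite:
  fixes f :: "complex \<Rightarrow> complex"
  assumes "continuous_on UNIV f" "finite S" "\<And>t. t \<notin> S \<Longrightarrow> f t = 0"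
  shows "f t = 0"
proof -
  have "closed {t. f t = 0}"
    using assms(1) by (intro closed_Collect_eq) auto
  moreover have "- S \<subseteq> {t. f t = 0}" using assms(3) by auto
  ultimately have "closure (- S) \<subseteq> {t. f t = 0}" by (rule closure_minimal[rotated])
  moreover have "closure (- S) = UNIV"
    using \<open>finite S\<close> by (simp add: closure_complement empty_interior_finite)
  ultimately show ?thesis by auto
qed

lemma prod_3: "prod f (UNIV :: 3 set) = f 1 * f 2 * f 3"
  unfolding UNIV_3 by (simp add: ac_simps)

lemma mon_eval_scale:
  assumes "\<And>x. x \<in># m \<Longrightarrow> v (fst x) $ snd x = a x * w (fst x) $ snd x"
  shows "mon_eval m v = (\<Prod>x\<in>#m. a x) * mon_eval m w"
  using assms by (induction m) (auto simp: mult_ac)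

context focal_ideal
begin

abbreviation extent :: "('n \<times> 3) multiset \<Rightarrow> 'n \<Rightarrow> nat" where
  "extent m i \<equiv> count m (i, 2) + count m (i, 3)"

text \<open>Since \<open>k\<close> carries a Y or Z, absence of bad triples makes the extents before
  \<open>k\<close> a greedy filling of the degrees, determined by their total. Absence of inversions
  then makes the counts of Y a greedy filling of the extents. The extent at \<open>k\<close> has to
  be prescribed: a standard monomial may use \<open>k\<close> before the earlier factors are
  full.\<close>

lemma standard_unique:
  assumes m: "m \<in> standard" "m' \<in> standard"
    and deg: "\<And>i. count m (i, 1) + extent m i = count m' (i, 1) + extent m' i"
    and tot: "(\<Sum>i\<in>UNIV. count m (i, 2)) = (\<Sum>i\<in>UNIV. count m' (i, 2))"
      "(\<Sum>i\<in>UNIV. count m (i, 3)) = (\<Sum>i\<in>UNIV. count m' (i, 3))"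
    and above: "\<And>l. r k < r l \<Longrightarrow> extent m l = 0" "\<And>l. r k < r l \<Longrightarrow> extent m' l = 0"
    and k: "extent m k = extent m' k" "0 < extent m k"
  shows "m = m'"
proof -
  let ?S = "{i. r i < r k}"
  have full: "extent m i = count m (i, 1) + extent m i"
    if "m \<in> standard" "0 < extent m k" "i \<in> ?S" "j \<in> ?S" "r i < r j" "0 < extent m j" for m i j
  proof -
    have "\<exists>s. s \<noteq> 1 \<and> (j, s) \<in># m" "\<exists>t. t \<noteq> 1 \<and> (k, t) \<in># m"
      using that by (auto intro: exI[of _ "2::3"] exI[of _ "3::3"])
    then obtain s t where st: "s \<noteq> 1" "(j, s) \<in># m" "t \<noteq> 1" "(k, t) \<in># m" by blast
    have "\<not> has_bad_triple m" using that by (simp add: standard_def)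
    have "(i, 1) \<notin># m"
    proof
      assume "(i, 1) \<in># m"
      then have "has_bad_triple m"
        unfolding has_bad_triple_def
        by (intro exI[of _ i] exI[of _ j] exI[of _ k] exI[of _ s] exI[of _ t]) (use st that in auto)
      with \<open>\<not> has_bad_triple m\<close> show False ..
    qed
    then show ?thesis by (simp add: not_in_iff)
  qed
  have tot_extent: "sum (extent m) UNIV = sum (extent m) ?S + extent m k"
    if "\<And>l. r k < r l \<Longrightarrow> extent m l = 0" for m
  proof -
    have "sum (extent m) UNIV = sum (extent m) (insert k ?S)"
    proof (rule sum.mono_neutral_right)
      show "\<forall>i\<in>UNIV - insert k ?S. extent m i = 0"
      proof
        fix i assume "i \<in> UNIV - insert k ?S"
        then have "r i \<noteq> r k" "\<not> r i < r k" using inj_r by (auto dest: injD)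
        then show "extent m i = 0" using that by simp
      qed
    qed auto
    then show ?thesis by simp
  qed
  have "sum (extent m) UNIV = sum (extent m') UNIV"
    using tot by (simp add: sum.distrib)
  then have sumS: "sum (extent m) ?S = sum (extent m') ?S"
    using tot_extent[of m] tot_extent[of m'] above k by simp
  have below: "extent m i = extent m' i" if "i \<in> ?S" for i
  proof (rule greedy_unique[of ?S r _ "\<lambda>i. count m (i, 1) + extent m i"])
    show "extent m i = count m (i, 1) + extent m i"
      if "i \<in> ?S" "j \<in> ?S" "r i < r j" "0 < extent m j" for i j
      by (rule full) (use that m k in auto)
    show "extent m' i = count m (i, 1) + extent m i"
      if "i \<in> ?S" "j \<in> ?S" "r i < r j" "0 < extent m' j" for i j
      unfolding deg by (rule full) (use that m k in auto)
    show "extent m' i \<le> count m (i, 1) + extent m i" for i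
      unfolding deg by simp
  qed (use that inj_r sumS in auto)
  have ext: "extent m i = extent m' i" for i
  proof (cases "r i" "r k" rule: linorder_cases)
    case less
    then show ?thesis using below by simp
  next
    case equal
    then show ?thesis using inj_r k by (auto dest: injD)
  next
    case greater
    then show ?thesis using above by simp
  qed
  have full2: "count m (i, 2) = extent m i" if "m \<in> standard" "r i < r j" "0 < count m (j, 2)"
      for m i j
  proof -
    have "\<not> has_inversion m" using that by (simp add: standard_def)
    moreover have "(j, 2) \<in># m" using that by simp
    ultimately have "(i, 3) \<notin># m"
      unfolding has_inversion_def using that by blast
    then show ?thesis by (simp add: not_in_iff)
  qed
  have c2: "count m (i, 2) = count m' (i, 2)" for i
  proof (rule greedy_unique[of UNIV r _ "extent m"])
    show "count m (i, 2) = extent m i" if "r i < r j" "0 < count m (j, 2)" for i j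
      using full2 m that by blast
    show "count m' (i, 2) = extent m i" if "r i < r j" "0 < count m' (j, 2)" for i j
      using full2 m that unfolding ext by blast
    show "count m' (i, 2) \<le> extent m i" for i
      unfolding ext by simp
  qed (use inj_r tot in auto)
  have "count m x = count m' x" for x
  proof (cases x)
    case (Pair i t)
    then show ?thesis
      using exhaust_3[of t] c2[of i] ext[of i] deg[of i] by auto
  qed
  then show ?thesis by (rule multiset_eqI)
qed

text \<open>Scaling coordinates \<open>2\<close> and \<open>3\<close> by \<open>\<tau>\<close>
  multiplies a monomial by \<open>\<tau>\<close> to the power of its weight; \<open>y'\<close> is
  chosen so that this scaling turns \<open>y' - h i\<close> into the vector in
  \<open>v \<tau>\<close>. Multiplied by \<open>\<tau> ^ E\<close> the relation stays continuous at
  \<open>\<tau> = 0\<close>, where the centers are collinear and only the summands of weight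
  \<open>E\<close> survive.\<close>

lemma standard_top_vanish:
  fixes c :: "('n \<times> 3) multiset \<Rightarrow> complex"
  assumes "finite M"
    and vanish: "\<And>l y. (\<Sum>m\<in>M. c m * mon_eval m (\<lambda>i. l i *s (y - h i))) = 0"
    and E: "\<And>m. m \<in> M \<Longrightarrow> weight m \<le> E"
  shows "(\<Sum>m\<in>{m\<in>M. weight m = E}. c m *
    mon_eval m (\<lambda>i. l i *s (\<chi> t. if t = 1 then y$1 - h i$1 else y$t))) = 0"
proof -
  define v where "v = (\<lambda>\<tau> i. l i *s (\<chi> t. if t = 1 then y$1 - h i$1 else y$t - \<tau> * h i$t))"
  define f where "f = (\<lambda>\<tau>. \<Sum>m\<in>M. c m * \<tau> ^ (E - weight m) * mon_eval m (v \<tau>))"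
  have "f \<tau> = 0" if "\<tau> \<notin> {0}" for \<tau>
  proof -
    have \<tau>: "\<tau> \<noteq> 0" using that by simp
    define y' :: "complex^3" where "y' = (\<chi> t. if t = 1 then y$1 else y$t / \<tau>)"
    have "mon_eval m (v \<tau>) = \<tau> ^ weight m * mon_eval m (\<lambda>i. l i *s (y' - h i))" for m
    proof -
      have "mon_eval m (v \<tau>) = (\<Prod>x\<in>#m. if snd x = 1 then 1 else \<tau>) * mon_eval m (\<lambda>i. l i *s (y'
          - h i))"
        by (rule mon_eval_scale) (use \<tau> in \<open>auto simp: v_def y'_def field_simps\<close>)
      also have "(\<Prod>x\<in>#m. if snd x = 1 then 1 else \<tau>) = \<tau> ^ weight m"
        by (induction m) (auto simp: weight_def)
      finally show ?thesis .
    qed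
    then have "f \<tau> = (\<Sum>m\<in>M. c m * (\<tau> ^ (E - weight m) * \<tau> ^ weight m) * mon_eval m (\<lambda>i. l i *s (y'
        - h i)))"
      by (simp add: f_def mult_ac)
    also have "\<dots> = (\<Sum>m\<in>M. \<tau> ^ E * (c m * mon_eval m (\<lambda>i. l i *s (y' - h i))))"
      using E by (intro sum.cong) (auto simp flip: power_add)
    also have "\<dots> = 0"
      using vanish by (simp flip: sum_distrib_left)
    finally show ?thesis .
  qed
  moreover have "continuous_on UNIV (\<lambda>\<tau>. v \<tau> i $ t)" for i t
    unfolding v_def by (cases "t = 1") (auto intro!: continuous_intros)
  then have "continuous_on UNIV (\<lambda>\<tau>. mon_eval m (v \<tau>))" for m
    unfolding mon_eval_eq_prod by (intro continuous_on_prod continuous_on_power) blast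
  then have "continuous_on UNIV f"
    unfolding f_def by (intro continuous_intros)
  ultimately have "f 0 = 0" using continuous_zero_cofinite[of f "{0}"] by blast
  moreover have "f 0 = (\<Sum>m\<in>M. if weight m = E then c m * mon_eval m (v 0) else 0)"
    unfolding f_def
  proof (rule sum.cong)
    fix m assume "m \<in> M"
    then show "c m * 0 ^ (E - weight m) * mon_eval m (v 0) = (if weight m = E then c m
        * mon_eval m (v 0) else 0)"
      using E[of m] by (auto simp: power_0_left)
  qed simp
  then have "f 0 = (\<Sum>m\<in>{m\<in>M. weight m = E}. c m * mon_eval m (v 0))"
    using \<open>finite M\<close> by (simp add: sum.inter_filter)
  ultimately show ?thesis by (simp add: v_def cong: if_cong)
qed

text \<open>All but the first product depends only on the multidegree and on the total numbers of Y
  and Z, and its variables are free; fixing these data therefore leaves a relation in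
  \<open>y$1\<close> alone.\<close>

lemma mon_eval_collinear:
  "mon_eval m (\<lambda>i. l i *s (\<chi> t. if t = 1 then y$1 - h i$1 else y$t)) =
     (\<Prod>i\<in>UNIV. (y$1 - h i$1) ^ count m (i, 1)) *
     ((\<Prod>i\<in>UNIV. l i ^ (count m (i, 1) + extent m i)) *
      y$2 ^ (\<Sum>i\<in>UNIV. count m (i, 2)) * y$3 ^ (\<Sum>i\<in>UNIV. count m (i, 3)))"
proof -
  have "mon_eval m (\<lambda>i. l i *s (\<chi> t. if t = 1 then y$1 - h i$1 else y$t)) =
      (\<Prod>i\<in>UNIV. \<Prod>t\<in>UNIV. (l i * (if t = 1 then y$1 - h i$1 else y$t)) ^ count m (i, t))"
    by (simp add: mon_eval_eq_prod prod.cartesian_product case_prod_unfold flip: UNIV_Times_UNIV)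
  also have "\<dots> = (\<Prod>i\<in>UNIV. (y$1 - h i$1) ^ count m (i, 1) * (l i ^ (count m (i, 1) + extent m i) *
      (y$2 ^ count m (i, 2) * y$3 ^ count m (i, 3))))"
    by (rule prod.cong) (simp_all add: prod_3 power_mult_distrib power_add mult_ac)
  also have "\<dots> = (\<Prod>i\<in>UNIV. (y$1 - h i$1) ^ count m (i, 1)) *
     ((\<Prod>i\<in>UNIV. l i ^ (count m (i, 1) + extent m i)) *
      ((\<Prod>i\<in>UNIV. y$2 ^ count m (i, 2)) * (\<Prod>i\<in>UNIV. y$3 ^ count m (i, 3))))"
    by (simp add: prod.distrib)
  finally show ?thesis by (simp add: power_sum mult_ac)
qed

lemma standard_independent:
  fixes c :: "('n \<times> 3) multiset \<Rightarrow> complex"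
  assumes "finite M" "M \<subseteq> standard"
    and vanish: "\<And>l y. (\<Sum>m\<in>M. c m * mon_eval m (\<lambda>i. l i *s (y - h i))) = 0"
    and "m0 \<in> M"
  shows "c m0 = 0"
proof (rule ccontr)
  assume "c m0 \<noteq> 0"
  define M1 where "M1 = {m\<in>M. c m \<noteq> 0}"
  have M1: "finite M1" "m0 \<in> M1" "M1 \<subseteq> standard" "\<And>m. m \<in> M1 \<Longrightarrow> c m \<noteq> 0"
    using assms \<open>c m0 \<noteq> 0\<close> by (auto simp: M1_def)
  have vanish1: "(\<Sum>m\<in>M1. c m * mon_eval m (\<lambda>i. l i *s (y - h i))) = 0" for l y
  proof -
    have "(\<Sum>m\<in>M1. c m * mon_eval m (\<lambda>i. l i *s (y - h i))) = (\<Sum>m\<in>M. c m * mon_eval m (\<lambda>i. l i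
        *s (y - h i)))"
      using \<open>finite M\<close> by (intro sum.mono_neutral_left) (auto simp: M1_def)
    then show ?thesis using vanish by simp
  qed
  define E where "E = Max (weight ` M1)"
  have E: "weight m \<le> E" if "m \<in> M1" for m
    using M1(1) that by (simp add: E_def)
  have "E \<in> weight ` M1"
    unfolding E_def using M1 by (intro Max_in) auto
  then obtain m1 where m1: "m1 \<in> M1" "weight m1 = E" by blast
  define M2 where "M2 = {m\<in>M1. weight m = E}"
  have M2: "finite M2" "m1 \<in> M2" "M2 \<subseteq> standard" "\<And>m. m \<in> M2 \<Longrightarrow> c m \<noteq> 0"
    using M1 m1 by (auto simp: M2_def)
  \<comment> \<open>The exponents of the \<open>l i\<close> and of \<open>y$2\<close> and
    \<open>y$3\<close>. The index \<open>1\<close> of the second summand is a dummy with exponent 0,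
    because \<open>y$1\<close> enters through the linear factors instead.\<close>
  define e :: "('n \<times> 3) multiset \<Rightarrow> 'n + 3 \<Rightarrow> nat" where
    "e = (\<lambda>m x. case x of Inl i \<Rightarrow> count m (i, 1) + extent m i
       | Inr t \<Rightarrow> if t = 1 then 0 else (\<Sum>i\<in>UNIV. count m (i, t)))"
  define M3 where "M3 = {m\<in>M2. \<forall>x\<in>UNIV. e m x = e m1 x}"
  have M3: "finite M3" "m1 \<in> M3" "M3 \<subseteq> standard" "\<And>m. m \<in> M3 \<Longrightarrow> c m \<noteq> 0"
    using M2 by (auto simp: M3_def)
  have e_eq: "e m = e m'" if "m \<in> M3" "m' \<in> M3" for m m'
    using that by (auto simp: M3_def)
  have vanish3: "(\<Sum>m\<in>M3. c m * (\<Prod>i\<in>UNIV. (y - h i$1) ^ count m (i, 1))) = 0" for y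
    unfolding M3_def
  proof (rule sum_monomials_separate)
    fix v :: "'n + 3 \<Rightarrow> complex"
    define z :: "complex^3" where "z = (\<chi> t. if t = 1 then y else v (Inr t))"
    have "(\<Prod>x\<in>UNIV. v x ^ e m x) = (\<Prod>i\<in>UNIV. v (Inl i) ^ (count m (i, 1) + extent m i)) *
      z$2 ^ (\<Sum>i\<in>UNIV. count m (i, 2)) * z$3 ^ (\<Sum>i\<in>UNIV. count m (i, 3))" for m
    proof -
      have "(\<Prod>x\<in>UNIV. v x ^ e m x) = (\<Prod>i\<in>UNIV. v (Inl i) ^ e m (Inl i))
          * (\<Prod>t\<in>UNIV. v (Inr t) ^ e m (Inr t))"
        unfolding UNIV_Plus_UNIV[symmetric] by (subst prod.Plus) (auto simp: comp_def)
      then show ?thesis by (simp add: e_def z_def prod_3)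
    qed
    then show "(\<Sum>m\<in>M2. c m * (\<Prod>i\<in>UNIV. (y - h i$1) ^ count m (i, 1)) * (\<Prod>x\<in>UNIV. v x ^ e m x)) = 0"
      using standard_top_vanish[OF M1(1) vanish1 E, of "\<lambda>i. v (Inl i)" z]
      unfolding mon_eval_collinear M2_def by (simp add: z_def mult_ac)
  qed (use M2 in auto)
  \<comment> \<open>\<open>k\<close> is the last factor at which some monomial of \<open>M3\<close>
    carries a Y or Z. If there is none, \<open>k\<close> is arbitrary and the multidegree alone
    determines the monomial.\<close>
  obtain k where k: "\<And>m l. m \<in> M3 \<Longrightarrow> r k < r l \<Longrightarrow> extent m l = 0"
    and k0: "(\<exists>m\<in>M3. 0 < extent m k) \<or> (\<forall>m\<in>M3. \<forall>l. extent m l = 0)"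
  proof (cases "\<exists>m\<in>M3. \<exists>l. 0 < extent m l")
    case True
    let ?L = "{l. \<exists>m\<in>M3. 0 < extent m l}"
    have "Max (r ` ?L) \<in> r ` ?L"
      using True by (intro Max_in) auto
    then obtain k where k: "Max (r ` ?L) = r k" "k \<in> ?L" by (rule imageE)
    have "extent m l = 0" if "m \<in> M3" "r k < r l" for m l
    proof (rule ccontr)
      assume "extent m l \<noteq> 0"
      then have "l \<in> ?L" using \<open>m \<in> M3\<close> by auto
      then have "r l \<le> r k" unfolding k(1)[symmetric] by (intro Max_ge) auto
      then show False using \<open>r k < r l\<close> by simp
    qed
    then show ?thesis using k(2) by (intro that[of k]) auto
  next
    case False
    have "extent m l = 0" if "m \<in> M3" for m l
    proof -
      have "\<not> 0 < extent m l"
      proof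
        assume "0 < extent m l"
        then have "\<exists>m\<in>M3. \<exists>l. 0 < extent m l" using that by (intro bexI exI)
        with False show False ..
      qed
      then show ?thesis by (simp only: not_gr_zero)
    qed
    then show ?thesis by (intro that[of undefined]) blast+
  qed
  define m2 where "m2 = arg_min_on (\<lambda>m. count m (k, 1)) M3"
  have m2: "m2 \<in> M3" "\<And>m. m \<in> M3 \<Longrightarrow> count m2 (k, 1) \<le> count m (k, 1)"
    unfolding m2_def using M3 arg_min_if_finite[of M3 "\<lambda>m. count m (k, 1)"]
    by (auto simp: not_less)
  have degs: "count m (i, 1) + extent m i = count m' (i, 1) + extent m' i" if "m \<in> M3" "m' \<in> M3"
      for m m' i
    using fun_cong[OF e_eq[OF that], of "Inl i"] by (simp add: e_def)
  have tots: "(\<Sum>i\<in>UNIV. count m (i, t)) = (\<Sum>i\<in>UNIV. count m' (i, t))"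
    if "m \<in> M3" "m' \<in> M3" "t \<noteq> 1" for m m' t
    using fun_cong[OF e_eq[OF that(1,2)], of "Inr t"] that(3) by (simp add: e_def)
  have unique: "m = m2" if "m \<in> M3" "count m (k, 1) = count m2 (k, 1)" for m
  proof (cases "0 < extent m2 k")
    case True
    show ?thesis
    proof (rule standard_unique[of m m2 k])
      show "extent m k = extent m2 k" using degs[OF that(1) m2(1), of k] that(2) by simp
      with True show "0 < extent m k" by simp
      show "m \<in> standard" "m2 \<in> standard" using M3(3) that(1) m2(1) by blast+
      show "count m (i, 1) + extent m i = count m2 (i, 1) + extent m2 i" for i
        by (rule degs[OF that(1) m2(1)])
      show "(\<Sum>i\<in>UNIV. count m (i, 2)) = (\<Sum>i\<in>UNIV. count m2 (i, 2))"
        "(\<Sum>i\<in>UNIV. count m (i, 3)) = (\<Sum>i\<in>UNIV. count m2 (i, 3))"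
        by (rule tots[OF that(1) m2(1)], simp)+
      show "extent m l = 0" "extent m2 l = 0" if "r k < r l" for l
        by (rule k[OF \<open>m \<in> M3\<close> that], rule k[OF m2(1) that])
    qed
  next
    case False
    \<comment> \<open>The exponent of \<open>m2\<close> at \<open>k\<close> is now the full degree
      of that factor. By its minimality the same holds throughout \<open>M3\<close>, and the second
      alternative of \<open>k0\<close> applies.\<close>
    have "extent m k = 0" if "m \<in> M3" for m
      using degs[OF that m2(1), of k] m2(2)[OF that] False by linarith
    then have "\<not> (\<exists>m\<in>M3. 0 < extent m k)" by (metis less_irrefl)
    then have all0: "\<forall>m\<in>M3. \<forall>l. extent m l = 0" using k0 by argo
    have "extent m l = 0" "extent m2 l = 0" for l
      by (rule spec[OF bspec[OF all0 that(1)]], rule spec[OF bspec[OF all0 m2(1)]])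
    moreover have "count m (l, 1) = count m2 (l, 1)" for l
      using degs[OF that(1) m2(1), of l] calculation[of l] by simp
    ultimately have "count m (l, t) = count m2 (l, t)" for l t
      using exhaust_3[of t] by auto
    then have "count m x = count m2 x" for x
      by (cases x) simp
    then show ?thesis by (rule multiset_eqI)
  qed
  \<comment> \<open>The common factor \<open>(y - h k$1) ^ count m2 (k, 1)\<close> is divided out.
    At \<open>y = h k$1\<close> each summand with a larger exponent vanishes, and by
    \<open>unique\<close> only that of \<open>m2\<close> remains.\<close>
  define f where "f = (\<lambda>y. \<Sum>m\<in>M3. c m * ((y - h k$1) ^ (count m (k, 1) - count m2 (k, 1)) *
      (\<Prod>i\<in>UNIV - {k}. (y - h i$1) ^ count m (i, 1))))"
  have "f y = 0" if "y \<notin> {h k$1}" for y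
  proof -
    have "(\<Prod>i\<in>UNIV. (y - h i$1) ^ count m (i, 1)) = (y - h k$1) ^ count m2 (k, 1) *
        ((y - h k$1) ^ (count m (k, 1) - count m2 (k, 1)) * (\<Prod>i\<in>UNIV - {k}. (y
            - h i$1) ^ count m (i, 1)))"
      if "m \<in> M3" for m
      using m2(2)[OF that] by (simp add: prod.remove[of UNIV k] mult.assoc[symmetric] flip:
          power_add)
    then have "(y - h k$1) ^ count m2 (k, 1) * f y = 0"
      using vanish3[of y] by (simp add: f_def sum_distrib_left mult.left_commute cong: sum.cong)
    then show ?thesis using that by simp
  qed
  moreover have "continuous_on UNIV f"
    unfolding f_def by (intro continuous_intros)
  ultimately have "f (h k$1) = 0"
    using continuous_zero_cofinite[of f "{h k$1}"] by blast
  moreover have "f (h k$1) = (\<Sum>m\<in>M3. if m = m2 then c m * (\<Prod>i\<in>UNIV - {k}. (h k$1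
      - h i$1) ^ count m (i, 1)) else 0)"
    unfolding f_def
  proof (rule sum.cong)
    fix m assume m: "m \<in> M3"
    show "c m * ((h k$1 - h k$1) ^ (count m (k, 1) - count m2 (k, 1)) * (\<Prod>i\<in>UNIV - {k}. (h k$1
        - h i$1) ^ count m (i, 1)))
      = (if m = m2 then c m * (\<Prod>i\<in>UNIV - {k}. (h k$1 - h i$1) ^ count m (i, 1)) else 0)"
      using m2(2)[OF m] unique[OF m] by (cases "count m (k, 1)
          = count m2 (k, 1)") (auto simp: power_0_left)
  qed simp
  then have "f (h k$1) = c m2 * (\<Prod>i\<in>UNIV - {k}. (h k$1 - h i$1) ^ count m2 (i, 1))"
    using m2(1) by (simp add: sum.delta[OF M3(1)])
  ultimately have "c m2 = 0 \<or> (\<exists>i\<in>UNIV - {k}. h k$1 = h i$1)"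
    by auto
  then show False using M3(4)[OF m2(1)] h_neq by auto
qed

text \<open>Both \<open>p\<close> and the element of \<open>K\<close> in its reduction vanish on the
  image, so the remaining combination of standard monomials does too and is zero by independence.
  Points with \<open>x0 = 1\<close> are enough to see this.\<close>

lemma mpoly_eval_in_K:
  fixes p :: "('n, 3) mpoly"
  assumes "\<And>l y x0. mpoly_eval p (\<lambda>i. l i *s (y - x0 *s h i)) = 0"
  shows "mpoly_eval p \<in> K"
proof -
  obtain k M c where k: "k \<in> K" and M: "finite M" "M \<subseteq> standard"
    and p: "mpoly_eval p = (\<lambda>w. k w + (\<Sum>m\<in>M. c m * mon_eval m w))"
    using mpoly_eval_reducible[of p] unfolding reducible_def by blast
  have "(\<Sum>m\<in>M. c m * mon_eval m (\<lambda>i. l i *s (y - h i))) = 0" for l y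
    using fun_cong[OF p, of "\<lambda>i. l i *s (y - 1 *s h i)"] assms[of l y 1] K_vanish[OF k, of l y 1]
    by simp
  then have "c m = 0" if "m \<in> M" for m
    using standard_independent[OF M] that by blast
  then show ?thesis using p k by simp
qed

end

section \<open>Projective points and the Zariski closure\<close>

lemma Rep_proj_pt [simp]: "v \<noteq> 0 \<Longrightarrow> Rep_proj (proj_pt v) = vec.span {v}"
  unfolding proj_pt_def by (rule Abs_proj_inverse) blast

lemma proj_cases:
  obtains v where "v \<noteq> 0" "U = proj_pt v"
proof -
  have "Rep_proj U \<in> {L. \<exists>v. v \<noteq> 0 \<and> L = vec.span {v}}" by (rule Rep_proj)
  then obtain v where "v \<noteq> 0" "Rep_proj U = vec.span {v}" by blast
  then show thesis
    using that Rep_proj_inverse[of U] by (auto simp: proj_pt_def)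
qed

lemma proj_pt_scale: "a \<noteq> 0 \<Longrightarrow> proj_pt (a *s v) = proj_pt v"
proof -
  assume "a \<noteq> 0"
  have "vec.span {a *s v} = vec.span {v}"
  proof (rule antisym)
    show "vec.span {a *s v} \<subseteq> vec.span {v}"
      by (rule vec.span_minimal) (auto intro: vec.span_scale vec.span_base)
    have "v = inverse a *s (a *s v)" using \<open>a \<noteq> 0\<close> by simp
    then have "v \<in> vec.span {a *s v}" by (metis singletonI vec.span_base vec.span_scale)
    then show "vec.span {v} \<subseteq> vec.span {a *s v}"
      by (intro vec.span_minimal) auto
  qed
  then show ?thesis by (simp add: proj_pt_def)
qed

lemma proj_pt_eq_iff:
  assumes "v \<noteq> 0" "w \<noteq> 0"
  shows "proj_pt v = proj_pt w \<longleftrightarrow> (\<exists>a. v = a *s w)"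
proof
  assume "proj_pt v = proj_pt w"
  then have "vec.span {v} = vec.span {w}" using assms by (metis Rep_proj_pt)
  then show "\<exists>a. v = a *s w" using vec.span_base[of v "{v}"] by (auto simp: vec.span_singleton)
next
  assume "\<exists>a. v = a *s w"
  then obtain a where "v = a *s w" by blast
  then show "proj_pt v = proj_pt w" using assms by (intro trans[OF _ proj_pt_scale[of a w]]) auto
qed

lemma proj_map_pt: "v \<noteq> 0 \<Longrightarrow> proj_map M (proj_pt v) = proj_pt (M *v v)"
  unfolding proj_map_def
  by (simp add: proj_pt_def[of "M *v v"] vec.span_singleton image_image vector_scalar_commute)

lemma coords_proj_pt:
  assumes "\<And>i. x i \<noteq> 0"
  shows "v \<in> coords (\<lambda>i. proj_pt (x i)) \<longleftrightarrow> (\<exists>l. (\<forall>i. l i \<noteq> 0) \<and> v = (\<lambda>i. l i *s x i))"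
proof
  assume "v \<in> coords (\<lambda>i. proj_pt (x i))"
  then have v: "v i \<noteq> 0" "\<exists>a. v i = a *s x i" for i
    using assms by (auto simp: coords_def vec.span_singleton)
  then obtain l where "\<And>i. v i = l i *s x i" by metis
  moreover from this v(1) have "l i \<noteq> 0" for i by (metis vector_smult_lzero)
  ultimately show "\<exists>l. (\<forall>i. l i \<noteq> 0) \<and> v = (\<lambda>i. l i *s x i)" by blast
qed (use assms in \<open>auto simp: coords_def vec.span_singleton\<close>)

lemma coords_ex: "\<exists>v. v \<in> coords U \<and> U = (\<lambda>i. proj_pt (v i)) \<and> (\<forall>i. v i \<noteq> 0)"
proof -
  have "\<exists>v. v \<noteq> 0 \<and> U i = proj_pt v" for i by (metis proj_cases)
  then obtain v where v: "\<And>i. v i \<noteq> 0" "\<And>i. U i = proj_pt (v i)" by metis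
  then have "U = (\<lambda>i. proj_pt (v i))" by auto
  moreover have "v \<in> coords U" using v by (auto simp: coords_def vec.span_base)
  ultimately show ?thesis using v by blast
qed

lemma coords_eq_proj_pt:
  assumes "v \<in> coords U"
  shows "U = (\<lambda>i. proj_pt (v i))" "v i \<noteq> 0"
proof -
  obtain x where x: "U = (\<lambda>i. proj_pt (x i))" "\<And>i. x i \<noteq> 0"
    using coords_ex[of U] by blast
  with assms obtain l where "\<And>i. l i \<noteq> 0" "v = (\<lambda>i. l i *s x i)" by (auto simp: coords_proj_pt)
  then show "U = (\<lambda>i. proj_pt (v i))" using x by (simp add: proj_pt_scale)
  show "v i \<noteq> 0" using assms by (simp add: coords_def)
qed

lemma coords_scale:
  assumes "v \<in> coords U" "\<And>i. l i \<noteq> 0"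
  shows "(\<lambda>i. l i *s v i) \<in> coords U"
proof -
  have v: "\<And>i. v i \<noteq> 0" "U = (\<lambda>i. proj_pt (v i))"
    using coords_eq_proj_pt[OF assms(1)] by blast+
  have "(\<lambda>i. l i *s v i) \<in> coords (\<lambda>i. proj_pt (v i))"
    using assms(2) by (subst coords_proj_pt[of v, OF v(1)]) blast
  then show ?thesis by (simp only: v(2)[symmetric])
qed

lemma vanishes_at_proj_pt:
  assumes "\<And>i. x i \<noteq> 0"
  shows "vanishes_at f (\<lambda>i. proj_pt (x i)) \<longleftrightarrow>
    (\<forall>l. (\<forall>i. l i \<noteq> 0) \<longrightarrow> mpoly_eval f (\<lambda>i. l i *s x i) = 0)"
  unfolding vanishes_at_def Ball_def coords_proj_pt[of x, OF assms] by auto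

section \<open>Multihomogeneous components and the Zariski closure\<close>

definition multidegree :: "('n \<times> 'd::finite \<Rightarrow>\<^sub>0 nat) \<Rightarrow> 'n \<Rightarrow> nat" where
  "multidegree m i = (\<Sum>j\<in>UNIV. Poly_Mapping.lookup m (i, j))"

definition multihom_part :: "('n \<Rightarrow> nat) \<Rightarrow> ('n, 'd::finite) mpoly \<Rightarrow> ('n, 'd) mpoly" where
  "multihom_part d f = (\<Sum>m\<in>{m\<in>Poly_Mapping.keys f. multidegree m = d}.
     Poly_Mapping.single m (Poly_Mapping.lookup f m))"

lemma multihomogeneous_multihom_part: "multihomogeneous d (multihom_part d f)"
proof -
  have "Poly_Mapping.keys (multihom_part d f) \<subseteq> {m. multidegree m = d}"
    unfolding multihom_part_def by (rule order.trans[OF keys_sum]) (auto split: if_splits)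
  then show ?thesis by (auto simp: multihomogeneous_def multidegree_def)
qed

lemma mpoly_eval_single:
  "mpoly_eval (Poly_Mapping.single m a :: ('n::finite, 'd::finite) mpoly) v =
    a * (\<Prod>x\<in>UNIV. (v (fst x) $ snd x) ^ Poly_Mapping.lookup m x)"
  by (simp add: mpoly_eval_def eval_hom.mpoly_hom_single)

lemma mpoly_eval_multihom_part:
  fixes f :: "('n::finite, 'd::finite) mpoly"
  shows "mpoly_eval (multihom_part d f) v = (\<Sum>m\<in>{m\<in>Poly_Mapping.keys f. multidegree m = d}.
    Poly_Mapping.lookup f m * (\<Prod>x\<in>UNIV. (v (fst x) $ snd x) ^ Poly_Mapping.lookup m x))"
  by (simp add: multihom_part_def mpoly_eval_single)

lemma mpoly_eval_sum_multihom_part: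
  fixes f :: "('n::finite, 'd::finite) mpoly"
  shows "mpoly_eval f v = (\<Sum>d\<in>multidegree ` Poly_Mapping.keys f. mpoly_eval (multihom_part d f) v)"
  unfolding mpoly_eval_multihom_part unfolding mpoly_eval_alt
  by (rule sum.image_gen) simp

lemma multihom_part_vanish:
  fixes f :: "('n::finite, 'd::finite) mpoly"
  assumes "\<And>l. (\<forall>i. l i \<noteq> 0) \<Longrightarrow> mpoly_eval f (\<lambda>i. l i *s v i) = 0"
  shows "mpoly_eval (multihom_part d f) v = 0"
proof -
  define c where "c = (\<lambda>m. Poly_Mapping.lookup f m
      * (\<Prod>x\<in>UNIV. (v (fst x) $ snd x) ^ Poly_Mapping.lookup m x))"
  have eval: "mpoly_eval f (\<lambda>i. l i *s v i) =
      (\<Sum>m\<in>Poly_Mapping.keys f. c m * (\<Prod>i\<in>UNIV. l i ^ multidegree m i))" for l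
  proof -
    have "(\<Prod>x\<in>UNIV. l (fst x) ^ Poly_Mapping.lookup m x) = (\<Prod>i\<in>UNIV. l i ^ multidegree m i)"
      for m :: "'n \<times> 'd \<Rightarrow>\<^sub>0 nat"
      by (simp add: multidegree_def power_sum prod.cartesian_product case_prod_unfold flip:
          UNIV_Times_UNIV)
    then show ?thesis
      by (simp add: mpoly_eval_alt c_def power_mult_distrib prod.distrib mult_ac)
  qed
  \<comment> \<open>The hypothesis covers only scalings without zero entries. Multiplying by the
    product of all \<open>l i\<close> extends the identity to every \<open>l\<close>, at the price
    of raising each exponent by one.\<close>
  have "(\<Sum>m\<in>{m\<in>Poly_Mapping.keys f. \<forall>i\<in>UNIV. Suc (multidegree m i) = Suc (d i)}. c m) = 0"
  proof (rule sum_monomials_separate)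
    fix l :: "'n \<Rightarrow> complex"
    have "(\<Sum>m\<in>Poly_Mapping.keys f. c m * (\<Prod>i\<in>UNIV. l i ^ Suc (multidegree m i)))
        = (\<Prod>i\<in>UNIV. l i) * mpoly_eval f (\<lambda>i. l i *s v i)"
      by (simp add: eval sum_distrib_left prod.distrib mult_ac)
    also have "\<dots> = 0"
      using assms[of l] by (cases "\<forall>i. l i \<noteq> 0") auto
    finally show "(\<Sum>m\<in>Poly_Mapping.keys f. c m * (\<Prod>i\<in>UNIV. l i ^ Suc (multidegree m i))) = 0" .
  qed auto
  moreover have "(\<forall>i. multidegree m i = d i) \<longleftrightarrow> multidegree m = d" for m :: "'n \<times> 'd \<Rightarrow>\<^sub>0 nat"
    by auto
  ultimately show ?thesis by (simp add: mpoly_eval_multihom_part c_def)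
qed

lemma vanishes_at_multihom_part:
  fixes f :: "('n::finite, 'd::finite) mpoly"
  assumes "vanishes_at f U"
  shows "vanishes_at (multihom_part d f) U"
  unfolding vanishes_at_def
proof
  fix v assume "v \<in> coords U"
  then show "mpoly_eval (multihom_part d f) v = 0"
    using assms by (intro multihom_part_vanish) (auto simp: vanishes_at_def coords_scale)
qed

text \<open>Closed sets are cut out by multihomogeneous polynomials, whereas
  \<open>vanishing_ideal\<close> has arbitrary members. The components of such a member vanish on
  \<open>S\<close> as well and define a closed set containing \<open>S\<close>.\<close>

lemma zariski_closure_iff:
  fixes S :: "('n::finite \<Rightarrow> ('d::finite) proj) set"
  shows "U \<in> zariski_closure S \<longleftrightarrow> (\<forall>f\<in>vanishing_ideal S. vanishes_at f U)"
proof
  assume U: "U \<in> zariski_closure S"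
  show "\<forall>f\<in>vanishing_ideal S. vanishes_at f U"
  proof
    fix f :: "('n, 'd) mpoly" assume f: "f \<in> vanishing_ideal S"
    let ?T = "zero_locus (range (\<lambda>d. multihom_part d f))"
    have "zariski_closed ?T"
      unfolding zariski_closed_def
      by (intro exI[of _ "range (\<lambda>d. multihom_part d f)"] conjI ballI refl)
        (auto intro: multihomogeneous_multihom_part)
    moreover have "S \<subseteq> ?T"
      using f by (auto simp: zero_locus_def vanishing_ideal_def intro: vanishes_at_multihom_part)
    ultimately have "U \<in> ?T"
      using U by (auto simp: zariski_closure_def hull_def)
    then have "mpoly_eval (multihom_part d f) v = 0" if "v \<in> coords U" for d v
      using that by (auto simp: zero_locus_def vanishes_at_def)
    then show "vanishes_at f U"
      by (simp add: vanishes_at_def mpoly_eval_sum_multihom_part[of f])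
  qed
next
  assume U: "\<forall>f\<in>vanishing_ideal S. vanishes_at f U"
  have "U \<in> T" if T: "zariski_closed T" "S \<subseteq> T" for T
  proof -
    obtain F where F: "T = zero_locus F"
      using T(1) by (auto simp: zariski_closed_def)
    have "F \<subseteq> vanishing_ideal S"
      using T(2) by (auto simp: F zero_locus_def vanishing_ideal_def)
    then show ?thesis using U by (auto simp: F zero_locus_def)
  qed
  then show "U \<in> zariski_closure S"
    by (simp add: zariski_closure_def hull_def)
qed

lemma vanishing_ideal_zariski_closure:
  fixes S :: "('n::finite \<Rightarrow> ('d::finite) proj) set"
  shows "vanishing_ideal (zariski_closure S) = vanishing_ideal S"
proof
  have "S \<subseteq> zariski_closure S" by (simp add: zariski_closure_def hull_subset)
  then show "vanishing_ideal (zariski_closure S) \<subseteq> vanishing_ideal S"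
    by (auto simp: vanishing_ideal_def)
  show "vanishing_ideal S \<subseteq> vanishing_ideal (zariski_closure S)"
    using zariski_closure_iff[of _ S] by (auto simp: vanishing_ideal_def)
qed

section \<open>Ideals of rings given by a type class\<close>

lemma ring_of_type_algebra_simps [simp]:
  "carrier ring_of_type_algebra = UNIV"
  "x \<otimes>\<^bsub>ring_of_type_algebra\<^esub> y = x * y" "x \<oplus>\<^bsub>ring_of_type_algebra\<^esub> y = x + y"
  "\<one>\<^bsub>ring_of_type_algebra\<^esub> = 1" "\<zero>\<^bsub>ring_of_type_algebra\<^esub> = 0"
  by (simp_all add: ring_of_type_algebra_def)

lemma ideal_ring_of_type_algebraI:
  fixes I :: "'r::comm_ring_1 set"
  assumes "0 \<in> I" "\<And>a b. a \<in> I \<Longrightarrow> b \<in> I \<Longrightarrow> a + b \<in> I" "\<And>a x. a \<in> I \<Longrightarrow> x * a \<in> I"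
  shows "ideal I ring_of_type_algebra"
proof (rule idealI)
  interpret R: ring "ring_of_type_algebra :: 'r ring" by (rule ring_from_type_algebra)
  show "ring (ring_of_type_algebra :: 'r ring)" by (rule ring_from_type_algebra)
  show "subgroup I (add_monoid ring_of_type_algebra)"
  proof (rule R.add.subgroupI)
    show "\<ominus>\<^bsub>ring_of_type_algebra\<^esub> a \<in> I" if "a \<in> I" for a
    proof -
      have "\<ominus>\<^bsub>ring_of_type_algebra\<^esub> a = - a"
        using R.r_neg[of a] by (simp add: eq_neg_iff_add_eq_0 add.commute)
      then show ?thesis using assms(3)[OF that, of "-1"] by simp
    qed
  qed (use assms in auto)
qed (use assms in \<open>auto simp: mult.commute\<close>)

section \<open>Lines in three-space\<close>

text \<open>\<open>sum_4\<close> and \<open>forall_4\<close> index by \<open>4\<close> where this development writes \<open>0\<close>.\<close>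

lemma sum_4': "sum f (UNIV :: 4 set) = f 0 + f 1 + f 2 + f 3"
proof -
  have "(4::4) = 0" by simp
  then have "f 4 = f 0" by (rule arg_cong)
  then show ?thesis by (simp add: sum_4 add_ac)
qed

lemma forall_4': "(\<forall>i::4. P i) \<longleftrightarrow> P 0 \<and> P 1 \<and> P 2 \<and> P 3"
proof -
  have "(4::4) = 0" by simp
  then have "P 4 = P 0" by (rule arg_cong)
  then show ?thesis by (auto simp: forall_4)
qed

lemma exhaust_4': "i = 0 \<or> i = 1 \<or> i = 2 \<or> i = (3::4)"
  using forall_4'[of "\<lambda>i. i = 0 \<or> i = 1 \<or> i = 2 \<or> i = (3::4)"] by blast

lemma sum_pluecker_index:
  "sum f (UNIV :: pluecker_index set) = f P01 + f P02 + f P03 + f P12 + f P13 + f P23"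
  by (simp add: UNIV_pluecker_index add_ac)

lemma forall_pluecker_index:
  "(\<forall>k. P k) \<longleftrightarrow> P P01 \<and> P P02 \<and> P P03 \<and> P P12 \<and> P P13 \<and> P P23"
  by (metis pluecker_index.exhaust)

lemma line_through_nth [simp]:
  "line_through x y $ P01 = x$0 * y$1 - x$1 * y$0"
  "line_through x y $ P02 = x$0 * y$2 - x$2 * y$0"
  "line_through x y $ P03 = x$0 * y$3 - x$3 * y$0"
  "line_through x y $ P12 = x$1 * y$2 - x$2 * y$1"
  "line_through x y $ P13 = x$1 * y$3 - x$3 * y$1"
  "line_through x y $ P23 = x$2 * y$3 - x$3 * y$2"
  by (simp_all add: line_through_def)

lemma vec4_nth [simp]: "vec4 a b c d $ 0 = a" "vec4 a b c d $ 1 = b" "vec4 a b c d $ 2 = c"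
    "vec4 a b c d $ 3 = d"
  by (simp_all add: vec4_def)

lemma line_through_scale_left: "line_through (a *s x) y = a *s line_through x y"
  by (simp add: vec_eq_iff forall_pluecker_index algebra_simps)

lemma line_through_scale_right: "line_through x (a *s y) = a *s line_through x y"
  by (simp add: vec_eq_iff forall_pluecker_index algebra_simps)

lemma line_through_add_left: "line_through (x + y) z = line_through x z + line_through y z"
  by (simp add: vec_eq_iff forall_pluecker_index algebra_simps)

lemma line_through_self [simp]: "line_through x x = 0"
  by (simp add: vec_eq_iff forall_pluecker_index)

lemma pluecker_matrix_mult_nth:
  fixes p :: "'a::comm_ring_1^pluecker_index"
  shows "(pluecker_matrix p *v x) $ 0 = p$P23 * x$1 - p$P13 * x$2 + p$P12 * x$3"
    "(pluecker_matrix p *v x) $ 1 = - p$P23 * x$0 + p$P03 * x$2 - p$P02 * x$3"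
    "(pluecker_matrix p *v x) $ 2 = p$P13 * x$0 - p$P03 * x$1 + p$P01 * x$3"
    "(pluecker_matrix p *v x) $ 3 = - p$P12 * x$0 + p$P02 * x$1 - p$P01 * x$2"
  by (simp_all add: matrix_vector_mult_def sum_4' pluecker_matrix_def)

lemma pluecker_matrix_scale_left:
  "pluecker_matrix (a *s p) *v x = a *s (pluecker_matrix p *v (x :: complex^4))"
  by (simp add: vec_eq_iff forall_4' pluecker_matrix_mult_nth algebra_simps)

lemma line_through_eq_0:
  assumes "line_through x y = 0" "y \<noteq> 0"
  shows "\<exists>a. x = a *s y"
proof -
  have eq: "x$k * y$l = x$l * y$k" for k l
    using assms(1) exhaust_4'[of k] exhaust_4'[of l]
    by (auto simp: vec_eq_iff forall_pluecker_index mult.commute)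
  obtain k where "y$k \<noteq> 0" using assms(2) by (auto simp: vec_eq_iff)
  then have "x = (x$k / y$k) *s y"
    using eq[of _ k] by (auto simp: vec_eq_iff field_simps)
  then show ?thesis ..
qed

lemma line_through_neq_0_iff:
  assumes "x \<noteq> 0" "y \<noteq> 0"
  shows "line_through x y \<noteq> 0 \<longleftrightarrow> proj_pt x \<noteq> proj_pt y"
  using line_through_eq_0[OF _ assms(2), of x] proj_pt_eq_iff[OF assms]
  by (auto simp: line_through_scale_left)

text \<open>A left inverse of \<^term>\<open>\<lambda>w. line_through w c\<close> modulo \<^term>\<open>c\<close>, with error term in the
  equations \<^prop>\<open>pluecker_matrix p *v c = 0\<close> of the camera: contract with a coordinate where
  \<^term>\<open>c\<close> does not vanish.\<close>

lemma line_through_left_inverse: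
  fixes c :: "complex^4"
  assumes "c \<noteq> 0"
  shows "\<exists>W R. \<forall>p. p = line_through (W *v p) c + R *v (pluecker_matrix p *v c)"
proof -
  have lin: "\<exists>W R. \<forall>p. p = line_through (W *v p) c + R *v (pluecker_matrix p *v c)"
    if "Vector_Spaces.linear (*s) (*s) f" "Vector_Spaces.linear (*s) (*s) g"
      "\<And>p. p = line_through (f p) c + g (pluecker_matrix p *v c)" for f g
    by (intro exI[of _ "matrix f"] exI[of _ "matrix g"]) (use that in \<open>simp add: matrix_works\<close>)
  obtain k where "c$k \<noteq> 0" using assms by (auto simp: vec_eq_iff)
  with exhaust_4'[of k] consider "c$0 \<noteq> 0" | "c$1 \<noteq> 0" | "c$2 \<noteq> 0" | "c$3 \<noteq> 0" by auto
  then show ?thesis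
  proof cases
    case 1
    show ?thesis
    proof (rule lin)
      let ?f = "\<lambda>p :: complex^pluecker_index. vec4 0 (- p$P01/c$0) (- p$P02/c$0) (- p$P03/c$0)"
      let ?g = "\<lambda>q :: complex^4. \<chi> k. case k of P12 \<Rightarrow> - q$3/c$0 | P13 \<Rightarrow> q$2/c$0 | P23 \<Rightarrow>
          - q$1/c$0 | _ \<Rightarrow> 0"
      show "p = line_through (?f p) c + ?g (pluecker_matrix p *v c)" for p
        using 1 by (simp add: vec_eq_iff forall_pluecker_index pluecker_matrix_mult_nth field_simps)
      show "Vector_Spaces.linear (*s) (*s) ?f" "Vector_Spaces.linear (*s) (*s) ?g"
        by (unfold_locales; simp add: vec_eq_iff forall_pluecker_index
            forall_4' add_divide_distrib diff_divide_distrib)+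
    qed
  next
    case 2
    show ?thesis
    proof (rule lin)
      let ?f = "\<lambda>p :: complex^pluecker_index. vec4 (p$P01/c$1) 0 (- p$P12/c$1) (- p$P13/c$1)"
      let ?g = "\<lambda>q :: complex^4. \<chi> k. case k of P02 \<Rightarrow> q$3/c$1 | P03 \<Rightarrow>
          - q$2/c$1 | P23 \<Rightarrow> q$0/c$1 | _ \<Rightarrow> 0"
      show "p = line_through (?f p) c + ?g (pluecker_matrix p *v c)" for p
        using 2 by (simp add: vec_eq_iff forall_pluecker_index pluecker_matrix_mult_nth field_simps)
      show "Vector_Spaces.linear (*s) (*s) ?f" "Vector_Spaces.linear (*s) (*s) ?g"
        by (unfold_locales; simp add: vec_eq_iff forall_pluecker_index
            forall_4' add_divide_distrib diff_divide_distrib)+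
    qed
  next
    case 3
    show ?thesis
    proof (rule lin)
      let ?f = "\<lambda>p :: complex^pluecker_index. vec4 (p$P02/c$2) (p$P12/c$2) 0 (- p$P23/c$2)"
      let ?g = "\<lambda>q :: complex^4. \<chi> k. case k of P01 \<Rightarrow> - q$3/c$2 | P03 \<Rightarrow> q$1/c$2 | P13 \<Rightarrow>
          - q$0/c$2 | _ \<Rightarrow> 0"
      show "p = line_through (?f p) c + ?g (pluecker_matrix p *v c)" for p
        using 3 by (simp add: vec_eq_iff forall_pluecker_index pluecker_matrix_mult_nth field_simps)
      show "Vector_Spaces.linear (*s) (*s) ?f" "Vector_Spaces.linear (*s) (*s) ?g"
        by (unfold_locales; simp add: vec_eq_iff forall_pluecker_index
            forall_4' add_divide_distrib diff_divide_distrib)+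
    qed
  next
    case 4
    show ?thesis
    proof (rule lin)
      let ?f = "\<lambda>p :: complex^pluecker_index. vec4 (p$P03/c$3) (p$P13/c$3) (p$P23/c$3) 0"
      let ?g = "\<lambda>q :: complex^4. \<chi> k. case k of P01 \<Rightarrow> q$2/c$3 | P02 \<Rightarrow>
          - q$1/c$3 | P12 \<Rightarrow> q$0/c$3 | _ \<Rightarrow> 0"
      show "p = line_through (?f p) c + ?g (pluecker_matrix p *v c)" for p
        using 4 by (simp add: vec_eq_iff forall_pluecker_index pluecker_matrix_mult_nth field_simps)
      show "Vector_Spaces.linear (*s) (*s) ?f" "Vector_Spaces.linear (*s) (*s) ?g"
        by (unfold_locales; simp add: vec_eq_iff forall_pluecker_index
            forall_4' add_divide_distrib diff_divide_distrib)+
    qed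
  qed
qed

text \<open>The error term of the left inverse vanishes, so a single incident point already makes
  \<open>p\<close> decomposable.\<close>

lemma line_through_of_incident:
  assumes "pluecker_matrix p *v c = 0" "c \<noteq> 0"
  shows "\<exists>w. p = line_through w c"
proof -
  obtain W R where "p = line_through (W *v p) c + R *v (pluecker_matrix p *v c)"
    using line_through_left_inverse[OF assms(2)] by blast
  then show ?thesis using assms(1) by auto
qed

text \<open>Each 2x2 minor of \<open>p\<close> and \<open>line_through x c\<close> is a linear
  combination of the entries of \<open>pluecker_matrix p *v x\<close> and
  \<open>pluecker_matrix p *v c\<close>, with coordinates of \<open>x\<close> and \<open>c\<close>
  as coefficients. Hence all minors vanish and the two vectors are proportional.\<close>

lemma line_unique:
  fixes p :: "complex^pluecker_index"
  assumes p: "pluecker_matrix p *v x = 0" "pluecker_matrix p *v c = 0"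
    and "line_through x c \<noteq> 0"
  shows "\<exists>a. p = a *s line_through x c"
proof -
  let ?q = "line_through x c" and ?x = "pluecker_matrix p *v x" and ?c = "pluecker_matrix p *v c"
  have "p$P01 * ?q$P02 - p$P02 * ?q$P01 = c$0 * ?x$3 - x$0 * ?c$3"
    "p$P01 * ?q$P03 - p$P03 * ?q$P01 = x$0 * ?c$2 - c$0 * ?x$2"
    "p$P01 * ?q$P12 - p$P12 * ?q$P01 = c$1 * ?x$3 - x$1 * ?c$3"
    "p$P01 * ?q$P13 - p$P13 * ?q$P01 = x$1 * ?c$2 - c$1 * ?x$2"
    "p$P01 * ?q$P23 - p$P23 * ?q$P01 = - (c$3 * ?x$3) - c$2 * ?x$2 - x$1 * ?c$1 - x$0 * ?c$0"
    "p$P02 * ?q$P03 - p$P03 * ?q$P02 = c$0 * ?x$1 - x$0 * ?c$1"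
    "p$P02 * ?q$P12 - p$P12 * ?q$P02 = c$2 * ?x$3 - x$2 * ?c$3"
    "p$P02 * ?q$P13 - p$P13 * ?q$P02 = c$3 * ?x$3 + c$1 * ?x$1 + x$0 * ?c$0 + x$2 * ?c$2"
    "p$P02 * ?q$P23 - p$P23 * ?q$P02 = c$2 * ?x$1 - x$2 * ?c$1"
    "p$P03 * ?q$P12 - p$P12 * ?q$P03 = - (c$2 * ?x$2) - c$1 * ?x$1 - x$0 * ?c$0 - x$3 * ?c$3"
    "p$P03 * ?q$P13 - p$P13 * ?q$P03 = x$3 * ?c$2 - c$3 * ?x$2"
    "p$P03 * ?q$P23 - p$P23 * ?q$P03 = c$3 * ?x$1 - x$3 * ?c$1"
    "p$P12 * ?q$P13 - p$P13 * ?q$P12 = x$1 * ?c$0 - c$1 * ?x$0"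
    "p$P12 * ?q$P23 - p$P23 * ?q$P12 = x$2 * ?c$0 - c$2 * ?x$0"
    "p$P13 * ?q$P23 - p$P23 * ?q$P13 = x$3 * ?c$0 - c$3 * ?x$0"
    by (simp_all add: pluecker_matrix_mult_nth algebra_simps)
  then have eq: "p$k * ?q$l = p$l * ?q$k" for k l
    unfolding p by (cases k; cases l) (simp_all del: line_through_nth)
  obtain k where "?q$k \<noteq> 0" using assms(3) by (auto simp: vec_eq_iff)
  then have "p = (p$k / ?q$k) *s ?q"
    using eq[of _ k] by (auto simp: vec_eq_iff field_simps simp del: line_through_nth)
  then show ?thesis ..
qed

text \<open>The forms \<open>moment t\<close> are coordinates in general position: any four of them with distinct
  parameters are linearly independent.\<close>

definition moment :: "complex \<Rightarrow> complex^4 \<Rightarrow> complex" where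
  "moment t x = x$0 + x$1 * t + x$2 * t^2 + x$3 * t^3"

lemma moment_diff: "moment t (x - y) = moment t x - moment t y"
  by (simp add: moment_def algebra_simps)

lemma moment_scale: "moment t (a *s x) = a * moment t x"
  by (simp add: moment_def algebra_simps)

lemma moment_eq_poly: "moment t x = poly [:x$0, x$1, x$2, x$3:] t"
  by (simp add: moment_def algebra_simps power2_eq_square power3_eq_cube)

lemma moment_generic:
  assumes "finite V" "0 \<notin> V" "finite T"
  shows "\<exists>t. t \<notin> T \<and> (\<forall>v\<in>V. moment t v \<noteq> 0)"
proof -
  have "finite {t. moment t v = 0}" if "v \<in> V" for v
  proof -
    have "[:v$0, v$1, v$2, v$3:] \<noteq> 0"
    proof -
      have "v \<noteq> 0" using that assms(2) by auto
      then show ?thesis by (auto simp: vec_eq_iff forall_4')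
    qed
    then show ?thesis unfolding moment_eq_poly by (rule poly_roots_finite)
  qed
  then have "finite (T \<union> (\<Union>v\<in>V. {t. moment t v = 0}))"
    using assms by simp
  then obtain t where "t \<notin> T \<union> (\<Union>v\<in>V. {t. moment t v = 0})"
    using ex_new_if_finite[OF infinite_UNIV_char_0] by blast
  then show ?thesis by blast
qed

lemma moment_eq_0:
  assumes "card T \<ge> 4" "\<And>t. t \<in> T \<Longrightarrow> moment t x = 0"
  shows "x = 0"
proof (rule ccontr)
  assume "x \<noteq> 0"
  let ?p = "[:x$0, x$1, x$2, x$3:]"
  have "?p \<noteq> 0" using \<open>x \<noteq> 0\<close> by (auto simp: vec_eq_iff forall_4')
  then have "finite {t. poly ?p t = 0}" "card {t. poly ?p t = 0} \<le> Polynomial.degree ?p"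
    by (rule poly_roots_finite, rule card_poly_roots_bound)
  moreover have "Polynomial.degree ?p \<le> 3" by simp
  moreover have "card T \<le> card {t. poly ?p t = 0}"
    using assms(2) \<open>finite {t. poly ?p t = 0}\<close>
    by (intro card_mono) (auto simp only: moment_eq_poly[symmetric] mem_Collect_eq subset_iff)
  ultimately show False using assms(1) by linarith
qed

text \<open>The Pluecker vector of the points (1, s, s^2, s^3) and (1, t, t^2, t^3) of the twisted
  cubic. By Cauchy-Binet, pairing with it gives the Pluecker coordinate of a line with respect to
  the forms \<open>moment s\<close> and \<open>moment t\<close>.\<close>

definition moment_pair :: "complex \<Rightarrow> complex \<Rightarrow> complex^pluecker_index" where
  "moment_pair s t = (\<chi> k. case k of P01 \<Rightarrow> t - s | P02 \<Rightarrow> t^2 - s^2 | P03 \<Rightarrow> t^3 - s^3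
     | P12 \<Rightarrow> s * t^2 - t * s^2 | P13 \<Rightarrow> s * t^3 - t * s^3 | P23 \<Rightarrow> s^2 * t^3 - t^2 * s^3)"

lemma moment_pair_line_through:
  "(\<Sum>k\<in>UNIV. moment_pair s t $ k * line_through x y $ k) = moment s x * moment t y - moment t x
      * moment s y"
  by (simp add: sum_pluecker_index moment_pair_def moment_def algebra_simps)

section \<open>Lifting the multi-view ideal\<close>

locale pinhole_cameras =
  fixes c :: "'n::finite \<Rightarrow> complex^4"
    and A :: "'n \<Rightarrow> complex^4^3"
    and B :: "'n \<Rightarrow> complex^3^pluecker_index"
  assumes center_nonzero: "c i \<noteq> 0"
    and center_inj: "inj (\<lambda>i. proj_pt (c i))"
    and camera_rank: "rank (A i) = 3"
    and camera_kernel: "{x. A i *v x = 0} = vec.span {c i}"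
    and line_through_center: "line_through x (c i) = B i *v (A i *v x)"
begin

lemma camera_eq_0_iff: "A i *v x = 0 \<longleftrightarrow> (\<exists>a. x = a *s c i)"
  using camera_kernel[of i] by (auto simp: vec.span_singleton)

lemma camera_surj: "\<exists>x. A i *v x = u"
proof -
  have "\<forall>a. (\<Sum>j\<in>UNIV. a j *s row j (A i)) = 0 \<longrightarrow> (\<forall>j. a j = 0)"
  proof (intro allI impI)
    fix a j
    assume *: "(\<Sum>j\<in>UNIV. a j *s row j (A i)) = 0"
    show "a j = 0"
    proof (rule ccontr)
      assume "a j \<noteq> 0"
      let ?W = "(\<lambda>j. row j (A i)) ` (UNIV - {j})"
      have "a j *s row j (A i) = - (\<Sum>k\<in>UNIV - {j}. a k *s row k (A i))"
        using * by (simp add: sum.remove[of UNIV j] eq_neg_iff_add_eq_0)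
      then have "row j (A i) = inverse (a j) *s (- (\<Sum>k\<in>UNIV - {j}. a k *s row k (A i)))"
        using \<open>a j \<noteq> 0\<close> by (metis vector_smult_assoc left_inverse vector_smult_lid)
      also have "\<dots> \<in> vec.span ?W"
        by (intro vec.span_scale vec.span_neg vec.span_sum) (auto intro: vec.span_base)
      finally have "row j (A i) \<in> vec.span ?W" .
      then have "rows (A i) \<subseteq> vec.span ?W"
        by (auto simp: rows_def intro: vec.span_base)
      then have "vec.dim (rows (A i)) \<le> card ?W"
        by (intro vec.dim_le_card) auto
      also have "card ?W \<le> card (UNIV - {j})" by (rule card_image_le) simp
      also have "card (UNIV - {j}) = 2" by simp
      finally show False using camera_rank[of i] by (simp add: row_rank_def_gen)
    qed
  qed
  then obtain M where "A i ** M = mat 1"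
    unfolding matrix_right_invertible_independent_rows[symmetric] by (elim exE)
  then have "A i *v (M *v u) = u" by (simp add: matrix_vector_mul_assoc)
  then show ?thesis ..
qed

lemma line_matrix_eq_0_iff: "B i *v u = 0 \<longleftrightarrow> u = 0"
proof
  assume "B i *v u = 0"
  obtain x where x: "A i *v x = u" using camera_surj by blast
  then have "line_through x (c i) = 0"
    using \<open>B i *v u = 0\<close> by (simp add: line_through_center)
  then have "\<exists>a. x = a *s c i" using line_through_eq_0 center_nonzero by blast
  then show "u = 0" using x camera_eq_0_iff by blast
qed simp

lemma line_through_center_eq_0_iff: "line_through x (c i) = 0 \<longleftrightarrow> A i *v x = 0"
  by (simp add: line_through_center line_matrix_eq_0_iff)

lemma camera_neq_0_iff: "x \<noteq> 0 \<Longrightarrow> A i *v x \<noteq> 0 \<longleftrightarrow> proj_pt x \<noteq> proj_pt (c i)"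
  using line_through_neq_0_iff[OF _ center_nonzero] by (simp flip: line_through_center_eq_0_iff)

lemma camera_other_center: "i \<noteq> j \<Longrightarrow> A i *v c j \<noteq> 0"
  using center_inj camera_neq_0_iff[OF center_nonzero, of i j] by (auto dest: injD)

lemma incident_center: "pluecker_matrix (B i *v u) *v c i = 0"
  using camera_surj[of i u] pluecker_matrix_line_through(2)[of _ "c i"]
      by (auto simp: line_through_center)

text \<open>The substitution lifts because, in coordinates adapted to generic \<open>t0\<close> and \<open>t1\<close>, the
  bifocal and trifocal relations of the cameras are restrictions of incidence relations of
  concurrent lines.\<close>

lemma lift_to_concurrent:
  fixes f :: "('n, 3) mpoly"
  assumes f: "\<And>l x. mpoly_eval f (\<lambda>i. l i *s (A i *v x)) = 0"
  shows "\<exists>F. (\<forall>x y. mpoly_eval F (\<lambda>i. line_through x (y i)) = 0) \<and> f = line_subst B F"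
proof -
  \<comment> \<open>The coordinate \<open>moment t0\<close> is nonzero at every center, so the
    centers can be normalised to \<open>(1, h i)\<close>.\<close>
  obtain t0 where t0: "\<And>i. moment t0 (c i) \<noteq> 0"
    using moment_generic[of "range c" "{}"] center_nonzero by fastforce
  \<comment> \<open>\<open>moment t1\<close> is nonzero on these vectors exactly when the numbers
    \<open>h i $ 1\<close> are pairwise different.\<close>
  define V where "V = (\<lambda>(i, j). moment t0 (c j) *s c i - moment t0 (c i) *s c j) ` {(i, j). i \<noteq> j}"
  have "0 \<notin> V"
  proof
    assume "0 \<in> V"
    then obtain i j where ij: "i \<noteq> j" "moment t0 (c j) *s c i = moment t0 (c i) *s c j"
      by (auto simp: V_def)
    then have "c i = (moment t0 (c i) / moment t0 (c j)) *s c j"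
      using t0[of j] by (auto simp: vec_eq_iff field_simps)
    then show False
      using camera_other_center[of j i] \<open>i \<noteq> j\<close> camera_eq_0_iff[of j "c i"] by blast
  qed
  moreover have "finite V" by (simp add: V_def)
  ultimately obtain t1 where t1: "t1 \<notin> {t0}" "\<And>v. v \<in> V \<Longrightarrow> moment t1 v \<noteq> 0"
    using moment_generic[of V "{t0}"] by auto
  obtain t2 where t2: "t2 \<notin> {t0, t1}" using moment_generic[of "{}" "{t0, t1}"] by auto
  obtain t3 where t3: "t3 \<notin> {t0, t1, t2}" using moment_generic[of "{}" "{t0, t1, t2}"] by auto
  define \<tau> :: "3 \<Rightarrow> complex" where "\<tau> = (\<lambda>a. if a = 1 then t1 else if a = 2 then t2 else t3)"
  have \<tau>: "\<tau> 1 = t1" "\<tau> 2 = t2" "\<tau> 3 = t3" by (simp_all add: \<tau>_def)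
  have zero: "x = 0" if "moment t0 x = 0" "\<And>a. moment (\<tau> a) x = 0" for x
  proof (rule moment_eq_0)
    show "card {t0, t1, t2, t3} \<ge> 4" using t1(1) t2 t3 by auto
    show "moment t x = 0" if "t \<in> {t0, t1, t2, t3}" for t
      using that \<open>moment t0 x = 0\<close> \<open>\<And>a. moment (\<tau> a) x = 0\<close>[of 1] \<open>\<And>a. moment (\<tau> a) x = 0\<close>[of 2]
        \<open>\<And>a. moment (\<tau> a) x = 0\<close>[of 3] by (auto simp: \<tau>)
  qed
  have solve: "\<exists>x. moment t0 x = z0 \<and> (\<forall>a. moment (\<tau> a) x = z $ a)" for z0 :: complex and z ::
      "complex^3"
  proof -
    define nd :: "4 \<Rightarrow> complex" where "nd = (\<lambda>k. if k = 0 then t0 else if k = 1 then t1 else if k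
        = 2 then t2 else t3)"
    define M :: "complex^4^4" where "M = (\<chi> k. vec4 1 (nd k) (nd k ^ 2) (nd k ^ 3))"
    have M: "(M *v x) $ k = moment (nd k) x" for x k
      by (simp add: M_def matrix_vector_mult_def sum_4' moment_def mult.commute)
    have "\<forall>x. M *v x = 0 \<longrightarrow> x = 0"
    proof (intro allI impI)
      fix x assume "M *v x = 0"
      then have m: "moment (nd k) x = 0" for k using M[of x k] by simp
      show "x = 0"
        using m[of 0] m[of 1] m[of 2] m[of 3] exhaust_3 by (intro zero) (auto simp: nd_def \<tau>_def)
    qed
    then obtain N where "N ** M = mat 1" using matrix_left_invertible_ker by blast
    then have "M ** N = mat 1" by (rule matrix_left_right_inverse1)
    define y where "y = vec4 z0 (z$1) (z$2) (z$3)"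
    have "M *v (N *v y) = y"
      using \<open>M ** N = mat 1\<close> by (simp add: matrix_vector_mul_assoc)
    then have "moment (nd k) (N *v y) = y $ k" for k using M[of "N *v y" k] by simp
    from this[of 0] this[of 1] this[of 2] this[of 3] show ?thesis
      by (intro exI[of _ "N *v y"]) (simp add: nd_def y_def forall_3 \<tau>)
  qed
  \<comment> \<open>Compensates the factor \<open>- moment t0 (c i)\<close> that appears in
    \<open>w_line\<close>.\<close>
  define l' where "l' = (\<lambda>l i. - l i / moment t0 (c i))"
  define q where "q = (\<lambda>s t p. \<Sum>k\<in>UNIV. moment_pair s t $ k * p $ k)"
  have q_line: "q s t (line_through x y) = moment s x * moment t y - moment t x * moment s y"
      for s t x y
    unfolding q_def by (rule moment_pair_line_through)
  define w where "w = (\<lambda>u i. \<chi> a. q t0 (\<tau> a) (B i *v u i))"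
  define h where "h = (\<lambda>i. \<chi> a. moment (\<tau> a) (c i) / moment t0 (c i))"
  have w_line: "w (\<lambda>i. A i *v x i) i $ a = - moment t0 (c i) * (moment (\<tau> a) (x i)
      - moment t0 (x i) * h i $ a)" for x i a
    using t0[of i] by (simp add: w_def q_line h_def field_simps flip: line_through_center)
  have w_camera: "w (\<lambda>i. A i *v (l' l i *s x)) = (\<lambda>i. l i *s (y - x0 *s h i))"
    if "moment t0 x = x0" "\<And>a. moment (\<tau> a) x = y $ a" for l x y x0
  proof -
    have "w (\<lambda>i. A i *v (l' l i *s x)) i $ a = (l i *s (y - x0 *s h i)) $ a" for i a
    proof -
      have l': "moment t0 (c i) * l' l i = - l i" using t0[of i] by (simp add: l'_def)
      have "w (\<lambda>i. A i *v (l' l i *s x)) i $ a = - (moment t0 (c i) * l' l i) * (y $ a - x0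
          * h i $ a)"
        by (simp add: w_line moment_scale that algebra_simps)
      then show ?thesis unfolding l' by (simp add: algebra_simps)
    qed
    then show ?thesis by (simp add: fun_eq_iff vec_eq_iff)
  qed
  \<comment> \<open>For lines through \<open>(1, h i)\<close> the three coordinates that involve
    \<open>t0\<close> determine the other three linearly. With \<open>a = 1\<close> this is the
    expression \<open>q\<close> of \<open>trifocal_part\<close>.\<close>
  have q_B: "q (\<tau> a) (\<tau> b) (B i *v u i) = h i $ a * w u i $ b - h i $ b * w u i $ a" for u i a b
  proof -
    obtain x where x: "A i *v x = u i" using camera_surj by blast
    then have "w u i = w (\<lambda>i. A i *v x) i" by (simp add: w_def)
    moreover have "q (\<tau> a) (\<tau> b) (B i *v u i) = moment (\<tau> a) x * moment (\<tau> b) (c i)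
        - moment (\<tau> b) x * moment (\<tau> a) (c i)"
      by (simp add: q_line flip: x line_through_center)
    ultimately show ?thesis
      using t0[of i] by (simp add: w_line h_def field_simps)
  qed
  define L where "L = (\<chi> a. moment_pair t0 (\<tau> a))"
  have "L *v p = (\<chi> a. q t0 (\<tau> a) p)" for p
    by (simp add: vec_eq_iff q_def L_def matrix_vector_mult_def)
  then have w_L: "w u i = (L ** B i) *v u i" for u i
    by (simp add: w_def flip: matrix_vector_mul_assoc)
  have "\<exists>N. N ** (L ** B i) = mat 1" for i
    unfolding matrix_left_invertible_ker
  proof (intro allI impI)
    fix u assume u: "(L ** B i) *v u = 0"
    obtain x where x: "A i *v x = u" using camera_surj by blast
    have "w (\<lambda>i. A i *v x) i = 0" using u x w_L[of "\<lambda>i. A i *v x" i] by simp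
    then have "moment (\<tau> a) x = moment t0 x * h i $ a" for a
      using w_line[of "\<lambda>_. x" i a] t0[of i] by simp
    then have "moment t0 (c i) *s x - moment t0 x *s c i = 0"
      using t0[of i] by (intro zero) (simp_all add: moment_diff moment_scale h_def)
    then have "x = (moment t0 x / moment t0 (c i)) *s c i"
      using t0[of i] by (auto simp: vec_eq_iff field_simps)
    then show "u = 0" using x camera_eq_0_iff by blast
  qed
  then obtain N where N: "\<And>i. N i ** (L ** B i) = mat 1" by metis
  have N_w: "N i *v w u i = u i" for u i
    unfolding w_L by (simp add: matrix_vector_mul_assoc N)
  \<comment> \<open>Functions of the adapted coordinates \<open>w\<close> whose pullback to the
    \<open>u i\<close> is the restriction of a polynomial vanishing on concurrent lines. The goal
    becomes to show that \<open>f\<close>, rewritten in \<open>w\<close>, belongs to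
    \<open>K\<close>.\<close>
  define K where "K = {F. \<exists>G. (\<forall>x y. mpoly_eval G (\<lambda>i. line_through x (y i)) = 0) \<and>
      (\<forall>u. F (w u) = mpoly_eval G (\<lambda>i. B i *v u i))}"
  obtain r :: "'n \<Rightarrow> nat" where r: "inj r"
    using finite_imp_inj_to_nat_seg[of "UNIV :: 'n set"] by auto
  have K_I: "F \<in> K" if "G \<in> polyfuns" "\<And>x y. G (\<lambda>i. line_through x (y i)) = 0"
    "\<And>u. F (w u) = G (\<lambda>i. B i *v u i)" for F G
  proof -
    obtain g where "\<forall>v. mpoly_eval g v = G v" using \<open>G \<in> polyfuns\<close> unfolding polyfuns_iff by blast
    then show ?thesis unfolding K_def using that by (intro CollectI exI[of _ g]) simp
  qed
  have q_poly: "(\<lambda>v :: 'n \<Rightarrow> _. q s t (v i)) \<in> polyfuns" for s t i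
    unfolding q_def by (intro polyfuns_sum polyfuns_mult polyfuns_const polyfuns_var)
  interpret focal_ideal h r K
  proof
    show "inj r" by (rule r)
    show "inj (\<lambda>i. h i $ 1)"
    proof (rule injI, rule ccontr)
      fix i j assume eq: "h i $ 1 = h j $ 1" and "i \<noteq> j"
      then have "moment t0 (c j) *s c i - moment t0 (c i) *s c j \<in> V"
        by (auto simp: V_def)
      from t1(2)[OF this] show False
        using eq t0[of i] t0[of j] by (simp add: h_def \<tau> moment_diff moment_scale field_simps)
    qed
    show "(\<lambda>w. 0) \<in> K"
      unfolding K_def by (intro CollectI exI[of _ 0]) simp
    show "(\<lambda>w. f w + g w) \<in> K" if fg: "f \<in> K" "g \<in> K" for f g
    proof -
      obtain F G where "\<forall>x y. mpoly_eval F (\<lambda>i. line_through x (y i)) = 0" "\<forall>u. f (w u)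
          = mpoly_eval F (\<lambda>i. B i *v u i)"
        "\<forall>x y. mpoly_eval G (\<lambda>i. line_through x (y i)) = 0" "\<forall>u. g (w u) = mpoly_eval G (\<lambda>i. B i
            *v u i)"
        using fg by (auto simp: K_def)
      then show ?thesis unfolding K_def by (intro CollectI exI[of _ "F + G"]) simp
    qed
    show "(\<lambda>w. mpoly_eval p w * f w) \<in> K" if f: "f \<in> K" for f and p :: "('n, 3) mpoly"
    proof -
      obtain F where F: "\<forall>x y. mpoly_eval F (\<lambda>i. line_through x (y i)) = 0" "\<forall>u. f (w u)
          = mpoly_eval F (\<lambda>i. B i *v u i)"
        using f by (auto simp: K_def)
      \<comment> \<open>\<open>w\<close> factors through the Pluecker coordinates by the same
        \<open>L\<close> for every camera, so a multiplier in \<open>w\<close> lifts to a polynomial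
        in Pluecker coordinates.\<close>
      have "w u = (\<lambda>i. L *v (B i *v u i))" for u
        by (simp add: fun_eq_iff w_L matrix_vector_mul_assoc)
      then show ?thesis unfolding K_def using F by (intro CollectI exI[of _
          "linear_subst (\<lambda>_. L) p * F"]) simp
    qed
    show "bifocal h i j \<in> K" if "i \<noteq> j" for i j
    proof (rule K_I)
      let ?G = "\<lambda>v. q t0 t1 (v i) * q t2 t3 (v j) - q t0 t2 (v i) * q t1 t3 (v j) + q t0 t3 (v i)
          * q t1 t2 (v j)
        + q t0 t1 (v j) * q t2 t3 (v i) - q t0 t2 (v j) * q t1 t3 (v i) + q t0 t3 (v j)
            * q t1 t2 (v i)"
      show "?G \<in> polyfuns"
        by (intro polyfuns_add polyfuns_diff polyfuns_mult q_poly)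
      show "?G (\<lambda>i. line_through x (y i)) = 0" for x y
        unfolding q_line by (simp add: algebra_simps)
      show "bifocal h i j (w u) = ?G (\<lambda>i. B i *v u i)" for u
      proof -
        have w0: "q t0 (\<tau> a) (B i *v u i) = w u i $ a" for i a by (simp add: w_def)
        show ?thesis
          unfolding \<tau>[symmetric] q_B w0 bifocal_def by (simp add: algebra_simps)
      qed
    qed
    show "trifocal h s t i j k \<in> K" for s t i j k
    proof (rule K_I)
      let ?D = "\<lambda>s t v. q t0 t1 (v i) * (q t0 (\<tau> s) (v j) * q t1 (\<tau> t) (v k) - q t0 (\<tau> s) (v k)
          * q t1 (\<tau> t) (v j))
          - q t0 t1 (v j) * (q t0 (\<tau> s) (v i) * q t1 (\<tau> t) (v k) - q t0 (\<tau> s) (v k)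
              * q t1 (\<tau> t) (v i))
          + q t0 t1 (v k) * (q t0 (\<tau> s) (v i) * q t1 (\<tau> t) (v j) - q t0 (\<tau> s) (v j)
              * q t1 (\<tau> t) (v i))"
      let ?G = "\<lambda>v. ?D s t v + ?D t s v"
      show "?G \<in> polyfuns"
        by (intro polyfuns_add polyfuns_diff polyfuns_mult q_poly)
      show "?G (\<lambda>i. line_through x (y i)) = 0" for x y
        unfolding q_line by (simp add: algebra_simps)
      show "trifocal h s t i j k (w u) = ?G (\<lambda>i. B i *v u i)" for u
      proof -
        have w0: "q t0 (\<tau> a) (B i *v u i) = w u i $ a" for i a by (simp add: w_def)
        show ?thesis
          unfolding \<tau>(1)[symmetric] q_B w0 trifocal_def trifocal_part_def Let_def ..
      qed
    qed
    show "F (\<lambda>i. l i *s (y - x0 *s h i)) = 0" if F: "F \<in> K" for F l y x0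
    proof -
      obtain x where x: "moment t0 x = x0" "\<And>a. moment (\<tau> a) x = y $ a" using solve by blast
      obtain G where G: "\<forall>x y. mpoly_eval G (\<lambda>i. line_through x (y i)) = 0" "\<forall>u. F (w u)
          = mpoly_eval G (\<lambda>i. B i *v u i)"
        using F by (auto simp: K_def)
      have "B i *v (A i *v (l' l i *s x)) = line_through x (l' l i *s c i)" for i
        by (simp add: line_through_scale_left line_through_scale_right flip: line_through_center)
      then show ?thesis unfolding w_camera[OF x, symmetric] using G by simp
    qed
  qed
  define p where "p = linear_subst N f"
  have "mpoly_eval p \<in> K"
  proof (rule mpoly_eval_in_K)
    fix l y x0
    obtain x where x: "moment t0 x = x0" "\<And>a. moment (\<tau> a) x = y $ a" using solve by blast
    have "mpoly_eval p (\<lambda>i. l i *s (y - x0 *s h i)) = mpoly_eval f (\<lambda>i. A i *v (l' l i *s x))"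
      unfolding w_camera[OF x, symmetric] by (simp add: p_def N_w)
    also have "\<dots> = 0" using f[of "l' l" x] by (simp add: vector_scalar_commute)
    finally show "mpoly_eval p (\<lambda>i. l i *s (y - x0 *s h i)) = 0" .
  qed
  then obtain F where F: "\<forall>x y. mpoly_eval F (\<lambda>i. line_through x (y i)) = 0"
    "\<forall>u. mpoly_eval p (w u) = mpoly_eval F (\<lambda>i. B i *v u i)"
    by (auto simp: K_def)
  have "f = line_subst B F"
    by (rule mpoly_eqI) (use F(2) in \<open>simp add: p_def N_w\<close>)
  with F(1) show ?thesis by blast
qed

end

section \<open>The multi-view and the multi-image variety\<close>

lemma continuous_on_mpoly_eval:
  fixes f :: "('n::finite, 'd::finite) mpoly"
  assumes "\<And>i. continuous_on S (\<lambda>t. v t i)"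
  shows "continuous_on S (\<lambda>t. mpoly_eval f (v t))"
  unfolding mpoly_eval_alt using assms by (intro continuous_intros) auto

lemma mpoly_eval_on_curve:
  fixes f :: "('n::finite, 'd::finite) mpoly"
  shows "\<exists>P. \<forall>t. mpoly_eval f (\<lambda>i. \<chi> j. poly (q i j) t) = poly P t"
proof (induction f rule: mpoly_induct)
  case (const a)
  show ?case by (rule exI[of _ "[:a:]"]) simp
next
  case (var i j)
  show ?case by (rule exI[of _ "q i j"]) (simp del: One_nat_def)
next
  case (add f g)
  then obtain P Q where "\<forall>t. mpoly_eval f (\<lambda>i. \<chi> j. poly (q i j) t) = poly P t"
    "\<forall>t. mpoly_eval g (\<lambda>i. \<chi> j. poly (q i j) t) = poly Q t" by blast
  then show ?case by (intro exI[of _ "P + Q"]) simp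
next
  case (mult f g)
  then obtain P Q where "\<forall>t. mpoly_eval f (\<lambda>i. \<chi> j. poly (q i j) t) = poly P t"
    "\<forall>t. mpoly_eval g (\<lambda>i. \<chi> j. poly (q i j) t) = poly Q t" by blast
  then show ?case by (intro exI[of _ "P * Q"]) simp
qed

lemma multihomogeneous_linear_form:
  fixes a :: "'d::finite \<Rightarrow> complex"
  shows "multihomogeneous (\<lambda>i'. if i' = i then 1 else 0) (\<Sum>l\<in>UNIV. mconst (a l)
      * mvar i l :: ('n, 'd) mpoly)"
proof -
  have "Poly_Mapping.keys (\<Sum>l\<in>UNIV. mconst (a l) * mvar i l :: ('n, 'd) mpoly) \<subseteq>
      (\<lambda>l. Poly_Mapping.single (i, l) 1) ` UNIV"
    by (rule order.trans[OF keys_sum]) (auto simp: mult_single split: if_splits)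
  then show ?thesis
    by (auto simp: multihomogeneous_def lookup_single when_def if_distrib
        if_distribR dest!: subsetD)
qed

lemma finite_affine_zeros:
  assumes "w \<noteq> (0 :: complex^'d)"
  shows "finite {t. v + t *s w = 0}"
proof -
  obtain k where k: "w $ k \<noteq> 0" using assms by (auto simp: vec_eq_iff)
  have "{t. v + t *s w = 0} \<subseteq> {- v $ k / w $ k}"
  proof
    fix t assume "t \<in> {t. v + t *s w = 0}"
    then have "v $ k + t * w $ k = 0" by (simp add: vec_eq_iff)
    then show "t \<in> {- v $ k / w $ k}" using k by (simp add: field_simps eq_neg_iff_add_eq_0)
  qed
  then show ?thesis by (rule finite_subset) simp
qed

lemma regular_on_linear:
  fixes M :: "'n::finite \<Rightarrow> complex^'d::finite^'e::finite"
  assumes "\<And>W v i. W \<in> S \<Longrightarrow> v \<in> coords W \<Longrightarrow> M i *v v i \<noteq> 0"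
  shows "regular_on S (\<lambda>U i. proj_map (M i) (U i))"
  unfolding regular_on_def
proof
  fix U assume "U \<in> S"
  define F :: "'n \<Rightarrow> 'e \<Rightarrow> ('n, 'd) mpoly" where
    "F = (\<lambda>k j. \<Sum>l\<in>UNIV. mconst (M k $ j $ l) * mvar k l)"
  have F: "(\<chi> j. mpoly_eval (F k j) v) = M k *v v k" for k v
    by (simp add: F_def matrix_vector_mult_def del: One_nat_def)
  \<comment> \<open>The linear forms have no common zero on \<open>S\<close>, so a single chart
    suffices and the closed set to be removed is empty.\<close>
  have Z: "zero_locus {1 :: ('n, 'd) mpoly} = {}"
  proof -
    have "\<not> vanishes_at (1 :: ('n, 'd) mpoly) V" for V
      using coords_ex[of V] by (auto simp: vanishes_at_def)
    then show ?thesis by (simp add: zero_locus_def)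
  qed
  have "zariski_closed ({} :: ('n \<Rightarrow> 'd proj) set)"
    unfolding zariski_closed_def
  proof (intro exI[of _ "{1 :: ('n, 'd) mpoly}"] conjI)
    show "\<forall>f\<in>{1 :: ('n, 'd) mpoly}. \<exists>d. multihomogeneous d f"
      by (auto simp: multihomogeneous_def intro!: exI[of _ "\<lambda>_. 0"] simp flip: single_one)
  qed (simp add: Z)
  moreover have "\<exists>d. \<forall>j. multihomogeneous d (F k j)" for k
    unfolding F_def by (intro exI allI) (rule multihomogeneous_linear_form)
  moreover have "proj_map (M k) (W k) = proj_pt (M k *v v k)" if "v \<in> coords W" for W v k
    using proj_map_pt[OF coords_eq_proj_pt(2)[OF that], of "M k" k] coords_eq_proj_pt(1)[OF that]
    by (metis (mono_tags, lifting))
  ultimately show "\<exists>Z F. zariski_closed Z \<and> U \<notin> Z \<and> (\<forall>k. \<exists>d. \<forall>j. multihomogeneous d (F k j)) \<and>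
      (\<forall>W\<in>S - Z. \<forall>v\<in>coords W. \<forall>k. (\<chi> j. mpoly_eval (F k j) v) \<noteq> 0 \<and>
        proj_map (M k) (W k) = proj_pt (\<chi> j. mpoly_eval (F k j) v))"
    using assms by (intro exI[of _ "{}"] exI[of _ F]) (simp add: F)
qed

lemma polyfuns_det:
  fixes M :: "('n::finite \<Rightarrow> complex^'d::finite) \<Rightarrow> complex^'k^'k"
  assumes "\<And>a b. (\<lambda>v. M v $ a $ b) \<in> polyfuns"
  shows "(\<lambda>v. det (M v)) \<in> polyfuns"
  unfolding det_def using assms by (intro polyfuns_sum polyfuns_mult polyfuns_prod polyfuns_const)

lemma polyfuns_pluecker_matrix:
  "(\<lambda>v :: 'n::finite \<Rightarrow> complex^pluecker_index. pluecker_matrix (v i) $ a $ b) \<in> polyfuns"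
proof -
  have "(\<lambda>v :: 'n \<Rightarrow> complex^pluecker_index. - (v i $ k)) \<in> polyfuns"
    "(\<lambda>v :: 'n \<Rightarrow> complex^pluecker_index. 0) \<in> polyfuns"
    "(\<lambda>v :: 'n \<Rightarrow> complex^pluecker_index. v i $ k) \<in> polyfuns" for k
    by (intro polyfuns_uminus polyfuns_var polyfuns_const)+
  then show ?thesis
    using exhaust_4'[of a] exhaust_4'[of b] by (auto simp: pluecker_matrix_def)
qed

section \<open>The ideals of the multi-view and multi-image varieties\<close>

context pinhole_cameras
begin

definition view_points :: "('n \<Rightarrow> 3 proj) set" where
  "view_points = {\<lambda>i. proj_pt (A i *v x) | x. x \<noteq> 0 \<and> (\<forall>i. A i *v x \<noteq> 0)}"

definition image_points :: "('n \<Rightarrow> pluecker_index proj) set" where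
  "image_points = {\<lambda>i. proj_pt (line_through x (c i)) | x. x \<noteq> 0 \<and> (\<forall>i. proj_pt x \<noteq> proj_pt (c i))}"

lemma multi_view_variety_eq: "multi_view_variety A = zariski_closure view_points"
  by (simp add: multi_view_variety_def view_points_def)

lemma multi_image_variety_eq: "multi_image_variety c = zariski_closure image_points"
  by (simp add: multi_image_variety_def image_points_def)

text \<open>On the twisted cubic a nonzero row of \<open>A i\<close> takes the value
  \<open>moment t\<close> of that row, and finitely many such polynomials in \<open>t\<close> have a
  common non-root.\<close>

lemma generic_point: "\<exists>x. \<forall>i. A i *v x \<noteq> 0"
proof -
  have "\<exists>k. A i $ k \<noteq> 0" for i
  proof (rule ccontr)
    assume "\<nexists>k. A i $ k \<noteq> 0"
    then have "A i *v x = 0" for x by (simp add: matrix_vector_mult_def vec_eq_iff)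
    moreover obtain x where "A i *v x = (\<chi> k. 1)" using camera_surj by blast
    ultimately show False by (simp add: vec_eq_iff)
  qed
  then obtain k where k: "\<And>i. A i $ k i \<noteq> 0" by metis
  then obtain t where t: "\<And>i. moment t (A i $ k i) \<noteq> 0"
    using moment_generic[of "range (\<lambda>i. A i $ k i)" "{}"] by fastforce
  have "(A i *v vec4 1 t (t^2) (t^3)) $ k i = moment t (A i $ k i)" for i
    by (simp add: matrix_vector_mult_def sum_4' moment_def)
  then have "A i *v vec4 1 t (t^2) (t^3) \<noteq> 0" for i
    using t[of i] by (metis zero_index)
  then show ?thesis by blast
qed

text \<open>Moving \<open>x\<close> towards a generic point and shifting all \<open>l i\<close> by
  \<open>t\<close> avoids the kernels and zero scalars for all but finitely many \<open>t\<close>,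
  so continuity at \<open>t = 0\<close> reaches every parameter. The parameters
  \<open>(l, x)\<close> thus fill a whole vector space, as lifting and primality require.\<close>

lemma vanishing_view_iff:
  "f \<in> vanishing_ideal (multi_view_variety A) \<longleftrightarrow> (\<forall>l x. mpoly_eval f (\<lambda>i. l i *s (A i *v x)) = 0)"
proof -
  have good: "vanishes_at f (\<lambda>i. proj_pt (A i *v x)) \<longleftrightarrow>
      (\<forall>l. (\<forall>i. l i \<noteq> 0) \<longrightarrow> mpoly_eval f (\<lambda>i. l i *s (A i *v x)) = 0)" if "\<forall>i. A i *v x \<noteq> 0" for x
    using that by (intro vanishes_at_proj_pt) auto
  have "mpoly_eval f (\<lambda>i. l i *s (A i *v x)) = 0" if f: "f \<in> vanishing_ideal view_points" for l x
  proof -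
    obtain e where e: "\<forall>i. A i *v e \<noteq> 0" using generic_point by blast
    define v where "v = (\<lambda>t i. (l i + t) *s (A i *v x + t *s (A i *v e)))"
    define S where "S = range (\<lambda>i. - l i) \<union> (\<Union>i. {t. A i *v x + t *s (A i *v e) = 0})"
    have "finite S" unfolding S_def using e by (auto intro: finite_affine_zeros)
    moreover have "mpoly_eval f (v t) = 0" if "t \<notin> S" for t
    proof -
      have nz: "\<forall>i. A i *v (x + t *s e) \<noteq> 0" "\<forall>i. l i + t \<noteq> 0"
        using that by (auto simp: S_def matrix_vector_right_distrib vector_scalar_commute
            eq_neg_iff_add_eq_0 add.commute)
      then have "x + t *s e \<noteq> 0" by (metis matrix_vector_mult_0_right)
      then have "(\<lambda>i. proj_pt (A i *v (x + t *s e))) \<in> view_points"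
        using nz by (auto simp: view_points_def)
      then have "vanishes_at f (\<lambda>i. proj_pt (A i *v (x + t *s e)))"
        using f by (auto simp: vanishing_ideal_def)
      then have "mpoly_eval f (\<lambda>i. (l i + t) *s (A i *v (x + t *s e))) = 0"
        using nz(2) unfolding good[OF nz(1)] by (elim allE[of _ "\<lambda>i. l i + t"]) simp
      then show ?thesis by (simp add: v_def matrix_vector_right_distrib vector_scalar_commute)
    qed
    moreover have "continuous_on UNIV (\<lambda>t. mpoly_eval f (v t))"
    proof (rule continuous_on_mpoly_eval)
      show "continuous_on UNIV (\<lambda>t. v t i)" for i
      proof -
        have "v t i = (\<chi> j. (l i + t) * ((A i *v x) $ j + t * (A i *v e) $ j))" for t
          by (simp add: v_def vec_eq_iff algebra_simps)
        then show ?thesis by (simp add: continuous_intros)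
      qed
    qed
    ultimately have "mpoly_eval f (v 0) = 0"
      using continuous_zero_cofinite[of "\<lambda>t. mpoly_eval f (v t)" S] by blast
    then show ?thesis by (simp add: v_def)
  qed
  moreover have "f \<in> vanishing_ideal view_points" if "\<forall>l x. mpoly_eval f (\<lambda>i. l i *s (A i *v x))
      = 0"
    unfolding vanishing_ideal_def view_points_def using that good by auto
  ultimately show ?thesis
    unfolding multi_view_variety_eq vanishing_ideal_zariski_closure by blast
qed

lemma vanishing_image_iff:
  "F \<in> vanishing_ideal (multi_image_variety c)
      \<longleftrightarrow> line_subst B F \<in> vanishing_ideal (multi_view_variety A)"
proof -
  have "vanishes_at F (\<lambda>i. proj_pt (line_through x (c i))) \<longleftrightarrow>
      vanishes_at (line_subst B F) (\<lambda>i. proj_pt (A i *v x))" if "\<forall>i. A i *v x \<noteq> 0" for x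
  proof -
    have "line_through x (c i) \<noteq> 0" "A i *v x \<noteq> 0" for i
      using that by (simp_all add: line_through_center_eq_0_iff)
    then show ?thesis
      by (simp add: vanishes_at_proj_pt vector_scalar_commute line_through_center)
  qed
  moreover have "x \<noteq> 0 \<and> (\<forall>i. proj_pt x \<noteq> proj_pt (c i)) \<longleftrightarrow> x \<noteq> 0 \<and> (\<forall>i. A i *v x \<noteq> 0)" for x
    using camera_neq_0_iff by blast
  ultimately show ?thesis
    unfolding multi_view_variety_eq multi_image_variety_eq vanishing_ideal_zariski_closure
    unfolding vanishing_ideal_def view_points_def image_points_def by auto
qed

lemma vanishing_image_iff':
  "F \<in> vanishing_ideal (multi_image_variety c) \<longleftrightarrow>
    (\<forall>l x. mpoly_eval F (\<lambda>i. l i *s line_through x (c i)) = 0)"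
  unfolding vanishing_image_iff vanishing_view_iff
  by (simp add: vector_scalar_commute line_through_center)

lemma image_points_subset: "image_points \<subseteq> concurrent_lines"
proof
  fix L assume "L \<in> image_points"
  then obtain x where x: "x \<noteq> 0" "\<And>i. proj_pt x \<noteq> proj_pt (c i)"
    and L: "L = (\<lambda>i. proj_pt (line_through x (c i)))"
    by (auto simp: image_points_def)
  have nz: "line_through x (c i) \<noteq> 0" for i
    using line_through_neq_0_iff[OF x(1) center_nonzero] x(2) by blast
  have "L i \<in> Gr" for i
    using x center_nonzero by (auto simp: L Gr_def)
  moreover have "on_line (proj_pt x) (L i)" for i
    using x(1) nz pluecker_matrix_line_through(1)[of x "c i"]
    by (auto simp: on_line_def L vec.span_singleton pluecker_matrix_scale_left
        vector_scalar_commute)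
  ultimately show "L \<in> concurrent_lines" by (auto simp: concurrent_lines_def)
qed

lemma concurrent_coords:
  assumes "L \<in> concurrent_lines" "v \<in> coords L"
  shows "\<exists>x. x \<noteq> 0 \<and> (\<forall>i. pluecker_matrix (v i) *v x = 0)"
proof -
  obtain U where U: "\<And>i. on_line U (L i)"
    using assms(1) by (auto simp: concurrent_lines_def)
  obtain x where x: "x \<noteq> 0" "U = proj_pt x" by (rule proj_cases)
  have "v i \<in> Rep_proj (L i)" for i using assms(2) by (simp add: coords_def)
  then have "pluecker_matrix (v i) *v x = 0" for i
    using U[of i] x by (auto simp: on_line_def vec.span_base)
  then show ?thesis using x by blast
qed

lemma vanishing_concurrentI:
  fixes F :: "('n, pluecker_index) mpoly"
  assumes "\<And>x y. mpoly_eval F (\<lambda>i. line_through x (y i)) = 0"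
  shows "F \<in> vanishing_ideal concurrent_lines"
  unfolding vanishing_ideal_def vanishes_at_def
proof (intro CollectI ballI)
  fix L :: "'n \<Rightarrow> pluecker_index proj" and v
  assume "L \<in> concurrent_lines" "v \<in> coords L"
  then obtain x where x: "x \<noteq> 0" "\<And>i. pluecker_matrix (v i) *v x = 0"
    using concurrent_coords by blast
  then have "\<forall>i. \<exists>w. v i = line_through w x" using line_through_of_incident by blast
  then obtain w where "\<And>i. v i = line_through (w i) x" by metis
  moreover have "line_through y x = line_through x (- y)" for y
    by (simp add: vec_eq_iff forall_pluecker_index)
  ultimately have "v = (\<lambda>i. line_through x (- w i))"
    by (simp add: fun_eq_iff)
  then show "mpoly_eval F v = 0" using assms by simp
qed

lemma line_subst_vanishing_concurrent:
  "line_subst B ` vanishing_ideal concurrent_lines = vanishing_ideal (multi_view_variety A)"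
proof
  show "line_subst B ` vanishing_ideal concurrent_lines \<subseteq> vanishing_ideal (multi_view_variety A)"
  proof
    fix f assume "f \<in> line_subst B ` vanishing_ideal concurrent_lines"
    then obtain F where F: "F \<in> vanishing_ideal concurrent_lines" "f = line_subst B F" by blast
    then have "F \<in> vanishing_ideal image_points"
      using image_points_subset by (auto simp: vanishing_ideal_def)
    then show "f \<in> vanishing_ideal (multi_view_variety A)"
      unfolding F(2) vanishing_image_iff[symmetric]
      by (simp add: multi_image_variety_eq vanishing_ideal_zariski_closure)
  qed
  show "vanishing_ideal (multi_view_variety A) \<subseteq> line_subst B ` vanishing_ideal concurrent_lines"
  proof
    fix f assume "f \<in> vanishing_ideal (multi_view_variety A)"
    then have "\<And>l x. mpoly_eval f (\<lambda>i. l i *s (A i *v x)) = 0"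
      by (simp add: vanishing_view_iff)
    then obtain F where "\<forall>x y. mpoly_eval F (\<lambda>i. line_through x (y i)) = 0" "f = line_subst B F"
      using lift_to_concurrent by blast
    then show "f \<in> line_subst B ` vanishing_ideal concurrent_lines"
      using vanishing_concurrentI by blast
  qed
qed

section \<open>The product of the cameras and its linear equations\<close>

lemma camera_line_iff:
  assumes "p \<noteq> 0"
  shows "proj_pt p \<in> pinhole_camera (c i) \<longleftrightarrow> pluecker_matrix p *v c i = 0"
proof
  assume "proj_pt p \<in> pinhole_camera (c i)"
  then show "pluecker_matrix p *v c i = 0"
    using assms center_nonzero by (auto simp: pinhole_camera_def on_line_def vec.span_base)
next
  assume p: "pluecker_matrix p *v c i = 0"
  then obtain w where w: "p = line_through w (c i)"
    using line_through_of_incident center_nonzero by blast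
  then have "w \<noteq> 0" using assms line_through_scale_left[of 0 0 "c i"] by auto
  then have "proj_pt p \<in> Gr"
    using assms line_through_neq_0_iff[of w "c i"] center_nonzero w by (auto simp: Gr_def)
  moreover have "on_line (proj_pt (c i)) (proj_pt p)"
    using assms center_nonzero p
    by (auto simp: on_line_def vec.span_singleton pluecker_matrix_scale_left vector_scalar_commute)
  ultimately show "proj_pt p \<in> pinhole_camera (c i)" by (simp add: pinhole_camera_def)
qed

lemma line_matrix_in_camera: "u \<noteq> 0 \<Longrightarrow> proj_pt (B i *v u) \<in> pinhole_camera (c i)"
  by (simp add: camera_line_iff line_matrix_eq_0_iff incident_center)

lemma line_matrix_left_inverse:
  "\<exists>B' R. \<forall>p. p = B i *v (B' *v p) + R *v (pluecker_matrix p *v c i)"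
proof -
  obtain W R where "\<And>p. p = line_through (W *v p) (c i) + R *v (pluecker_matrix p *v c i)"
    using line_through_left_inverse[OF center_nonzero] by blast
  then have "\<And>p. p = B i *v ((A i ** W) *v p) + R *v (pluecker_matrix p *v c i)"
    by (simp add: line_through_center flip: matrix_vector_mul_assoc)
  then show ?thesis by blast
qed

definition incidence_form :: "'n \<Rightarrow> 4 \<Rightarrow> ('n, pluecker_index) mpoly" where
  "incidence_form i b = (pluecker_matrix (\<chi> k. mvar i k) *v (\<chi> a. mconst (c i $ a))) $ b"

lemma mpoly_eval_incidence_form:
  "mpoly_eval (incidence_form i b) v = (pluecker_matrix (v i) *v c i) $ b"
  using exhaust_4'[of b]
  by (auto simp: incidence_form_def pluecker_matrix_mult_nth simp del: One_nat_def)

lemma camera_ideal_eq: "camera_ideal c = genideal ring_of_type_algebra {incidence_form i b | i b.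
    True}"
  by (simp add: camera_ideal_def incidence_form_def)

lemma camera_ideal_is_ideal: "ideal (camera_ideal c) ring_of_type_algebra"
  unfolding camera_ideal_eq by (rule ring.genideal_ideal[OF ring_from_type_algebra]) simp

lemma incidence_form_mem: "incidence_form i b \<in> camera_ideal c"
  unfolding camera_ideal_eq
  using ring.genideal_self[OF ring_from_type_algebra, of "{incidence_form i b | i b. True}"] by auto

lemma camera_ideal_closed:
  "0 \<in> camera_ideal c"
  "f \<in> camera_ideal c \<Longrightarrow> g \<in> camera_ideal c \<Longrightarrow> f + g \<in> camera_ideal c"
  "f \<in> camera_ideal c \<Longrightarrow> g * f \<in> camera_ideal c"
proof -
  note sub = ideal.axioms(1)[OF camera_ideal_is_ideal]
  show "0 \<in> camera_ideal c"
    using additive_subgroup.zero_closed[OF sub] by simp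
  show "f \<in> camera_ideal c \<Longrightarrow> g \<in> camera_ideal c \<Longrightarrow> f + g \<in> camera_ideal c"
    using additive_subgroup.a_closed[OF sub, of f g] by simp
  show "f \<in> camera_ideal c \<Longrightarrow> g * f \<in> camera_ideal c"
    using ideal.I_l_closed[OF camera_ideal_is_ideal, of f g] by simp
qed

lemma camera_ideal_sum:
  "finite S \<Longrightarrow> (\<And>x. x \<in> S \<Longrightarrow> f x \<in> camera_ideal c) \<Longrightarrow> sum f S \<in> camera_ideal c"
  by (induction S rule: finite_induct) (auto intro: camera_ideal_closed)

text \<open>\<open>\<Phi>\<close> projects every Pluecker vector to the plane of its camera,
  changing it by a combination of incidence forms. Hence \<open>F\<close> and its composite with
  \<open>\<Phi>\<close> agree modulo \<open>camera_ideal c\<close>, by induction on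
  \<open>F\<close>. The composite factors through \<open>line_subst B F\<close> and is zero when
  that is.\<close>

lemma line_subst_eq_0_iff: "line_subst B F = 0 \<longleftrightarrow> F \<in> camera_ideal c"
proof
  assume F0: "line_subst B F = 0"
  obtain B' R where BR: "\<And>i p. p = B i *v (B' i *v p) + R i *v (pluecker_matrix p *v c i)"
    using line_matrix_left_inverse by metis
  define \<Phi> where "\<Phi> = (\<lambda>v :: 'n \<Rightarrow> complex^pluecker_index. \<lambda>i. B i *v (B' i *v v i))"
  have \<Phi>: "mpoly_eval (linear_subst (\<lambda>i. B i ** B' i) G) v = mpoly_eval G (\<Phi> v)"
    for G :: "('n, pluecker_index) mpoly" and v
    by (simp add: \<Phi>_def matrix_vector_mul_assoc)
  have "\<exists>G\<in>camera_ideal c. \<forall>v. mpoly_eval F v = mpoly_eval F (\<Phi> v) + mpoly_eval G v" for F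
  proof (induction F rule: mpoly_induct)
    case (const a)
    show ?case using camera_ideal_closed(1) by (intro bexI[of _ 0]) simp_all
  next
    case (var i k)
    have "(\<Sum>b\<in>UNIV. mconst (R i $ k $ b) * incidence_form i b) \<in> camera_ideal c"
      by (intro camera_ideal_sum camera_ideal_closed(3) incidence_form_mem) simp
    moreover have "mpoly_eval (mvar i k) v = mpoly_eval (mvar i k) (\<Phi> v) +
        mpoly_eval (\<Sum>b\<in>UNIV. mconst (R i $ k $ b) * incidence_form i b) v" for v
      using arg_cong[OF BR[of "v i" i], of "\<lambda>p. p $ k"]
      by (simp add: \<Phi>_def matrix_vector_mult_def[of
          "R i"] mpoly_eval_incidence_form del: One_nat_def)
    ultimately show ?case by blast
  next
    case (add f g)
    then obtain f' g' where f': "f' \<in> camera_ideal c" "\<And>v. mpoly_eval f v = mpoly_eval f (\<Phi> v)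
        + mpoly_eval f' v"
      and g': "g' \<in> camera_ideal c" "\<And>v. mpoly_eval g v = mpoly_eval g (\<Phi> v) + mpoly_eval g' v"
          by blast
    have "mpoly_eval (f + g) v = mpoly_eval (f + g) (\<Phi> v) + mpoly_eval (f' + g') v" for v
      using f'(2)[of v] g'(2)[of v] by simp
    then show ?case using camera_ideal_closed(2)[OF f'(1) g'(1)] by blast
  next
    case (mult f g)
    then obtain f' g' where fg: "f' \<in> camera_ideal c" "\<And>v. mpoly_eval f v = mpoly_eval f (\<Phi> v)
        + mpoly_eval f' v"
      "g' \<in> camera_ideal c" "\<And>v. mpoly_eval g v = mpoly_eval g (\<Phi> v) + mpoly_eval g' v" by blast
    \<comment> \<open>The difference of the products: \<open>f * g\<close> minus its projection is
      \<open>f' * g\<close> plus the projection of \<open>f\<close> times \<open>g'\<close>.\<close>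
    define e where "e = g * f' + linear_subst (\<lambda>i. B i ** B' i) f * g'"
    have "e \<in> camera_ideal c"
      unfolding e_def using fg camera_ideal_closed by blast
    moreover have "mpoly_eval (f * g) v = mpoly_eval (f * g) (\<Phi> v) + mpoly_eval e v" for v
    proof -
      have e: "mpoly_eval e v = mpoly_eval g v * mpoly_eval f' v + mpoly_eval f (\<Phi> v)
          * mpoly_eval g' v"
        by (simp only: e_def mpoly_eval_add mpoly_eval_mult \<Phi>)
      then show ?thesis
        unfolding mpoly_eval_mult e fg(2)[of v] fg(4)[of v] by (simp add: algebra_simps)
    qed
    ultimately show ?case by blast
  qed
  then obtain G where G: "G \<in> camera_ideal c" "\<And>v. mpoly_eval F v = mpoly_eval F (\<Phi> v)
      + mpoly_eval G v" by blast
  have "mpoly_eval F (\<Phi> v) = mpoly_eval (line_subst B F) (\<lambda>i. B' i *v v i)" for v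
    by (simp add: \<Phi>_def)
  then have Z: "mpoly_eval F (\<Phi> v) = 0" for v by (simp only: F0 mpoly_eval_zero)
  have "mpoly_eval F v = mpoly_eval G v" for v
    using G(2)[of v] Z[of v] by simp
  then have "F = G" by (rule mpoly_eqI)
  then show "F \<in> camera_ideal c" using G(1) by simp
next
  assume F: "F \<in> camera_ideal c"
  have "ideal {F. line_subst B F = 0} ring_of_type_algebra"
    by (rule ideal_ring_of_type_algebraI)
      (auto simp: line_subst_add line_subst_mult line_subst_const[of B 0, simplified])
  moreover have "line_subst B (incidence_form i b) = 0" for i b
    by (rule mpoly_eqI) (simp add: mpoly_eval_incidence_form incident_center)
  ultimately have "camera_ideal c \<subseteq> {F. line_subst B F = 0}"
    unfolding camera_ideal_eq
    by (intro ring.genideal_minimal[OF ring_from_type_algebra]) auto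
  then show "line_subst B F = 0" using F by blast
qed

lemma a_kernel_line_subst:
  "a_kernel ring_of_type_algebra ring_of_type_algebra (line_subst B) = camera_ideal c"
  by (auto simp: a_kernel_def' line_subst_eq_0_iff)

lemma line_subst_ring_hom: "line_subst B \<in> ring_hom ring_of_type_algebra ring_of_type_algebra"
  by (rule ring_hom_memI) (simp_all add: line_subst_add line_subst_mult line_subst_const[of B 1,
      simplified])

lemma surj_line_subst: "surj (line_subst B)"
proof (rule surjI)
  have "\<exists>M. M ** B i = mat 1" for i
    unfolding matrix_left_invertible_ker by (simp add: line_matrix_eq_0_iff)
  then have ex: "\<exists>M. \<forall>i. M i ** B i = mat 1" by metis
  show "line_subst B (linear_subst (SOME M. \<forall>i. M i ** B i = mat 1) f) = f" for f
    using someI_ex[OF ex] by (intro mpoly_eqI) (simp add: matrix_vector_mul_assoc)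
qed

text \<open>If \<open>f\<close> and \<open>g\<close> are nonzero at two parameter values
  \<open>(l, x)\<close>, then on the line joining these both become nonzero polynomials in one
  variable, whose product cannot vanish.\<close>

lemma primeideal_multi_view: "primeideal (vanishing_ideal (multi_view_variety A))
    ring_of_type_algebra"
proof (rule primeidealI)
  show "ideal (vanishing_ideal (multi_view_variety A)) ring_of_type_algebra"
    by (rule ideal_ring_of_type_algebraI) (simp_all add: vanishing_view_iff)
  show "cring (ring_of_type_algebra :: ('n, 3) mpoly ring)" by (rule cring_from_type_algebra)
  show "carrier ring_of_type_algebra \<noteq> vanishing_ideal (multi_view_variety A)"
  proof
    assume "carrier ring_of_type_algebra = vanishing_ideal (multi_view_variety A)"
    then have "(1 :: ('n, 3) mpoly) \<in> vanishing_ideal (multi_view_variety A)" by auto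
    then show False by (simp add: vanishing_view_iff)
  qed
  fix f g :: "('n, 3) mpoly"
  assume "f \<otimes>\<^bsub>ring_of_type_algebra\<^esub> g \<in> vanishing_ideal (multi_view_variety A)"
  then have fg: "mpoly_eval f (\<lambda>i. l i *s (A i *v x)) * mpoly_eval g (\<lambda>i. l i *s (A i *v x)) = 0"
      for l x
    by (simp add: vanishing_view_iff)
  show "f \<in> vanishing_ideal (multi_view_variety A) \<or> g \<in> vanishing_ideal (multi_view_variety A)"
  proof (rule ccontr)
    assume "\<not> ?thesis"
    then obtain l x l' x' where
      f: "mpoly_eval f (\<lambda>i. l i *s (A i *v x)) \<noteq> 0" and g: "mpoly_eval g (\<lambda>i. l' i *s (A i *v x'))
          \<noteq> 0"
      by (auto simp: vanishing_view_iff)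
    define d where "d = x' - x"
    have x': "x' = x + d" by (simp add: d_def)
    define q where "q = (\<lambda>i j. [:l i, l' i - l i:] * [:(A i *v x) $ j, (A i *v d) $ j:])"
    have q: "(\<chi> j. poly (q i j) t) = (l i + t * (l' i - l i)) *s (A i *v (x + t *s d))" for i t
      by (simp add: q_def vec_eq_iff matrix_vector_right_distrib vector_scalar_commute
          algebra_simps)
    obtain P where P: "\<And>t. mpoly_eval f (\<lambda>i. \<chi> j. poly (q i j) t) = poly P t"
      using mpoly_eval_on_curve[of f q] by blast
    obtain Q where Q: "\<And>t. mpoly_eval g (\<lambda>i. \<chi> j. poly (q i j) t) = poly Q t"
      using mpoly_eval_on_curve[of g q] by blast
    have "poly (P * Q) t = 0" for t
      using fg[of "\<lambda>i. l i + t * (l' i - l i)" "x + t *s d"]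
      by (simp add: q flip: P Q)
    then have "P * Q = 0" using poly_all_0_iff_0 by blast
    moreover have "poly P 0 \<noteq> 0" using f by (simp add: q flip: P)
    moreover have "poly Q 1 \<noteq> 0" using g by (simp add: q x' flip: Q)
    ultimately show False by auto
  qed
qed

text \<open>If no common point of the lines \<^term>\<open>v i\<close> exists, the stacked matrices have a left
  inverse \<open>N\<close>; the determinant of \<open>N\<close> times the stacked matrices of unknowns then separates
  \<^term>\<open>v\<close> from the image points.\<close>

lemma common_point:
  assumes "\<And>F. F \<in> vanishing_ideal (multi_image_variety c) \<Longrightarrow> mpoly_eval F v = 0"
  shows "\<exists>x. x \<noteq> 0 \<and> (\<forall>i. pluecker_matrix (v i) *v x = 0)"
proof (rule ccontr)
  assume contra: "\<not> ?thesis"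
  define M :: "('n \<Rightarrow> complex^pluecker_index) \<Rightarrow> complex^4^('n \<times> 4)" where
    "M = (\<lambda>v. \<chi> ib. pluecker_matrix (v (fst ib)) $ snd ib)"
  have M: "(M v *v x) $ (i, b) = (pluecker_matrix (v i) *v x) $ b" for v x i b
    by (simp add: M_def matrix_vector_mult_def)
  have M0: "M v *v x = 0 \<longleftrightarrow> (\<forall>i. pluecker_matrix (v i) *v x = 0)" for v x
    by (simp add: vec_eq_iff split_paired_all M)
  have "\<forall>x. M v *v x = 0 \<longrightarrow> x = 0"
    using contra M0 by blast
  then obtain N where N: "N ** M v = mat 1"
    unfolding matrix_left_invertible_ker[symmetric] by (elim exE)
  have "(\<lambda>v. (N ** M v) $ a $ b) \<in> polyfuns" for a b
  proof -
    have "(\<lambda>v. \<Sum>k\<in>UNIV. N $ a $ k * pluecker_matrix (v (fst k)) $ snd k $ b) \<in> polyfuns"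
      by (intro polyfuns_sum polyfuns_mult polyfuns_const polyfuns_pluecker_matrix)
    then show ?thesis by (simp add: matrix_matrix_mult_def M_def)
  qed
  then have "(\<lambda>v. det (N ** M v)) \<in> polyfuns" by (rule polyfuns_det)
  then obtain F where F: "\<And>v. mpoly_eval F v = det (N ** M v)"
    unfolding polyfuns_iff by blast
  have "det (N ** M (\<lambda>i. l i *s line_through x (c i))) = 0" for l x
  proof (rule ccontr)
    let ?M = "M (\<lambda>i. l i *s line_through x (c i))"
    assume det: "det (N ** ?M) \<noteq> 0"
    have inj: "y = 0" if "?M *v y = 0" for y
    proof -
      have 0: "(N ** ?M) *v y = 0"
        using that by (simp flip: matrix_vector_mul_assoc)
      obtain N' where N': "N' ** (N ** ?M) = mat 1"
        using det by (auto simp: invertible_det_nz[symmetric] invertible_left_inverse)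
      have "y = N' *v ((N ** ?M) *v y)"
        unfolding matrix_vector_mul_assoc N' by simp
      then show "y = 0" by (simp only: 0 matrix_vector_mult_0_right)
    qed
    \<comment> \<open>The common point \<open>x\<close> lies in the kernel of all the matrices. If
      it is zero, then so are all the lines and matrices, and any nonzero vector contradicts
      injectivity.\<close>
    have "x = 0"
      by (rule inj) (simp add: M0 pluecker_matrix_scale_left pluecker_matrix_line_through)
    moreover have "line_through 0 y = 0" for y
      by (simp add: vec_eq_iff forall_pluecker_index)
    moreover have "pluecker_matrix 0 *v y = 0" for y :: "complex^4"
      by (simp add: vec_eq_iff forall_4' pluecker_matrix_mult_nth)
    ultimately have "?M *v vec4 1 0 0 0 = 0"
      by (simp add: M0)
    then have "vec4 1 0 0 0 = (0 :: complex^4)" by (rule inj)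
    then show False by (simp add: vec_eq_iff forall_4')
  qed
  then have "F \<in> vanishing_ideal (multi_image_variety c)"
    by (simp add: vanishing_image_iff' F)
  then have "mpoly_eval F v = 0" by (rule assms)
  then show False by (simp add: F N)
qed

text \<open>A common point different from all centers determines the lines by
  \<open>line_unique\<close>. If it is the center \<open>c j\<close>, the other lines are still
  determined, but line \<open>j\<close> is any line through \<open>c j\<close>; such tuples are
  limits of image tuples.\<close>

lemma multi_image_variety_eq_Int:
  "multi_image_variety c = concurrent_lines \<inter> {L. \<forall>i. L i \<in> pinhole_camera (c i)}"
proof (rule Set.set_eqI)
  fix U :: "'n \<Rightarrow> pluecker_index proj"
  obtain v where v: "v \<in> coords U" "U = (\<lambda>i. proj_pt (v i))" "\<And>i. v i \<noteq> 0"
    using coords_ex[of U] by blast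
  have mem: "U \<in> multi_image_variety c \<longleftrightarrow> (\<forall>F\<in>vanishing_ideal (multi_image_variety c). vanishes_at
      F U)"
    unfolding multi_image_variety_eq vanishing_ideal_zariski_closure by (rule zariski_closure_iff)
  show "U \<in> multi_image_variety c \<longleftrightarrow> U \<in> concurrent_lines \<inter> {L. \<forall>i. L i \<in> pinhole_camera (c i)}"
  proof
    assume "U \<in> multi_image_variety c"
    then have van: "mpoly_eval F v = 0" if "F \<in> vanishing_ideal (multi_image_variety c)" for F
      using mem that v(1) by (auto simp: vanishes_at_def)
    have "incidence_form i b \<in> vanishing_ideal (multi_image_variety c)" for i b
      by (simp add: vanishing_image_iff' mpoly_eval_incidence_form pluecker_matrix_scale_left
          pluecker_matrix_line_through)
    from van[OF this] have "pluecker_matrix (v i) *v c i = 0" for i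
      by (simp add: mpoly_eval_incidence_form vec_eq_iff)
    then have cam: "U i \<in> pinhole_camera (c i)" for i
      using camera_line_iff[OF v(3)] v(2) by simp
    obtain x where x: "x \<noteq> 0" "\<And>i. pluecker_matrix (v i) *v x = 0"
      using common_point[OF van] by blast
    then have "on_line (proj_pt x) (U i)" for i
      using v(2,3) by (auto simp: on_line_def vec.span_singleton pluecker_matrix_scale_left
          vector_scalar_commute)
    moreover have "U i \<in> Gr" for i using cam[of i] by (simp add: pinhole_camera_def)
    ultimately show "U \<in> concurrent_lines \<inter> {L. \<forall>i. L i \<in> pinhole_camera (c i)}"
      using cam by (auto simp: concurrent_lines_def)
  next
    assume U: "U \<in> concurrent_lines \<inter> {L. \<forall>i. L i \<in> pinhole_camera (c i)}"
    show "U \<in> multi_image_variety c"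
      unfolding mem vanishes_at_def
    proof (intro ballI)
      fix F v assume F: "F \<in> vanishing_ideal (multi_image_variety c)" and v: "v \<in> coords U"
      have F0: "mpoly_eval F (\<lambda>i. l i *s line_through x (c i)) = 0" for l x
        using F by (simp add: vanishing_image_iff')
      obtain x where x: "x \<noteq> 0" "\<And>i. pluecker_matrix (v i) *v x = 0"
        using concurrent_coords U v by blast
      have vc: "pluecker_matrix (v i) *v c i = 0" for i
      proof -
        have "proj_pt (v i) \<in> pinhole_camera (c i)"
          using U coords_eq_proj_pt(1)[OF v] by (metis (mono_tags, lifting) IntD2 mem_Collect_eq)
        then show ?thesis using camera_line_iff[OF coords_eq_proj_pt(2)[OF v]] by blast
      qed
      have "\<exists>a. A i *v x \<noteq> 0 \<longrightarrow> v i = a *s line_through x (c i)" for i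
        using line_unique[OF x(2) vc] line_through_center_eq_0_iff by blast
      then obtain a where a: "\<And>i. A i *v x \<noteq> 0 \<Longrightarrow> v i = a i *s line_through x (c i)" by metis
      show "mpoly_eval F v = 0"
      proof (cases "\<forall>i. A i *v x \<noteq> 0")
        case True
        then have "v = (\<lambda>i. a i *s line_through x (c i))" using a by blast
        then show ?thesis using F0 by simp
      next
        case False
        then obtain j where j: "A j *v x = 0" by blast
        then obtain b where b: "x = b *s c j" using camera_eq_0_iff by blast
        then have "b \<noteq> 0" using x(1) by auto
        have other: "A i *v x \<noteq> 0" if "i \<noteq> j" for i
          using camera_other_center[OF that] \<open>b \<noteq> 0\<close> by (simp add: b vector_scalar_commute)
        obtain w where w: "v j = line_through w (c j)"
          using line_through_of_incident[OF vc center_nonzero] by blast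
        \<comment> \<open>The point moves away from \<open>c j\<close> along line \<open>j\<close>.
          Entry \<open>j\<close> of its image is \<open>t *s v j\<close>, a multiple of the fixed
          vector \<open>v j\<close>; replacing it by \<open>v j\<close> makes the path continuous at
          \<open>t = 0\<close>, where it arrives at \<open>v\<close>.\<close>
        define p where "p = (\<lambda>t i. if i = j then v j else a i *s line_through (x + t *s w) (c i))"
        have "mpoly_eval F (p t) = 0" if "t \<notin> {0}" for t
        proof -
          have "line_through (x + t *s w) (c j) = t *s v j"
            by (simp add: line_through_add_left line_through_scale_left w b)
          then have "p t = (\<lambda>i. (if i = j then 1 / t else a i) *s line_through (x + t *s w) (c i))"
            using that by (auto simp: p_def fun_eq_iff)
          then show ?thesis using F0 by simp
        qed
        moreover have "continuous_on UNIV (\<lambda>t. mpoly_eval F (p t))"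
        proof (rule continuous_on_mpoly_eval)
          show "continuous_on UNIV (\<lambda>t. p t i)" for i
          proof (cases "i = j")
            case False
            then have "p t i = (\<chi> k. a i * (line_through x (c i) $ k + t
                * line_through w (c i) $ k))" for t
              by (simp add: p_def line_through_add_left line_through_scale_left vec_eq_iff
                  algebra_simps)
            then show ?thesis by (simp add: continuous_intros)
          qed (simp add: p_def)
        qed
        ultimately have "mpoly_eval F (p 0) = 0"
          using continuous_zero_cofinite[of "\<lambda>t. mpoly_eval F (p t)" "{0}"] by blast
        moreover have "p 0 = v" using a other by (auto simp: p_def fun_eq_iff)
        ultimately show ?thesis by simp
      qed
    qed
  qed
qed

text \<open>The ideal of the concurrent lines already maps onto the multi-view ideal. An
  \<open>F\<close> in the multi-image ideal therefore has the same image as some \<open>G\<close> of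
  the former, and \<open>F - G\<close> lies in the kernel of \<open>line_subst B\<close>.\<close>

lemma vanishing_image_eq_sum:
  "vanishing_ideal (multi_image_variety c) =
     set_add ring_of_type_algebra (vanishing_ideal concurrent_lines) (camera_ideal c)"
proof
  show "vanishing_ideal (multi_image_variety c) \<subseteq>
      set_add ring_of_type_algebra (vanishing_ideal concurrent_lines) (camera_ideal c)"
  proof
    fix F assume "F \<in> vanishing_ideal (multi_image_variety c)"
    then have "line_subst B F \<in> line_subst B ` vanishing_ideal concurrent_lines"
      by (simp only: line_subst_vanishing_concurrent vanishing_image_iff)
    then obtain G where G: "G \<in> vanishing_ideal concurrent_lines" "line_subst B F = line_subst B G"
      by (rule imageE)
    have "line_subst B (F - G) = 0"
      by (rule mpoly_eqI) (use arg_cong[OF G(2), of mpoly_eval] in \<open>simp add: fun_eq_iff\<close>)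
    then have "F - G \<in> camera_ideal c" by (simp only: line_subst_eq_0_iff)
    moreover have "F = G + (F - G)" by simp
    ultimately show "F \<in> set_add ring_of_type_algebra (vanishing_ideal concurrent_lines)
        (camera_ideal c)"
      unfolding set_add_def' ring_of_type_algebra_simps using G(1) by blast
  qed
  show "set_add ring_of_type_algebra (vanishing_ideal concurrent_lines) (camera_ideal c) \<subseteq>
      vanishing_ideal (multi_image_variety c)"
  proof
    fix F assume "F \<in> set_add ring_of_type_algebra (vanishing_ideal concurrent_lines)
        (camera_ideal c)"
    then obtain G H where GH: "G \<in> vanishing_ideal concurrent_lines" "H \<in> camera_ideal c" "F = G
        + H"
      unfolding set_add_def' ring_of_type_algebra_simps by blast
    have "line_subst B H = 0" using GH(2) by (simp only: line_subst_eq_0_iff)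
    then have "line_subst B F = line_subst B G" by (simp add: GH(3) line_subst_add)
    then show "F \<in> vanishing_ideal (multi_image_variety c)"
      using GH(1) by (simp add: vanishing_image_iff flip: line_subst_vanishing_concurrent)
  qed
qed

text \<open>Left inverses \<open>M i\<close> of the injective \<open>B i\<close> give the inverse
  morphism. It is defined on the multi-image variety because each line there passes through its
  center and so has its coordinates in the range of \<open>B i\<close>.\<close>

lemma isomorphism:
  "variety_isomorphism (multi_view_variety A) (multi_image_variety c) (\<lambda>U i. proj_map (B i) (U i))"
proof -
  have "\<exists>M. M ** B i = mat 1" for i
    unfolding matrix_left_invertible_ker by (simp add: line_matrix_eq_0_iff)
  then obtain M where M: "\<And>i. M i ** B i = mat 1" by metis
  have MB: "M i *v (B i *v u) = u" for i u
    by (simp add: matrix_vector_mul_assoc M)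
  let ?\<phi> = "\<lambda>U i. proj_map (B i) (U i)" and ?\<psi> = "\<lambda>W i. proj_map (M i) (W i)"
  have \<phi>_pt: "?\<phi> (\<lambda>i. proj_pt (u i)) = (\<lambda>i. proj_pt (B i *v u i))" if "\<And>i. u i \<noteq> 0" for u
    using that by (simp add: proj_map_pt)
  have \<psi>_pt: "?\<psi> (\<lambda>i. proj_pt (B i *v u i)) = (\<lambda>i. proj_pt (u i))" if "\<And>i. u i \<noteq> 0" for u
    using that by (simp add: proj_map_pt MB line_matrix_eq_0_iff)
  \<comment> \<open>As \<open>line_subst B\<close> is surjective, the pullbacks of the multi-image
    ideal exhaust the multi-view ideal, so both memberships test the same polynomials.\<close>
  have transfer: "(\<lambda>i. proj_pt (B i *v u i)) \<in> multi_image_variety c \<longleftrightarrow>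
      (\<lambda>i. proj_pt (u i)) \<in> multi_view_variety A" if u: "\<And>i. u i \<noteq> 0" for u
  proof -
    have Bu: "B i *v u i \<noteq> 0" for i using u by (simp add: line_matrix_eq_0_iff)
    have van: "vanishes_at F (\<lambda>i. proj_pt (B i *v u i))
        \<longleftrightarrow> vanishes_at (line_subst B F) (\<lambda>i. proj_pt (u i))" for F
      by (simp add: vanishes_at_proj_pt[of "\<lambda>i. B i
          *v u i", OF Bu] vanishes_at_proj_pt[of u, OF u] vector_scalar_commute)
    have "(\<lambda>i. proj_pt (B i *v u i)) \<in> multi_image_variety c \<longleftrightarrow>
        (\<forall>F\<in>vanishing_ideal (multi_image_variety c). vanishes_at F (\<lambda>i. proj_pt (B i *v u i)))"
      unfolding multi_image_variety_eq vanishing_ideal_zariski_closure by (rule zariski_closure_iff)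
    also have "\<dots> \<longleftrightarrow> (\<forall>F. line_subst B F \<in> vanishing_ideal (multi_view_variety A) \<longrightarrow>
        vanishes_at (line_subst B F) (\<lambda>i. proj_pt (u i)))"
      by (simp add: Ball_def vanishing_image_iff van)
    also have "\<dots> \<longleftrightarrow> (\<forall>f\<in>vanishing_ideal (multi_view_variety A). vanishes_at f (\<lambda>i. proj_pt (u i)))"
      using surj_line_subst by (metis surjD)
    also have "\<dots> \<longleftrightarrow> (\<lambda>i. proj_pt (u i)) \<in> multi_view_variety A"
      unfolding multi_view_variety_eq vanishing_ideal_zariski_closure
          by (rule zariski_closure_iff[symmetric])
    finally show ?thesis .
  qed
  have view: "\<exists>u. (\<forall>i. u i \<noteq> 0) \<and> U = (\<lambda>i. proj_pt (u i))" for U :: "'n \<Rightarrow> 3 proj"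
    using coords_ex[of U] by blast
  have image: "\<exists>u. (\<forall>i. u i \<noteq> 0) \<and> v = (\<lambda>i. B i *v u i)"
    if "W \<in> multi_image_variety c" "v \<in> coords W" for W v
  proof -
    have "\<exists>u. u \<noteq> 0 \<and> v i = B i *v u" for i
    proof -
      have "W i \<in> pinhole_camera (c i)"
        using that(1) by (simp add: multi_image_variety_eq_Int)
      moreover have "W i = proj_pt (v i)" and nz: "v i \<noteq> 0"
        using coords_eq_proj_pt[OF that(2)] by (simp add: fun_eq_iff)+
      ultimately have "pluecker_matrix (v i) *v c i = 0"
        using camera_line_iff by simp
      then obtain w where "v i = line_through w (c i)"
        using line_through_of_incident center_nonzero by blast
      then have "v i = B i *v (A i *v w)" by (simp add: line_through_center)
      then show ?thesis using nz by (intro exI[of _ "A i *v w"]) auto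
    qed
    then show ?thesis by (metis (no_types, lifting) ext)
  qed
  have image_pt: "\<exists>u. (\<forall>i. u i \<noteq> 0) \<and> W = (\<lambda>i. proj_pt (B i *v u i))"
    if "W \<in> multi_image_variety c" for W
    using coords_ex[of W] image[OF that] by blast
  have "variety_morphism (multi_view_variety A) (multi_image_variety c) ?\<phi>"
    unfolding variety_morphism_def
  proof
    show "?\<phi> ` multi_view_variety A \<subseteq> multi_image_variety c"
    proof
      fix W assume "W \<in> ?\<phi> ` multi_view_variety A"
      then obtain U where U: "U \<in> multi_view_variety A" "W = ?\<phi> U" by blast
      obtain u where u: "\<forall>i. u i \<noteq> 0" "U = (\<lambda>i. proj_pt (u i))" using view by blast
      show "W \<in> multi_image_variety c"
        using U u transfer[of u] \<phi>_pt[of u] by simp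
    qed
    show "regular_on (multi_view_variety A) ?\<phi>"
      by (rule regular_on_linear) (simp add: coords_def line_matrix_eq_0_iff)
  qed
  moreover have "variety_morphism (multi_image_variety c) (multi_view_variety A) ?\<psi>"
    unfolding variety_morphism_def
  proof
    show "?\<psi> ` multi_image_variety c \<subseteq> multi_view_variety A"
    proof
      fix U assume "U \<in> ?\<psi> ` multi_image_variety c"
      then obtain W where W: "W \<in> multi_image_variety c" "U = ?\<psi> W" by blast
      obtain u where u: "\<forall>i. u i \<noteq> 0" "W = (\<lambda>i. proj_pt (B i *v u i))"
        using image_pt[OF W(1)] by blast
      show "U \<in> multi_view_variety A"
        using W u transfer[of u] \<psi>_pt[of u] by simp
    qed
    show "regular_on (multi_image_variety c) ?\<psi>"
    proof (rule regular_on_linear)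
      fix W v i assume "W \<in> multi_image_variety c" "v \<in> coords W"
      then obtain u where "\<forall>i. u i \<noteq> 0" "v = (\<lambda>i. B i *v u i)" using image by blast
      then show "M i *v v i \<noteq> 0" by (simp add: MB)
    qed
  qed
  moreover have "?\<psi> (?\<phi> U) = U" for U
  proof -
    obtain u where "\<forall>i. u i \<noteq> 0" "U = (\<lambda>i. proj_pt (u i))" using view by blast
    then show ?thesis by (simp add: proj_map_pt MB line_matrix_eq_0_iff)
  qed
  moreover have "?\<phi> (?\<psi> W) = W" if W: "W \<in> multi_image_variety c" for W
  proof -
    obtain u where "\<forall>i. u i \<noteq> 0" "W = (\<lambda>i. proj_pt (B i *v u i))"
      using image_pt[OF W] by blast
    then show ?thesis by (simp add: proj_map_pt MB line_matrix_eq_0_iff)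
  qed
  ultimately show ?thesis
    unfolding variety_isomorphism_def by (intro conjI exI[of _ ?\<psi>]) auto
qed

end

theorem proposition5p3:
  fixes c :: "'n::finite \<Rightarrow> complex^4"
    and A :: "'n \<Rightarrow> complex^4^3"
    and B :: "'n \<Rightarrow> complex^3^pluecker_index"
  assumes "\<And>i. c i \<noteq> 0"
    and "inj (\<lambda>i. proj_pt (c i))"
    and "\<And>i. rank (A i) = 3"
    and "\<And>i. {x. A i *v x = 0} = vec.span {c i}"
    and "\<And>i x. line_through x (c i) = B i *v (A i *v x)"
  shows
    "(\<forall>i u. u \<noteq> 0 \<longrightarrow> B i *v u \<noteq> 0 \<and> proj_map (B i) (proj_pt u) = proj_pt (B i *v u)
        \<and> proj_map (B i) (proj_pt u) \<in> Gr) \<and>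
     variety_isomorphism (multi_view_variety A) (multi_image_variety c)
       (\<lambda>U i. proj_map (B i) (U i)) \<and>
     multi_image_variety c = concurrent_lines \<inter> {L. \<forall>i. L i \<in> pinhole_camera (c i)} \<and>
     vanishing_ideal (multi_image_variety c) =
       set_add ring_of_type_algebra (vanishing_ideal concurrent_lines) (camera_ideal c) \<and>
     line_subst B \<in> ring_hom ring_of_type_algebra ring_of_type_algebra \<and>
     surj (line_subst B) \<and>
     a_kernel ring_of_type_algebra ring_of_type_algebra (line_subst B) = camera_ideal c \<and>
     primeideal (vanishing_ideal (multi_view_variety A)) ring_of_type_algebra \<and>
     vanishing_ideal (multi_view_variety A) = line_subst B ` vanishing_ideal concurrent_lines"
proof -
  interpret pinhole_cameras c A B
    using assms by unfold_locales
  have "B i *v u \<noteq> 0 \<and> proj_map (B i) (proj_pt u) = proj_pt (B i *v u) \<and> proj_map (B i) (proj_pt u) \<in> Gr"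
    if "u \<noteq> 0" for i u
    using that line_matrix_in_camera[OF that, of i]
    by (simp add: line_matrix_eq_0_iff proj_map_pt pinhole_camera_def)
  then show ?thesis
    using isomorphism multi_image_variety_eq_Int vanishing_image_eq_sum line_subst_ring_hom
      surj_line_subst a_kernel_line_subst primeideal_multi_view line_subst_vanishing_concurrent
    by blast
qed

end
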